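(* Let $\mathfrak h$ be a finite-dimensional abelian Lie algebra over $\mathbb{C}$ with nondegenerate symmetric bilinear form $\langle\cdot,\cdot\rangle$, $d=\dim\mathfrak h$, let $\{\alpha_q\}_{q=1}^d$ be an orthonormal basis, and let $\nu$ be an isometry of $\mathfrak h$ of period $p>0$ preserving a rational lattice in $\mathfrak h$. Let $L^{(r_1,r_2)}(n)$ and $\bar L^{(r_1,r_2)}(n)$ be the operators on $S[\nu]$ defined in the context, and put $L^{(r)}(n)=L^{(r,r)}(n)$, $\bar L^{(r)}(n)=\bar L^{(r,r)}(n)$ for $n\in\mathbb{Z}$, $r\in\mathbb{N}$. (a) The assignment $L_n^{(r)}\mapsto L^{(r)}(n)$, $c\mapsto d$, defines a representation of the Lie algebra $\hat{\mathcal D}^+$ on $S[\nu]$. (b) The assignment $\bar L_n^{(r)}\mapsto\bar L^{(r)}(n)$, $c\mapsto d$, also defines a representation of the Lie algebra $\hat{\mathcal D}^+$ on $S[\nu]$, with the central term being a pure monomial, i.e. $$[\bar L^{(r)}(m),\bar L^{(s)}(n)]=\sum_{i=\min(r,s)}^{r+s}a_i^{(r,s)}(m,n)\bar L^{(i)}(m+n)+\frac{((r+s+1)!)^2}{2(2(r+s)+3)!}m^{2(r+s)+3}\delta_{m+n,0}\,d,$$ where $a_i^{(r,s)}(m,n)$ are the structure constants of $\hat{\mathcal D}^+$ with respect to the elements $\bar L_n^{(r)}$.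
   Context: $\mathbb{N}$ denotes the nonnegative integers. The Lie algebra $\hat{\mathcal D}^+$: $\mathcal D$ is the Lie algebra of formal differential operators on $\mathbb{C}^\times$ spanned by $t^nD^r$, $D=t\frac{d}{dt}$, $n\in\mathbb{Z}$, $r\in\mathbb{N}$. Let $\Psi$ be the 2-cocycle on $\mathcal D$ determined by $\Psi(t^mf(D),t^ng(D))=-\Psi(t^ng(D),t^mf(D))=\delta_{m+n,0}\sum_{i=1}^mf(-i)g(m-i)$ for $m>0$ ($f,g$ polynomials). $\mathcal D^+$ is the Lie subalgebra of $\mathcal D$ generated by $L_n^{(r)}=(-1)^{r+1}D^r(t^nD)D^r$ ($n\in\mathbb{Z},r\in\mathbb{N}$), and $\hat{\mathcal D}^+=\mathbb{C}c\oplus\mathcal D^+$ is its central extension by the 2-cocycle $-\frac12\Psi$; $L_n^{(r)}$ are viewed as elements of $\hat{\mathcal D}^+$. Put $\bar L_n^{(r)}=L_n^{(r)}+\frac{(-1)^r}{2}\zeta(-1-2r)\delta_{n,0}c$ ($\zeta$ the Riemann zeta function). In $\hat{\mathcal D}^+$ these satisfy $[\bar L_m^{(r)},\bar L_n^{(s)}]=\sum_{i=\min(r,s)}^{r+s}a_i^{(r,s)}(m,n)\bar L_{m+n}^{(i)}+\frac{((r+s+1)!)^2}{2(2(r+s)+3)!}m^{2(r+s)+3}\delta_{m+n,0}\,c$ for structure constants $a_i^{(r,s)}(m,n)$. Twisted space: isometry of period $p$ means $\langle\nu\alpha,\nu\beta\rangle=\langle\alpha,\beta\rangle$, $\nu^p=1$.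 Fix a primitive $p$-th root of unity $\omega_p$; $\mathfrak h_{(r)}=\{\alpha\in\mathfrak h:\nu\alpha=\omega_p^r\alpha\}$ ($r\in\mathbb{Z}$), $\alpha_{(r)}$ is the projection of $\alpha$ on $\mathfrak h_{(r)}$. $\hat{\mathfrak h}[\nu]=\coprod_{n\in\frac1p\mathbb{Z}}\mathfrak h_{(pn)}\otimes t^n\oplus\mathbb{C}C$, with $C$ central and $[\alpha\otimes t^m,\beta\otimes t^n]=\langle\alpha,\beta\rangle m\delta_{m+n,0}C$ for $\alpha\in\mathfrak h_{(pm)},\beta\in\mathfrak h_{(pn)}$. $\hat{\mathfrak h}[\nu]^{\pm}=\coprod_{\pm n>0}\mathfrak h_{(pn)}\otimes t^n$. $S[\nu]=\mathcal U(\hat{\mathfrak h}[\nu])\otimes_{\mathcal U(\hat{\mathfrak h}[\nu]^+\oplus\mathfrak h_{(0)}\oplus\mathbb{C}C)}\mathbb{C}\simeq S(\hat{\mathfrak h}[\nu]^-)$, where $\hat{\mathfrak h}[\nu]^+\oplus\mathfrak h_{(0)}$ acts trivially on $\mathbb{C}$ and $C$ acts as $1$. For $\alpha\in\mathfrak h$, $n\in\frac1p\mathbb{Z}$, $\alpha(n)$ denotes the action of $\alpha_{(pn)}\otimes t^n$ on $S[\nu]$, and $\alpha^\nu\langle x\rangle=\sum_{n\in\frac1p\mathbb{Z}}\alpha(n)x^{-n}$. Operators: with $:\cdot:$ normal ordering, placing $\alpha(n)$ with $n>0$ to the right, $$L^{\nu;y_1,y_2}\langle x\rangle=\frac12\sum_{q=1}^d:\alpha_q^\nu\langle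 e^{y_1}x\rangle\alpha_q^\nu\langle e^{y_2}x\rangle:-\frac12\frac{\partial}{\partial y_1}\Big(\sum_{k=0}^{p-1}\frac{\big(e^{k(-y_1+y_2)/p}-1\big)\dim\mathfrak h_{(k)}}{1-e^{-y_1+y_2}}\Big),$$ $$\bar L^{\nu;y_1,y_2}\langle x\rangle=\frac12\sum_{q=1}^d:\alpha_q^\nu\langle e^{y_1}x\rangle\alpha_q^\nu\langle e^{y_2}x\rangle:-\frac12\frac{\partial}{\partial y_1}\Big(\sum_{k=0}^{p-1}\frac{e^{k(-y_1+y_2)/p}\dim\mathfrak h_{(k)}}{1-e^{-y_1+y_2}}\Big),$$ and $L^{(r_1,r_2)}(n),\bar L^{(r_1,r_2)}(n)$ are defined by $$L^{\nu;y_1,y_2}\langle x\rangle=\sum_{n\in\mathbb{Z},\,r_1,r_2\in\mathbb{N}}L^{(r_1,r_2)}(n)x^{-n}\frac{y_1^{r_1}y_2^{r_2}}{r_1!r_2!},\qquad\bar L^{\nu;y_1,y_2}\langle x\rangle=\frac12\frac{d}{(y_1-y_2)^2}+\sum_{n\in\mathbb{Z},\,r_1,r_2\in\mathbb{N}}\bar L^{(r_1,r_2)}(n)x^{-n}\frac{y_1^{r_1}y_2^{r_2}}{r_1!r_2!}.$$ *)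

theory Defs
  imports
    "HOL-Complex_Analysis.Complex_Analysis"
    "HOL-Computational_Algebra.Computational_Algebra"
    "HOL-Library.Poly_Mapping"
    "HOL-Library.Product_Plus"
begin

section \<open>The Riemann zeta function\<close>

text \<open>The analytic continuation is unique on the complement of \<open>1\<close>; its value at \<open>1\<close> is left
  unspecified and never used.\<close>

definition riemann_zeta :: "complex \<Rightarrow> complex" where
  "riemann_zeta = (SOME f. f holomorphic_on (- {1}) \<and>
     (\<forall>s. Re s > 1 \<longrightarrow> (\<lambda>n. 1 / of_nat (Suc n) powr s) sums f s))"


section \<open>Representations and induced modules of complex Lie algebras\<close>

text \<open>A Lie algebra is given by a carrier \<open>G\<close>, a scalar multiplication \<open>sG\<close> and a bracket \<open>br\<close>;
  \<open>sV\<close> is the scalar multiplication of the (whole-type) representation space.\<close>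

definition lie_representation ::
  "'g::ab_group_add set \<Rightarrow> (complex \<Rightarrow> 'g \<Rightarrow> 'g) \<Rightarrow> ('g \<Rightarrow> 'g \<Rightarrow> 'g) \<Rightarrow>
   (complex \<Rightarrow> 'v::ab_group_add \<Rightarrow> 'v) \<Rightarrow> ('g \<Rightarrow> 'v \<Rightarrow> 'v) \<Rightarrow> bool" where
  "lie_representation G sG br sV \<rho> \<longleftrightarrow>
     vector_space sV \<and>
     (\<forall>x\<in>G. Vector_Spaces.linear sV sV (\<rho> x)) \<and>
     (\<forall>x\<in>G. \<forall>y\<in>G. \<forall>v. \<rho> (x + y) v = \<rho> x v + \<rho> y v) \<and>
     (\<forall>c. \<forall>x\<in>G. \<forall>v. \<rho> (sG c x) v = sV c (\<rho> x v)) \<and>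
     (\<forall>x\<in>G. \<forall>y\<in>G. \<forall>v. \<rho> (br x y) v = \<rho> x (\<rho> y v) - \<rho> y (\<rho> x v))"

text \<open>Linear combinations of words (lists of elements of \<open>G\<close>) form the free associative algebra on
  the set \<open>G\<close>.  Dividing by the two-sided ideal generated by the first three families below gives
  \<open>U(G)\<close>; dividing further by the left ideal generated by the elements \<open>b - \<theta>(b)\<close>, \<open>b \<in> B\<close>, gives
  \<open>U(G) \<otimes>\<^bsub>U(B)\<^esub> \<complex>\<close>, where the subalgebra \<open>B\<close> acts on \<open>\<complex>\<close> by the character \<open>\<theta>\<close>.\<close>

abbreviation word :: "'g list \<Rightarrow> ('g list \<Rightarrow>\<^sub>0 complex)" where
  "word u \<equiv> Poly_Mapping.single u 1"

abbreviation scale_words :: "complex \<Rightarrow> ('g list \<Rightarrow>\<^sub>0 complex) \<Rightarrow> ('g list \<Rightarrow>\<^sub>0 complex)" where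
  "scale_words c \<equiv> Poly_Mapping.map (\<lambda>a. c * a)"

definition induced_relations ::
  "'g::ab_group_add set \<Rightarrow> (complex \<Rightarrow> 'g \<Rightarrow> 'g) \<Rightarrow> ('g \<Rightarrow> 'g \<Rightarrow> 'g) \<Rightarrow> 'g set \<Rightarrow> ('g \<Rightarrow> complex) \<Rightarrow>
   ('g list \<Rightarrow>\<^sub>0 complex) set" where
  "induced_relations G sG br B \<theta> = module.span scale_words (
     {word (u @ [x + y] @ w) - word (u @ [x] @ w) - word (u @ [y] @ w) | u w x y.
        u \<in> lists G \<and> w \<in> lists G \<and> x \<in> G \<and> y \<in> G} \<union>
     {word (u @ [sG c x] @ w) - scale_words c (word (u @ [x] @ w)) | u w c x.
        u \<in> lists G \<and> w \<in> lists G \<and> x \<in> G} \<union>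
     {word (u @ [x, y] @ w) - word (u @ [y, x] @ w) - word (u @ [br x y] @ w) | u w x y.
        u \<in> lists G \<and> w \<in> lists G \<and> x \<in> G \<and> y \<in> G} \<union>
     {word (u @ [b]) - scale_words (\<theta> b) (word u) | u b. u \<in> lists G \<and> b \<in> B})"

definition word_eval ::
  "(complex \<Rightarrow> 'v::ab_group_add \<Rightarrow> 'v) \<Rightarrow> ('g \<Rightarrow> 'v \<Rightarrow> 'v) \<Rightarrow> 'v \<Rightarrow> ('g list \<Rightarrow>\<^sub>0 complex) \<Rightarrow> 'v" where
  "word_eval sV \<rho> v0 w = (\<Sum>u\<in>Poly_Mapping.keys w. sV (Poly_Mapping.lookup w u) (foldr \<rho> u v0))"

text \<open>\<open>\<rho>\<close> makes the space a model of \<open>U(G) \<otimes>\<^bsub>U(B)\<^esub> \<complex>\<close> in which \<open>v0\<close> is \<open>1 \<otimes> 1\<close>: the evaluation of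
  words at \<open>v0\<close> is onto and its kernel consists exactly of the defining relations.  This determines
  the module up to a unique isomorphism respecting \<open>v0\<close>.\<close>

definition is_induced_module ::
  "'g::ab_group_add set \<Rightarrow> (complex \<Rightarrow> 'g \<Rightarrow> 'g) \<Rightarrow> ('g \<Rightarrow> 'g \<Rightarrow> 'g) \<Rightarrow> 'g set \<Rightarrow> ('g \<Rightarrow> complex) \<Rightarrow>
   (complex \<Rightarrow> 'v::ab_group_add \<Rightarrow> 'v) \<Rightarrow> ('g \<Rightarrow> 'v \<Rightarrow> 'v) \<Rightarrow> 'v \<Rightarrow> bool" where
  "is_induced_module G sG br B \<theta> sV \<rho> v0 \<longleftrightarrow>
     lie_representation G sG br sV \<rho> \<and>
     (\<forall>v. \<exists>w. Poly_Mapping.keys w \<subseteq> lists G \<and> word_eval sV \<rho> v0 w = v) \<and>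
     (\<forall>w. Poly_Mapping.keys w \<subseteq> lists G \<longrightarrow>
        (word_eval sV \<rho> v0 w = 0 \<longleftrightarrow> w \<in> induced_relations G sG br B \<theta>))"


section \<open>Differential operators on the punctured plane and the algebra D-hat-plus\<close>

text \<open>The finitely supported family \<open>n \<mapsto> f\<^sub>n\<close> of polynomials stands for \<open>\<Sum>\<^sub>n t\<^sup>n f\<^sub>n(D)\<close>.\<close>

type_synonym dop = "int \<Rightarrow>\<^sub>0 complex poly"

definition dop_scale :: "complex \<Rightarrow> dop \<Rightarrow> dop" where
  "dop_scale c = Poly_Mapping.map (smult c)"

text \<open>From \<open>D t\<^sup>n = t\<^sup>n (D + n)\<close> one has \<open>t\<^sup>m f(D) t\<^sup>n g(D) = t\<^sup>m\<^sup>+\<^sup>n f(D + n) g(D)\<close>.\<close>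

definition dop_mult :: "dop \<Rightarrow> dop \<Rightarrow> dop" where
  "dop_mult A B = (\<Sum>m\<in>Poly_Mapping.keys A. \<Sum>n\<in>Poly_Mapping.keys B.
     Poly_Mapping.single (m + n)
       (pcompose (Poly_Mapping.lookup A m) [:of_int n, 1:] * Poly_Mapping.lookup B n))"

definition dop_bracket :: "dop \<Rightarrow> dop \<Rightarrow> dop" where
  "dop_bracket A B = dop_mult A B - dop_mult B A"

definition tD :: "int \<Rightarrow> nat \<Rightarrow> dop"  \<comment> \<open>\<open>t\<^sup>n D\<^sup>r\<close>\<close> where
  "tD n r = Poly_Mapping.single n (monom 1 r)"

text \<open>Antisymmetry and bilinearity determine the cocycle from its values for \<open>m > 0\<close> except on
  \<open>m = n = 0\<close>, where the (empty) sum gives \<open>0\<close>.\<close>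

definition psi_hom :: "int \<Rightarrow> complex poly \<Rightarrow> int \<Rightarrow> complex poly \<Rightarrow> complex" where
  "psi_hom m f n g =
     (if m + n \<noteq> 0 then 0
      else if m > 0 then (\<Sum>i=1..m. poly f (- of_int i) * poly g (of_int (m - i)))
      else if m < 0 then - (\<Sum>i=1..n. poly g (- of_int i) * poly f (of_int (n - i)))
      else 0)"

definition Psi :: "dop \<Rightarrow> dop \<Rightarrow> complex" where
  "Psi A B = (\<Sum>m\<in>Poly_Mapping.keys A. \<Sum>n\<in>Poly_Mapping.keys B.
     psi_hom m (Poly_Mapping.lookup A m) n (Poly_Mapping.lookup B n))"

definition Lgen :: "int \<Rightarrow> nat \<Rightarrow> dop"  \<comment> \<open>\<open>(-1)\<^sup>r\<^sup>+\<^sup>1 D\<^sup>r (t\<^sup>n D) D\<^sup>r\<close>\<close> where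
  "Lgen n r = dop_scale ((- 1) ^ (r + 1)) (dop_mult (dop_mult (tD 0 r) (tD n 1)) (tD 0 r))"

inductive_set Dplus :: "dop set" where
  Dplus_gen: "Lgen n r \<in> Dplus"
| Dplus_zero: "0 \<in> Dplus"
| Dplus_add: "A \<in> Dplus \<Longrightarrow> B \<in> Dplus \<Longrightarrow> A + B \<in> Dplus"
| Dplus_scale: "A \<in> Dplus \<Longrightarrow> dop_scale c A \<in> Dplus"
| Dplus_bracket: "A \<in> Dplus \<Longrightarrow> B \<in> Dplus \<Longrightarrow> dop_bracket A B \<in> Dplus"

text \<open>In the central extension \<open>(A, z)\<close> stands for \<open>A + z c\<close>.\<close>

type_synonym dhat = "dop \<times> complex"

definition Dhat :: "dhat set" where
  "Dhat = Dplus \<times> UNIV"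

definition dhat_scale :: "complex \<Rightarrow> dhat \<Rightarrow> dhat" where
  "dhat_scale a x = (dop_scale a (fst x), a * snd x)"

definition dhat_bracket :: "dhat \<Rightarrow> dhat \<Rightarrow> dhat" where
  "dhat_bracket x y = (dop_bracket (fst x) (fst y), - (1/2) * Psi (fst x) (fst y))"

definition dhat_c :: dhat where
  "dhat_c = (0, 1)"

definition dhat_L :: "int \<Rightarrow> nat \<Rightarrow> dhat" where
  "dhat_L n r = (Lgen n r, 0)"

definition dhat_Lbar :: "int \<Rightarrow> nat \<Rightarrow> dhat" where
  "dhat_Lbar n r = dhat_L n r +
     dhat_scale ((- 1) ^ r / 2 * riemann_zeta (- 1 - 2 * of_nat r) * (if n = 0 then 1 else 0)) dhat_c"

text \<open>\<open>struct_const r s m n i\<close> is \<open>a\<^sub>i\<^sup>(\<^sup>r\<^sup>,\<^sup>s\<^sup>)(m,n)\<close>, the coefficient of the basis element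
  \<open>dhat_Lbar (m + n) i\<close> in the bracket of \<open>dhat_Lbar m r\<close> and \<open>dhat_Lbar n s\<close>.\<close>

definition struct_const :: "nat \<Rightarrow> nat \<Rightarrow> int \<Rightarrow> int \<Rightarrow> nat \<Rightarrow> complex" where
  "struct_const r s m n i =
     module.representation dhat_scale (insert dhat_c {dhat_Lbar k j | k j. True})
       (dhat_bracket (dhat_Lbar m r) (dhat_Lbar n s)) (dhat_Lbar (m + n) i)"


section \<open>The space with isometry and the twisted Heisenberg algebra\<close>

record 'h twisted_data =
  scl :: "complex \<Rightarrow> 'h \<Rightarrow> 'h"
  form :: "'h \<Rightarrow> 'h \<Rightarrow> complex"
  isom :: "'h \<Rightarrow> 'h"
  period :: nat
  omega :: complex

definition twisted_space :: "'h::ab_group_add twisted_data \<Rightarrow> bool" where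
  "twisted_space H \<longleftrightarrow>
     vector_space (scl H) \<and>
     (\<exists>B. finite B \<and> module.span (scl H) B = UNIV) \<and>
     (\<forall>x y z. form H (x + y) z = form H x z + form H y z) \<and>
     (\<forall>c x y. form H (scl H c x) y = c * form H x y) \<and>
     (\<forall>x y. form H x y = form H y x) \<and>
     (\<forall>x. (\<forall>y. form H x y = 0) \<longrightarrow> x = 0) \<and>
     Vector_Spaces.linear (scl H) (scl H) (isom H) \<and>
     (\<forall>x y. form H (isom H x) (isom H y) = form H x y) \<and>
     period H > 0 \<and> (isom H ^^ period H) = id \<and>
     omega H ^ period H = 1 \<and> (\<forall>k. 0 < k \<and> k < period H \<longrightarrow> omega H ^ k \<noteq> 1)"

definition orthonormal_basis :: "'h::ab_group_add twisted_data \<Rightarrow> nat \<Rightarrow> (nat \<Rightarrow> 'h) \<Rightarrow> bool" where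
  "orthonormal_basis H d \<alpha> \<longleftrightarrow>
     inj_on \<alpha> {1..d} \<and> \<not> module.dependent (scl H) (\<alpha> ` {1..d}) \<and>
     module.span (scl H) (\<alpha> ` {1..d}) = UNIV \<and>
     (\<forall>i\<in>{1..d}. \<forall>j\<in>{1..d}. form H (\<alpha> i) (\<alpha> j) = (if i = j then 1 else 0))"

text \<open>A rational lattice in \<open>\<hh>\<close> is the integral span of a complex basis on which the form takes
  rational values.\<close>

definition rational_lattice :: "'h::ab_group_add twisted_data \<Rightarrow> 'h set \<Rightarrow> bool" where
  "rational_lattice H \<Lambda> \<longleftrightarrow>
     (\<exists>B. finite B \<and> \<not> module.dependent (scl H) B \<and> module.span (scl H) B = UNIV \<and>
        \<Lambda> = {\<Sum>b\<in>B. scl H (of_int (c b)) b | c. True}) \<and>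
     (\<forall>x\<in>\<Lambda>. \<forall>y\<in>\<Lambda>. form H x y \<in> \<rat>)"

definition eigenspace :: "'h twisted_data \<Rightarrow> int \<Rightarrow> 'h set"  \<comment> \<open>\<open>\<hh>\<^sub>(\<^sub>r\<^sub>)\<close>\<close> where
  "eigenspace H r = {a. isom H a = scl H (omega H powi r) a}"

definition edim :: "'h::ab_group_add twisted_data \<Rightarrow> int \<Rightarrow> nat" where
  "edim H r = vector_space.dim (scl H) (eigenspace H r)"

definition eproj :: "'h::ab_group_add twisted_data \<Rightarrow> int \<Rightarrow> 'h \<Rightarrow> 'h"
  \<comment> \<open>the component in \<open>\<hh>\<^sub>(\<^sub>r\<^sub>)\<close> with respect to the direct sum of the \<open>\<hh>\<^sub>(\<^sub>k\<^sub>)\<close>, \<open>0 \<le> k < p\<close>\<close> where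
  "eproj H r a = (THE b. \<exists>\<gamma>. (\<forall>k<period H. \<gamma> k \<in> eigenspace H (int k)) \<and>
     a = (\<Sum>k<period H. \<gamma> k) \<and> b = \<gamma> (nat (r mod int (period H))))"

text \<open>Exponents in \<open>(1/p)\<int>\<close> are indexed by integers throughout: the index \<open>k\<close> means the exponent
  \<open>k/p\<close>.  The pair \<open>(f, z)\<close> stands for \<open>\<Sum>\<^sub>k f\<^sub>k \<otimes> t\<^sup>k\<^sup>/\<^sup>p + z C\<close>.\<close>

type_synonym 'h hhat = "(int \<Rightarrow>\<^sub>0 'h) \<times> complex"

definition frac_exp :: "'h twisted_data \<Rightarrow> int \<Rightarrow> complex" where
  "frac_exp H k = of_int k / of_nat (period H)"

definition hhat_carrier :: "'h::ab_group_add twisted_data \<Rightarrow> 'h hhat set" where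
  "hhat_carrier H = {x. \<forall>k. Poly_Mapping.lookup (fst x) k \<in> eigenspace H k}"

definition hhat_scale :: "'h::ab_group_add twisted_data \<Rightarrow> complex \<Rightarrow> 'h hhat \<Rightarrow> 'h hhat" where
  "hhat_scale H c x = (Poly_Mapping.map (scl H c) (fst x), c * snd x)"

definition hhat_bracket :: "'h::ab_group_add twisted_data \<Rightarrow> 'h hhat \<Rightarrow> 'h hhat \<Rightarrow> 'h hhat" where
  "hhat_bracket H x y =
     (0, \<Sum>k\<in>Poly_Mapping.keys (fst x). \<Sum>l\<in>Poly_Mapping.keys (fst y).
        if k + l = 0
        then form H (Poly_Mapping.lookup (fst x) k) (Poly_Mapping.lookup (fst y) l) * frac_exp H k
        else 0)"

definition hhat_nonneg :: "'h::ab_group_add twisted_data \<Rightarrow> 'h hhat set"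
  \<comment> \<open>the subalgebra of nonnegative modes and \<open>C\<close>\<close> where
  "hhat_nonneg H = {x \<in> hhat_carrier H. \<forall>k\<in>Poly_Mapping.keys (fst x). k \<ge> 0}"

record ('g, 'v) lie_module =
  mscl :: "complex \<Rightarrow> 'v \<Rightarrow> 'v"
  act :: "'g \<Rightarrow> 'v \<Rightarrow> 'v"
  vac :: 'v

definition is_S_nu :: "'h::ab_group_add twisted_data \<Rightarrow> ('h hhat, 'v::ab_group_add) lie_module \<Rightarrow> bool"
  \<comment> \<open>the character \<open>snd\<close> kills all modes and sends \<open>C\<close> to \<open>1\<close>\<close> where
  "is_S_nu H S \<longleftrightarrow>
     is_induced_module (hhat_carrier H) (hhat_scale H) (hhat_bracket H) (hhat_nonneg H) snd
       (mscl S) (act S) (vac S)"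


section \<open>The vertex operator coefficients\<close>

definition hmode ::
  "'h::ab_group_add twisted_data \<Rightarrow> ('h hhat, 'v) lie_module \<Rightarrow> 'h \<Rightarrow> int \<Rightarrow> 'v \<Rightarrow> 'v"
  \<comment> \<open>\<open>\<alpha>(k/p)\<close>\<close> where
  "hmode H S a k = act S (Poly_Mapping.single k (eproj H k a), 0)"

text \<open>When \<open>k\<close> and \<open>l\<close> are both positive or both nonpositive the two modes commute, so only the
  position of a single positive mode matters.\<close>

definition normal_ordered ::
  "'h::ab_group_add twisted_data \<Rightarrow> ('h hhat, 'v) lie_module \<Rightarrow> 'h \<Rightarrow> int \<Rightarrow> 'h \<Rightarrow> int \<Rightarrow> 'v \<Rightarrow> 'v" where
  "normal_ordered H S a k b l v =
     (if k > 0 then hmode H S b l (hmode H S a k v) else hmode H S a k (hmode H S b l v))"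

text \<open>As \<open>\<alpha>\<langle>e\<^sup>y x\<rangle> = \<Sum>\<^sub>k \<alpha>(k/p) e\<^sup>-\<^sup>k\<^sup>y\<^sup>/\<^sup>p x\<^sup>-\<^sup>k\<^sup>/\<^sup>p\<close>, the mode \<open>\<alpha>(k/p)\<close> enters the coefficient of
  \<open>y\<^sup>r / r!\<close> with the following factor.\<close>

definition exp_factor :: "'h twisted_data \<Rightarrow> int \<Rightarrow> nat \<Rightarrow> complex" where
  "exp_factor H k r = fact r * fps_nth (fps_exp (- frac_exp H k)) r"

text \<open>The coefficient of \<open>x\<^sup>-\<^sup>n y\<^sub>1\<^sup>r\<^sup>1 y\<^sub>2\<^sup>r\<^sup>2 / (r1! r2!)\<close> in
  \<open>1/2 \<Sum>\<^sub>q :\<alpha>\<^sub>q\<langle>e\<^sup>y\<^sup>1 x\<rangle> \<alpha>\<^sub>q\<langle>e\<^sup>y\<^sup>2 x\<rangle>:\<close>, applied to \<open>v\<close>.  On a fixed \<open>v\<close> only finitely many pairs of modes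
  of total degree \<open>n\<close> contribute.\<close>

definition quad_coeff ::
  "'h::ab_group_add twisted_data \<Rightarrow> ('h hhat, 'v::ab_group_add) lie_module \<Rightarrow> nat \<Rightarrow> (nat \<Rightarrow> 'h) \<Rightarrow>
   nat \<Rightarrow> nat \<Rightarrow> int \<Rightarrow> 'v \<Rightarrow> 'v" where
  "quad_coeff H S d \<alpha> r1 r2 n v =
     mscl S (1/2) (\<Sum>q=1..d. Sum_any (\<lambda>k.
       (let l = int (period H) * n - k in
        mscl S (exp_factor H k r1 * exp_factor H l r2) (normal_ordered H S (\<alpha> q) k (\<alpha> q) l v))))"

text \<open>The scalar terms of the two generating functions depend only on \<open>u = - y\<^sub>1 + y\<^sub>2\<close>, and
  \<open>-1/2 \<partial>/\<partial>y\<^sub>1 F(-y\<^sub>1 + y\<^sub>2) = 1/2 F'(u)\<close>.  In the second one the polar term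
  \<open>1/2 d/(y\<^sub>1 - y\<^sub>2)\<^sup>2 = 1/2 d u\<^sup>-\<^sup>2\<close> is moved to the other side.\<close>

definition scalar_series :: "'h::ab_group_add twisted_data \<Rightarrow> complex fls" where
  "scalar_series H = fls_const (1/2) * fls_deriv
     (\<Sum>k<period H. (fps_to_fls (fps_exp (frac_exp H (int k))) - 1) * of_nat (edim H (int k)) /
        (1 - fps_to_fls (fps_exp 1)))"

definition scalar_series_bar :: "'h::ab_group_add twisted_data \<Rightarrow> nat \<Rightarrow> complex fls" where
  "scalar_series_bar H d = fls_const (1/2) * fls_deriv
     (\<Sum>k<period H. fps_to_fls (fps_exp (frac_exp H (int k))) * of_nat (edim H (int k)) /
        (1 - fps_to_fls (fps_exp 1)))
     - fls_const (of_nat d / 2) * fls_X_intpow (- 2)"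

text \<open>The coefficient of \<open>y\<^sub>1\<^sup>r\<^sup>1 y\<^sub>2\<^sup>r\<^sup>2 / (r1! r2!)\<close> in \<open>F(-y\<^sub>1 + y\<^sub>2)\<close>, for \<open>F\<close> without polar part.\<close>

definition diff_coeff :: "complex fls \<Rightarrow> nat \<Rightarrow> nat \<Rightarrow> complex" where
  "diff_coeff F r1 r2 =
     fact r1 * fact r2 * (of_nat ((r1 + r2) choose r1) * (- 1) ^ r1 * fls_nth F (int (r1 + r2)))"

definition Lop ::
  "'h::ab_group_add twisted_data \<Rightarrow> ('h hhat, 'v::ab_group_add) lie_module \<Rightarrow> nat \<Rightarrow> (nat \<Rightarrow> 'h) \<Rightarrow>
   nat \<Rightarrow> nat \<Rightarrow> int \<Rightarrow> 'v \<Rightarrow> 'v" where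
  "Lop H S d \<alpha> r1 r2 n v = quad_coeff H S d \<alpha> r1 r2 n v +
     (if n = 0 then mscl S (diff_coeff (scalar_series H) r1 r2) v else 0)"

definition Lop_bar ::
  "'h::ab_group_add twisted_data \<Rightarrow> ('h hhat, 'v::ab_group_add) lie_module \<Rightarrow> nat \<Rightarrow> (nat \<Rightarrow> 'h) \<Rightarrow>
   nat \<Rightarrow> nat \<Rightarrow> int \<Rightarrow> 'v \<Rightarrow> 'v" where
  "Lop_bar H S d \<alpha> r1 r2 n v = quad_coeff H S d \<alpha> r1 r2 n v +
     (if n = 0 then mscl S (diff_coeff (scalar_series_bar H d) r1 r2) v else 0)"

definition Ldiag ::
  "'h::ab_group_add twisted_data \<Rightarrow> ('h hhat, 'v::ab_group_add) lie_module \<Rightarrow> nat \<Rightarrow> (nat \<Rightarrow> 'h) \<Rightarrow>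
   nat \<Rightarrow> int \<Rightarrow> 'v \<Rightarrow> 'v" where
  "Ldiag H S d \<alpha> r n = Lop H S d \<alpha> r r n"

definition Ldiag_bar ::
  "'h::ab_group_add twisted_data \<Rightarrow> ('h hhat, 'v::ab_group_add) lie_module \<Rightarrow> nat \<Rightarrow> (nat \<Rightarrow> 'h) \<Rightarrow>
   nat \<Rightarrow> int \<Rightarrow> 'v \<Rightarrow> 'v" where
  "Ldiag_bar H S d \<alpha> r n = Lop_bar H S d \<alpha> r r n"

end

theory Submission
  imports Defs
begin

text \<open>An element \<open>t\<^sup>n f(D)\<close> of \<open>\<D>\<^sup>+\<close> is represented by a normally ordered quadratic expression in
  the modes plus, for \<open>n = 0\<close>, a scalar; it is chosen so that its commutator with a mode \<open>\<alpha>(k/p)\<close>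
  is \<open>f(k/p) \<alpha>(n + k/p)\<close>, the action of \<open>t\<^sup>n f(D)\<close> on \<open>t\<^sup>k\<^sup>/\<^sup>p\<close>.  Hence the defect of the bracket
  relation commutes with all modes, and since the vacuum generates the module it suffices to
  evaluate the defect on the vacuum.  There it vanishes in nonzero degree, because a vector killed
  by all nonnegative modes has degree \<open>0\<close>; in degree \<open>0\<close> it is a finite sum of values of a
  polynomial at the points \<open>k/p\<close>.  The scalars \<open>P(\<partial>)((e\<^sup>x\<^sup>u - 1)/(1 - e\<^sup>u))|\<^sub>u\<^sub>=\<^sub>0\<close> turn this sum over
  \<open>k/p + \<int>\<close> into the sum over \<open>\<int>\<close> that defines \<open>\<Psi>\<close>.

  The second representation is the same map: the two scalar series differ by the expansion of
  \<open>1/(1 - e\<^sup>u) + 1/u\<close>, whose coefficients are, up to factorials, the values \<open>\<zeta>(-1-2r)\<close>.  By the same token the central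
  term in the basis \<open>L\<close>-bar is the difference between a sum \<open>\<Sum>\<^sub>j\<^sub><\<^sub>m P(j)\<close> and its Euler-Maclaurin
  correction, that is \<open>1/2 \<integral>\<^sub>0\<^sup>m x\<^sup>N(m - x)\<^sup>N dx\<close> with \<open>N = r + s + 1\<close>.  The values of \<open>\<zeta>\<close> come from
  Euler-Maclaurin summation as well, which is exact on polynomials.\<close>

section \<open>The zeta function at negative integers\<close>

text \<open>No presentation of the algebra by generators and relations enters: \<open>R\<close> is
  defined for every polynomial, and all that is asked of the components of an element of
  \<open>Dplus\<close> is that they are \<open>reflective\<close>. That condition comes from the
  quadratic form. Commuting with the mode of index \<open>l\<close> contracts it with either of the
  two factors, at the summation indices \<open>-l\<close> and \<open>p n + l\<close>, and reflection
  makes the two contributions equal. For \<open>m + n = 0\<close> the computation reduces to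
  \<open>R m f (R (-m) g v0)\<close> with \<open>m > 0\<close>. The trace over the orthonormal basis
  counts the mode \<open>k/p\<close> with multiplicity \<open>D k\<close>, which gives half the sum
  of \<open>D k * P(k/p)\<close> over \<open>0 <= k < p m\<close>, where \<open>P\<close> is
  \<open>vac_poly\<close>. On the other side, \<open>P\<close> is symmetric about
  \<open>m/2\<close>, so the bracket polynomial is the difference \<open>P(x + m) - P(x)\<close>.
  Pairing such a difference with a series \<open>E\<close> yields the pairings of \<open>P\<close>
  with \<open>e^(j u) E (1 - e^u)\<close>, \<open>j < m\<close>: the denominators
  \<open>1 - e^u\<close> in the scalars are what performs the summation. The zeta function is given
  by a choice operator, so a continuation must be exhibited. It is built as the entire function
  \<open>a zeta(1 - a)\<close>, on half-planes by truncations of growing order.\<close>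

definition falling :: "complex \<Rightarrow> nat \<Rightarrow> complex" where
  "falling a i = (\<Prod>j<i. a - of_nat j)"

lemma falling_0 [simp]: "falling a 0 = 1"
  and falling_Suc: "falling a (Suc i) = falling a i * (a - of_nat i)"
  by (simp_all add: falling_def)

lemma falling_add: "falling a (j + i) = falling a j * falling (a - of_nat j) i"
  by (induction i) (simp_all add: falling_Suc algebra_simps)

lemma falling_of_nat: "i \<le> n \<Longrightarrow> falling (of_nat n) i = fact n / fact (n - i)"
proof (induction i)
  case (Suc i)
  have "fact (n - i) = (of_nat (n - i) * fact (n - Suc i) :: complex)"
    using Suc.prems by (metis Suc_diff_Suc Suc_le_lessD fact_Suc)
  then show ?case using Suc by (simp add: falling_Suc of_nat_diff)
qed simp

lemma falling_of_nat_eq_0: "n < i \<Longrightarrow> falling (of_nat n) i = 0"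
  by (auto simp: falling_def)

lemma holomorphic_falling [holomorphic_intros]:
  "f holomorphic_on A \<Longrightarrow> (\<lambda>a. falling (f a) i) holomorphic_on A"
  unfolding falling_def by (intro holomorphic_intros)

section \<open>Bernoulli numbers and the Euler-Maclaurin remainder\<close>

definition exp_quotient :: "complex fps" where
  "exp_quotient = Abs_fps (\<lambda>n. 1 / fact (Suc n))"

text \<open>The series \<open>u / (e^u - 1)\<close>, with coefficients \<open>B_n / n!\<close> in
  the convention \<open>B_1 = -1/2\<close>.\<close>

definition bernoulli_fps :: "complex fps" where
  "bernoulli_fps = inverse exp_quotient"

lemma fps_X_mult_exp_quotient: "fps_X * exp_quotient = fps_exp 1 - 1"
proof (rule fps_ext)
  fix n show "(fps_X * exp_quotient) $ n = (fps_exp 1 - 1) $ n"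
    by (cases n) (simp_all add: exp_quotient_def del: fact_Suc)
qed

lemma bernoulli_exp_quotient: "bernoulli_fps * exp_quotient = 1"
  unfolding bernoulli_fps_def by (rule inverse_mult_eq_1) (simp add: exp_quotient_def)

lemma bernoulli_convolution:
  assumes "l > 0"
  shows "(\<Sum>j<l. bernoulli_fps $ j / fact (l - j)) = (if l = 1 then 1 else 0)"
proof -
  obtain l' where l: "l = Suc l'" using assms gr0_implies_Suc by blast
  have "(bernoulli_fps * exp_quotient) $ l' = (if l' = 0 then 1 else 0)"
    unfolding bernoulli_exp_quotient by simp
  then show ?thesis unfolding l fps_mult_nth exp_quotient_def lessThan_Suc_atMost atMost_atLeast0
    by (auto simp: Suc_diff_le simp del: fact_Suc)
qed

text \<open>With \<open>B(D) = D / (e\<^sup>D - 1)\<close>, \<open>D = d/dx\<close>, this is \<open>D x\<^sup>a - (e\<^sup>D - 1) B(D) x\<^sup>a\<close> at \<open>x = n\<close>, where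
  \<open>B(D)\<close> is truncated after \<open>D\<^sup>N\<close>.\<close>

definition em_term :: "nat \<Rightarrow> nat \<Rightarrow> complex \<Rightarrow> complex" where
  "em_term N n a = a * of_nat n powr (a - 1) -
     (\<Sum>j\<le>N. bernoulli_fps $ j * falling a j *
        (of_nat (Suc n) powr (a - of_nat j) - of_nat n powr (a - of_nat j)))"

lemma powr_taylor:
  assumes "n > 0" and "Re b \<le> M + 1"
  shows "norm (of_nat (Suc n) powr b -
      (\<Sum>i\<le>M. falling b i * of_nat n powr (b - of_nat i) / fact i)) \<le>
    norm (falling b (Suc M)) * real n powr (Re b - M - 1) / fact M"
proof -
  let ?S = "closed_segment (of_nat n) (of_nat (Suc n)) :: complex set"
  let ?f = "\<lambda>i x. falling b i * x powr (b - of_nat i)"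
  have S: "x \<in> \<real> \<and> Re x \<ge> n" if x: "x \<in> ?S" for x
  proof -
    obtain u where u: "0 \<le> u" "x = (1 - u) *\<^sub>R of_nat n + u *\<^sub>R of_nat (Suc n)"
      using x unfolding closed_segment_def by blast
    have "x = of_real (real n + u)"
      unfolding u(2) by (simp add: scaleR_conv_of_real algebra_simps)
    with u(1) show ?thesis by auto
  qed
  have "norm (?f 0 (of_nat (Suc n)) - (\<Sum>i\<le>M. ?f i (of_nat n) * (of_nat (Suc n) - of_nat n) ^ i / fact i)) \<le>
     (norm (falling b (Suc M)) * real n powr (Re b - M - 1)) * cmod (of_nat (Suc n) - of_nat n) ^ Suc M / fact M"
  proof (rule complex_Taylor[where S = ?S])
    fix i x assume x: "x \<in> ?S"
    then have "x \<notin> \<real>\<^sub>\<le>\<^sub>0" using S[OF x] assms(1) by (auto elim!: nonpos_Reals_cases)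
    then show "(?f i has_field_derivative ?f (Suc i) x) (at x within ?S)"
      by (auto intro!: derivative_eq_intros simp: falling_Suc algebra_simps)
  next
    fix x assume x: "x \<in> ?S"
    have "norm (x powr (b - of_nat (Suc M))) = Re x powr (Re b - M - 1)"
      using S[OF x] by (subst norm_powr_real_powr) (auto simp: algebra_simps)
    \<comment> \<open>The assumption on \<open>Re b\<close> makes this exponent nonpositive, so the
      maximum over the segment is attained at its left end \<open>n\<close>.\<close>
    also have "\<dots> \<le> real n powr (Re b - M - 1)"
      using S[OF x] assms by (intro powr_mono2') auto
    finally show "cmod (?f (Suc M) x) \<le> norm (falling b (Suc M)) * real n powr (Re b - M - 1)"
      by (simp add: norm_mult mult_left_mono)
  qed auto
  then show ?thesis by simp
qed

text \<open>The subtracted power cancels the Taylor term \<open>i = 0\<close>. Sorting the rest by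
  the total order \<open>l = i + j\<close> leaves the Bernoulli convolution as coefficient, which is
  nonzero only for \<open>l = 1\<close>.\<close>

lemma em_term_main_part:
  assumes "n > 0" and "N > 0"
  shows "(\<Sum>j\<le>N. bernoulli_fps $ j * falling a j *
     ((\<Sum>i\<le>N-j. falling (a - of_nat j) i * of_nat n powr (a - of_nat j - of_nat i) / fact i)
        - of_nat n powr (a - of_nat j))) = a * of_nat n powr (a - 1)"
proof -
  let ?t = "\<lambda>l. falling a l * of_nat n powr (a - of_nat l)"
  have "(\<Sum>j\<le>N. bernoulli_fps $ j * falling a j *
     ((\<Sum>i\<le>N-j. falling (a - of_nat j) i * of_nat n powr (a - of_nat j - of_nat i) / fact i)
        - of_nat n powr (a - of_nat j)))
    = (\<Sum>j\<le>N. \<Sum>l\<in>{j<..N}. bernoulli_fps $ j / fact (l - j) * ?t l)"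
  proof (rule sum.cong[OF refl])
    fix j assume j: "j \<in> {..N}"
    have "(\<Sum>i\<le>N-j. falling (a - of_nat j) i * of_nat n powr (a - of_nat j - of_nat i) / fact i)
        = of_nat n powr (a - of_nat j) +
          (\<Sum>i\<in>{0<..N-j}. falling (a - of_nat j) i * of_nat n powr (a - of_nat j - of_nat i) / fact i)"
    proof -
      have "{..N-j} = insert 0 {0<..N-j}" by auto
      then show ?thesis by simp
    qed
    then have "bernoulli_fps $ j * falling a j *
     ((\<Sum>i\<le>N-j. falling (a - of_nat j) i * of_nat n powr (a - of_nat j - of_nat i) / fact i)
        - of_nat n powr (a - of_nat j)) =
      (\<Sum>i\<in>{0<..N-j}. bernoulli_fps $ j / fact i * ?t (j + i))"
      by (simp add: sum_distrib_left falling_add[of a j] diff_diff_eq ring_distribs mult_ac)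
    also have "\<dots> = (\<Sum>l\<in>{j<..N}. bernoulli_fps $ j / fact (l - j) * ?t l)"
      using j by (intro sum.reindex_bij_witness[of _ "\<lambda>l. l - j" "\<lambda>i. j + i"]) auto
    finally show "bernoulli_fps $ j * falling a j *
     ((\<Sum>i\<le>N-j. falling (a - of_nat j) i * of_nat n powr (a - of_nat j - of_nat i) / fact i)
        - of_nat n powr (a - of_nat j)) = (\<Sum>l\<in>{j<..N}. bernoulli_fps $ j / fact (l - j) * ?t l)" .
  qed
  also have "\<dots> = (\<Sum>l\<in>{0<..N}. \<Sum>j<l. bernoulli_fps $ j / fact (l - j) * ?t l)"
    by (subst sum.Sigma, simp, simp, subst sum.Sigma, simp, simp,
        rule sum.reindex_bij_witness[of _ "\<lambda>(l, j). (j, l)" "\<lambda>(l, j). (j, l)"]) auto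
  also have "\<dots> = (\<Sum>l\<in>{0<..N}. if l = 1 then ?t l else 0)"
    by (intro sum.cong refl, subst sum_distrib_right[symmetric], subst bernoulli_convolution) auto
  also have "\<dots> = a * of_nat n powr (a - 1)"
    using assms(2) by (simp add: falling_Suc)
  finally show ?thesis .
qed

text \<open>What remains are Taylor remainders of the \<open>j\<close>-th summand after order
  \<open>N - j\<close>, so all of them have total order \<open>N + 1\<close>. The factor
  \<open>falling a (Suc N)\<close> is kept explicit because its vanishing at small integers makes
  the formula exact there.\<close>

lemma norm_em_term_le:
  assumes "n > 0" "N > 0" and "Re a \<le> N + 1"
  shows "norm (em_term N n a) \<le>
    (\<Sum>j\<le>N. norm (bernoulli_fps $ j) / fact (N - j)) * norm (falling a (Suc N)) * real n powr (Re a - N - 1)"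
proof -
  let ?T = "\<lambda>j. \<Sum>i\<le>N-j. falling (a - of_nat j) i * of_nat n powr (a - of_nat j - of_nat i) / fact i"
  have "em_term N n a = - (\<Sum>j\<le>N. bernoulli_fps $ j * falling a j *
       (of_nat (Suc n) powr (a - of_nat j) - ?T j))"
    unfolding em_term_def em_term_main_part[OF assms(1,2), symmetric]
    by (simp add: sum_negf[symmetric] sum_subtractf[symmetric] algebra_simps del: of_nat_Suc)
  then have "norm (em_term N n a) \<le> (\<Sum>j\<le>N. norm (bernoulli_fps $ j) * norm (falling a j) *
       norm (of_nat (Suc n) powr (a - of_nat j) - ?T j))"
    by (auto intro!: order.trans[OF norm_sum] sum_mono simp: norm_mult)
  also have "(\<Sum>j\<le>N. norm (bernoulli_fps $ j) * norm (falling a j) *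
       norm (of_nat (Suc n) powr (a - of_nat j) - ?T j)) \<le> (\<Sum>j\<le>N. norm (bernoulli_fps $ j) / fact (N - j) *
       (norm (falling a (Suc N)) * real n powr (Re a - N - 1)))"
  proof (rule sum_mono)
    fix j assume "j \<in> {..N}"
    then have j: "j \<le> N" by simp
    have "norm (of_nat (Suc n) powr (a - of_nat j) - ?T j) \<le>
       norm (falling (a - of_nat j) (Suc (N - j))) * real n powr (Re (a - of_nat j) - (N - j) - 1) / fact (N - j)"
      using assms j by (intro powr_taylor) (auto simp: of_nat_diff)
    also have "Re (a - of_nat j) - (N - j) - 1 = Re a - N - 1"
      using j by (simp add: of_nat_diff)
    finally have 1: "norm (of_nat (Suc n) powr (a - of_nat j) - ?T j) \<le>
       norm (falling (a - of_nat j) (Suc (N - j))) * real n powr (Re a - N - 1) / fact (N - j)" .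
    have "norm (falling a (Suc N)) = norm (falling a j) * norm (falling (a - of_nat j) (Suc (N - j)))"
      using falling_add[of a j "Suc (N - j)"] j by (simp add: norm_mult)
    then show "norm (bernoulli_fps $ j) * norm (falling a j) * norm (of_nat (Suc n) powr (a - of_nat j) - ?T j)
      \<le> norm (bernoulli_fps $ j) / fact (N - j) * (norm (falling a (Suc N)) * real n powr (Re a - N - 1))"
      using mult_left_mono[OF 1, of "norm (bernoulli_fps $ j) * norm (falling a j)"]
      by (simp add: algebra_simps)
  qed
  finally show ?thesis by (simp add: sum_distrib_right mult.assoc)
qed

lemma em_term_holomorphic: "n > 0 \<Longrightarrow> em_term N n holomorphic_on A"
  unfolding em_term_def by (intro holomorphic_intros) (auto simp: of_nat_Suc[symmetric] simp del: of_nat_Suc)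

text \<open>For \<open>Re s > 1\<close> and \<open>a = 1 - s\<close> summation of the terms telescopes to
  \<open>em_fun N a = a \<zeta>(1 - a)\<close>.\<close>

definition em_fun :: "nat \<Rightarrow> complex \<Rightarrow> complex" where
  "em_fun N a = (suminf (\<lambda>n. em_term N (Suc n) a)) - (\<Sum>j\<le>N. bernoulli_fps $ j * falling a j)"

section \<open>Convergence and analytic continuation\<close>

lemma em_term_uniform:
  assumes "N > 0" "Re a < N"
  shows "\<exists>r>0. cball a r \<subseteq> {a. Re a < N} \<and>
    uniform_limit (cball a r) (\<lambda>k x. \<Sum>n<k. em_term N (Suc n) x) (\<lambda>x. suminf (\<lambda>n. em_term N (Suc n) x)) sequentially"
proof -
  \<comment> \<open>Half the distance to the line \<open>Re a = N\<close>: on the ball the exponent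
    \<open>Re x - N - 1\<close> then stays at most \<open>-1 - r\<close>, which makes the majorant
    summable.\<close>
  define r where "r = (N - Re a) / 2"
  have r: "r > 0" using assms by (simp add: r_def)
  have Re_le: "Re x \<le> Re a + r" if "x \<in> cball a r" for x
    using that complex_Re_le_cmod[of "x - a"] by (auto simp: dist_norm norm_minus_commute)
  have sub: "cball a r \<subseteq> {a. Re a < N}" using Re_le assms by (force simp: r_def field_simps)
  have "continuous_on (cball a r) (\<lambda>x. falling x (Suc N))"
    by (intro holomorphic_on_imp_continuous_on holomorphic_intros)
  then have "compact ((\<lambda>x. falling x (Suc N)) ` cball a r)"
    by (intro compact_continuous_image) auto
  then obtain C where C: "\<And>x. x \<in> cball a r \<Longrightarrow> norm (falling x (Suc N)) \<le> C"
    by (meson bounded_iff compact_imp_bounded imageI)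
  have C0: "C \<ge> 0" using order_trans[OF norm_ge_zero C[of a]] r by simp
  define K where "K = (\<Sum>j\<le>N. norm (bernoulli_fps $ j) / fact (N - j))"
  have K0: "K \<ge> 0" unfolding K_def by (intro sum_nonneg) auto
  have "uniform_limit (cball a r) (\<lambda>k x. \<Sum>n<k. em_term N (Suc n) x) (\<lambda>x. suminf (\<lambda>n. em_term N (Suc n) x)) sequentially"
  proof (rule Weierstrass_m_test)
    fix n x assume x: "x \<in> cball a r"
    have "norm (em_term N (Suc n) x) \<le> K * norm (falling x (Suc N)) * real (Suc n) powr (Re x - N - 1)"
      unfolding K_def using Re_le[OF x] assms by (intro norm_em_term_le) (auto simp: r_def field_simps)
    also have "\<dots> \<le> K * C * real (Suc n) powr (Re a + r - N - 1)"
      using Re_le[OF x] C[OF x] K0 C0 by (intro mult_mono powr_mono) auto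
    finally show "norm (em_term N (Suc n) x) \<le> K * C * real (Suc n) powr (Re a + r - N - 1)" .
  next
    have "summable (\<lambda>n. real (Suc n) powr (Re a + r - N - 1))"
      using assms by (subst summable_Suc_iff, subst summable_real_powr_iff) (auto simp: r_def field_simps)
    then show "summable (\<lambda>n. K * C * real (Suc n) powr (Re a + r - N - 1))"
      by (rule summable_mult)
  qed
  with r sub show ?thesis by blast
qed

lemma em_fun_holomorphic:
  assumes "N > 0"
  shows "em_fun N holomorphic_on {a. Re a < N}"
proof -
  have "(\<lambda>x. suminf (\<lambda>n. em_term N (Suc n) x)) holomorphic_on {a. Re a < N}"
  proof (rule holomorphic_uniform_sequence)
    show "(\<lambda>x. \<Sum>n<k. em_term N (Suc n) x) holomorphic_on {a. Re a < N}" for k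
      by (intro holomorphic_on_sum em_term_holomorphic) simp
  qed (use em_term_uniform assms in \<open>auto intro: open_halfspace_Re_lt\<close>)
  moreover have "(\<lambda>a. \<Sum>j\<le>N. bernoulli_fps $ j * falling a j) holomorphic_on {a. Re a < N}"
    by (intro holomorphic_intros)
  ultimately show ?thesis
    using holomorphic_on_diff unfolding em_fun_def by blast
qed

lemma powr_tendsto_0:
  assumes "Re b < 0"
  shows "(\<lambda>n. of_nat (Suc n) powr b) \<longlonglongrightarrow> 0"
proof (rule tendsto_norm_zero_cancel)
  have "(\<lambda>n. real (Suc n) powr Re b) \<longlonglongrightarrow> 0"
    using assms by (intro tendsto_neg_powr filterlim_compose[OF filterlim_real_sequentially filterlim_Suc])
  moreover have "norm (of_nat (Suc n) powr b) = real (Suc n) powr Re b" for n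
    using norm_powr_real_powr[of "of_nat (Suc n)" b] by (simp del: of_nat_Suc)
  ultimately show "(\<lambda>n. norm (of_nat (Suc n) powr b)) \<longlonglongrightarrow> 0" by simp
qed

lemma em_fun_sums:
  assumes "N > 0" "Re a < 0"
  shows "(\<lambda>n. a * of_nat (Suc n) powr (a - 1)) sums em_fun N a"
proof -
  let ?H = "\<lambda>n. \<Sum>j\<le>N. bernoulli_fps $ j * falling a j * of_nat (Suc n) powr (a - of_nat j)"
  obtain r where "r > 0" and u: "uniform_limit (cball a r) (\<lambda>k x. \<Sum>n<k. em_term N (Suc n) x)
      (\<lambda>x. suminf (\<lambda>n. em_term N (Suc n) x)) sequentially"
    using em_term_uniform[of N a] assms by auto
  have 1: "(\<lambda>n. em_term N (Suc n) a) sums (suminf (\<lambda>n. em_term N (Suc n) a))"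
    unfolding sums_def using tendsto_uniform_limitI[OF u, of a] \<open>r > 0\<close> by simp
  have "?H \<longlonglongrightarrow> (\<Sum>j\<le>N. bernoulli_fps $ j * falling a j * 0)"
    using assms(2) by (intro tendsto_intros powr_tendsto_0) auto
  then have "?H \<longlonglongrightarrow> 0" by simp
  then have "(\<lambda>n. ?H (Suc n) - ?H n) sums (0 - ?H 0)" by (rule telescope_sums)
  from sums_add[OF 1 this] show ?thesis
    by (simp add: em_term_def em_fun_def sum_subtractf algebra_simps)
qed

text \<open>For \<open>Re a < 0\<close> both functions sum the same series. The identity theorem
  carries the equality to the half-plane on which both are holomorphic.\<close>

lemma em_fun_unique:
  assumes "M > 0" "N > 0" "Re a < M" "Re a < N"
  shows "em_fun M a = em_fun N a"
proof (rule analytic_continuation_open[where s = "{a. Re a < 0}" and s' = "{a. Re a < real (min M N)}"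
      and f = "em_fun M" and g = "em_fun N"])
  show "connected {a. Re a < real (min M N)}"
    by (intro convex_connected convex_halfspace_Re_lt)
  show "em_fun M holomorphic_on {a. Re a < real (min M N)}" "em_fun N holomorphic_on {a. Re a < real (min M N)}"
    using assms by (auto intro!: holomorphic_on_subset[OF em_fun_holomorphic])
  show "em_fun M z = em_fun N z" if "z \<in> {a. Re a < 0}" for z
    using em_fun_sums[of M z] em_fun_sums[of N z] assms that sums_unique2 by blast
  show "{a::complex. Re a < 0} \<noteq> {}" by (auto intro: exI[of _ "-1"])
qed (use assms in \<open>auto intro: open_halfspace_Re_lt\<close>)

text \<open>The truncation order depends on the point and exceeds \<open>Re a\<close>. Near any
  point a fixed larger order may be used instead, which gives holomorphy.\<close>

definition em_entire :: "complex \<Rightarrow> complex" where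
  "em_entire a = em_fun (Suc (nat \<lceil>\<bar>Re a\<bar>\<rceil>)) a"

lemma em_entire_eq: "N > 0 \<Longrightarrow> Re a < N \<Longrightarrow> em_entire a = em_fun N a"
  unfolding em_entire_def by (rule em_fun_unique) (auto, linarith)

lemma em_entire_holomorphic: "em_entire holomorphic_on A"
proof -
  have "em_entire field_differentiable (at a)" for a
  proof -
    obtain N where N: "N > 0" "Re a < real N"
      using reals_Archimedean2[of "max 0 (Re a)"] by (metis max_less_iff_conj of_nat_0_less_iff)
    have "em_entire holomorphic_on {a. Re a < N}"
      using em_fun_holomorphic[OF N(1)] em_entire_eq[OF N(1)] by (subst holomorphic_cong[OF refl]) auto
    then show ?thesis
      using N(2) holomorphic_on_imp_differentiable_at open_halfspace_Re_lt by blast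
  qed
  then show ?thesis by (meson field_differentiable_at_within holomorphic_on_def)
qed

lemma zeta_sums_em_entire:
  assumes "Re s > 1"
  shows "(\<lambda>n. 1 / of_nat (Suc n) powr s) sums (em_entire (1 - s) / (1 - s))"
proof -
  have "(\<lambda>n. (1 - s) * of_nat (Suc n) powr (- s)) sums em_entire (1 - s)"
    using em_fun_sums[of 1 "1 - s"] em_entire_eq[of 1 "1 - s"] assms by simp
  from sums_divide[OF this, of "1 - s"]
  have "(\<lambda>n. (1 - s) * of_nat (Suc n) powr (- s) / (1 - s)) sums (em_entire (1 - s) / (1 - s))" .
  also have "(\<lambda>n. (1 - s) * of_nat (Suc n) powr (- s) / (1 - s)) = (\<lambda>n. 1 / of_nat (Suc n) powr s)"
    using assms by (auto simp: fun_eq_iff powr_minus inverse_eq_divide simp del: of_nat_Suc)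
  finally show ?thesis .
qed

text \<open>The right-hand side is itself a continuation, so the choice in
  \<open>riemann_zeta\<close> is not vacuous. The identity theorem on the connected punctured plane
  then determines the chosen function.\<close>

lemma riemann_zeta_eq:
  assumes "s \<noteq> 1"
  shows "riemann_zeta s = em_entire (1 - s) / (1 - s)"
proof -
  let ?P = "\<lambda>f. f holomorphic_on (- {1}) \<and>
     (\<forall>s. Re s > 1 \<longrightarrow> (\<lambda>n. 1 / of_nat (Suc n) powr s) sums f s)"
  have "(em_entire \<circ> (\<lambda>s. 1 - s)) holomorphic_on - {1}"
    by (intro holomorphic_on_compose em_entire_holomorphic holomorphic_intros)
  then have hol: "(\<lambda>s. em_entire (1 - s) / (1 - s)) holomorphic_on - {1}"
    unfolding o_def by (intro holomorphic_on_divide holomorphic_intros) auto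
  have "?P riemann_zeta"
    unfolding riemann_zeta_def
    by (rule someI[of ?P "\<lambda>s. em_entire (1 - s) / (1 - s)"])
       (use hol zeta_sums_em_entire in \<open>simp del: of_nat_Suc\<close>)
  then have Z: "riemann_zeta holomorphic_on - {1}"
    "\<And>s. Re s > 1 \<Longrightarrow> (\<lambda>n. 1 / of_nat (Suc n) powr s) sums riemann_zeta s" by auto
  show ?thesis
  proof (rule analytic_continuation_open[where s = "{s. Re s > 1}" and s' = "- {1}"
      and f = riemann_zeta and g = "\<lambda>s. em_entire (1 - s) / (1 - s)"])
    show "connected (- {1::complex})" by (simp add: connected_punctured_universe)
    show "{s. 1 < Re s} \<noteq> {}" by (auto intro: exI[of _ 2])
    show "riemann_zeta z = em_entire (1 - z) / (1 - z)" if "z \<in> {s. 1 < Re s}" for z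
      using Z(2) zeta_sums_em_entire that sums_unique2 by blast
  qed (use Z hol assms in \<open>auto intro: open_halfspace_Re_gt\<close>)
qed

text \<open>At \<open>a = k + 1\<close> the truncated operators act on a polynomial, so all terms vanish.\<close>

lemma em_entire_of_nat:
  assumes "k > 0"
  shows "em_entire (of_nat (Suc k)) = - (fact (Suc k) * bernoulli_fps $ Suc k)"
proof -
  let ?a = "of_nat (Suc k) :: complex" and ?N = "Suc (Suc k)"
  have z: "falling ?a (Suc ?N) = 0" by (intro falling_of_nat_eq_0) simp
  have "em_term ?N (Suc n) ?a = 0" for n
    using norm_em_term_le[of "Suc n" ?N ?a] unfolding z by simp
  then have "em_fun ?N ?a = - (\<Sum>j\<le>?N. bernoulli_fps $ j * falling ?a j)"
    unfolding em_fun_def by simp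
  also have "(\<Sum>j\<le>?N. bernoulli_fps $ j * falling ?a j) = (\<Sum>j\<le>Suc k. bernoulli_fps $ j * falling ?a j)"
    using falling_of_nat_eq_0[of "Suc k" ?N] by simp
  also have "\<dots> = fact (Suc k) * (\<Sum>j\<le>Suc k. bernoulli_fps $ j / fact (Suc k - j))"
    unfolding sum_distrib_left by (intro sum.cong refl) (simp add: falling_of_nat del: of_nat_Suc fact_Suc)
  \<comment> \<open>As \<open>k > 0\<close>, the convolution over \<open>j < Suc k\<close> is
    \<open>0\<close> and only the top term is left; at \<open>k = 0\<close> it would contribute
    \<open>1\<close>.\<close>
  also have "(\<Sum>j\<le>Suc k. bernoulli_fps $ j / fact (Suc k - j)) = bernoulli_fps $ Suc k"
    using bernoulli_convolution[of "Suc k"] assms unfolding lessThan_Suc_atMost[symmetric]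
    by (simp del: lessThan_Suc_atMost)
  finally show ?thesis using em_entire_eq[of ?N ?a] by simp
qed

text \<open>In classical notation the value is \<open>- B_(k+1) / (k+1)\<close>.\<close>

lemma riemann_zeta_neg_nat:
  assumes "k > 0"
  shows "riemann_zeta (- of_nat k) = - (fact k * bernoulli_fps $ Suc k)"
proof -
  have "riemann_zeta (- of_nat k) = em_entire (of_nat (Suc k)) / of_nat (Suc k)"
    using assms by (subst riemann_zeta_eq) (auto simp: complex_eq_iff)
  then show ?thesis unfolding em_entire_of_nat[OF assms] by (simp add: field_simps del: of_nat_Suc)
qed

section \<open>Pairing polynomials with power series\<close>

text \<open>The value of \<open>P(\<partial>) E\<close> at the origin.\<close>

definition pairing :: "complex fps \<Rightarrow> complex poly \<Rightarrow> complex" where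
  "pairing E P = (\<Sum>i\<le>degree P. coeff P i * (fact i * E $ i))"

lemma pairing_eq:
  assumes "degree P \<le> n"
  shows "pairing E P = (\<Sum>i\<le>n. coeff P i * (fact i * E $ i))"
  unfolding pairing_def using assms by (intro sum.mono_neutral_left) (auto intro: coeff_eq_0)

lemma pairing_add: "pairing E (P + Q) = pairing E P + pairing E Q"
  using pairing_eq[of P "max (degree P) (degree Q)" E] pairing_eq[of Q "max (degree P) (degree Q)" E]
    pairing_eq[of "P + Q" "max (degree P) (degree Q)" E]
  by (simp add: degree_add_le sum.distrib ring_distribs)

lemma pairing_smult: "pairing E (smult c P) = c * pairing E P"
  using pairing_eq[of "smult c P" "degree P" E]
  by (simp add: degree_smult_le pairing_def sum_distrib_left mult.assoc)

lemma pairing_0 [simp]: "pairing E 0 = 0"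
  by (simp add: pairing_def)

lemma pairing_minus: "pairing E (- P) = - pairing E P"
  using pairing_smult[of E "-1" P] by simp

lemma pairing_diff: "pairing E (P - Q) = pairing E P - pairing E Q"
  using pairing_add[of E P "- Q"] by (simp add: pairing_minus)

lemma pairing_fps_add: "pairing (E + F) P = pairing E P + pairing F P"
  by (simp add: pairing_def ring_distribs sum.distrib)

lemma pairing_fps_minus: "pairing (- E) P = - pairing E P"
  by (simp add: pairing_def sum_negf)

lemma pairing_fps_diff: "pairing (E - F) P = pairing E P - pairing F P"
  using pairing_fps_add[of E "- F" P] by (simp add: pairing_fps_minus)

lemma pairing_fps_const: "pairing (fps_const c * E) P = c * pairing E P"
  by (simp add: pairing_def sum_distrib_left algebra_simps)

lemma pairing_fps_0 [simp]: "pairing 0 P = 0"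
  by (simp add: pairing_def)

lemma pairing_fps_sum: "pairing (\<Sum>j\<in>A. E j) P = (\<Sum>j\<in>A. pairing (E j) P)"
  by (induction A rule: infinite_finite_induct) (simp_all add: pairing_fps_add)

lemma pairing_fps_1: "pairing 1 P = poly P 0"
proof -
  have "pairing 1 P = (\<Sum>i\<le>degree P. if i = 0 then coeff P 0 else 0)"
    unfolding pairing_def by (intro sum.cong) auto
  then show ?thesis by (simp add: poly_0_coeff_0)
qed

lemma pairing_pCons: "pairing E (pCons c Q) = c * E $ 0 + pairing (fps_deriv E) Q"
proof -
  have "pairing E (pCons c Q) = (\<Sum>i\<le>Suc (degree Q). coeff (pCons c Q) i * (fact i * E $ i))"
    by (intro pairing_eq degree_pCons_le)
  also have "\<dots> = c * E $ 0 + pairing (fps_deriv E) Q"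
    unfolding sum.atMost_Suc_shift pairing_def
    by (simp add: algebra_simps)
  finally show ?thesis .
qed

lemma pairing_monom: "pairing E (monom c n) = c * (fact n * E $ n)"
proof -
  have "pairing E (monom c n) = (\<Sum>i\<le>n. if i = n then c * (fact n * E $ n) else 0)"
    unfolding pairing_eq[OF degree_monom_le] by (intro sum.cong) auto
  then show ?thesis by simp
qed

text \<open>Dual to the fact that \<open>e^(a d/dx)\<close> is translation by \<open>a\<close>: a
  factor \<open>X\<close> of the polynomial differentiates the series, and past
  \<open>e^(a u)\<close> the derivative becomes derivative plus \<open>a\<close>. The series varies
  in the induction since each step differentiates it.\<close>

lemma pairing_fps_exp_mult: "pairing (fps_exp a * E) P = pairing E (pcompose P [:a, 1:])"
proof (induction P arbitrary: E)
  case (pCons c Q)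
  have d: "fps_deriv (fps_exp a * E) = fps_exp a * (fps_const a * E + fps_deriv E)"
    by (simp add: algebra_simps)
  have lin: "pairing E ([:a, 1:] * R) = pairing (fps_const a * E + fps_deriv E) R" for R
  proof -
    have "[:a, 1:] * R = smult a R + pCons 0 R" by simp
    then show ?thesis
      by (simp add: pairing_add pairing_smult pairing_pCons pairing_fps_add pairing_fps_const
          del: mult_pCons_left)
  qed
  show ?case
    unfolding pairing_pCons d pCons.IH pcompose_pCons pairing_add lin by simp
qed simp

lemma pairing_fps_exp: "pairing (fps_exp a) P = poly P a"
  using pairing_fps_exp_mult[of a 1 P] by (simp add: pairing_fps_1 poly_pcompose)

section \<open>Summation of polynomials by series with denominator \<open>1 - e^u\<close>\<close>

lemma geometric_fps_exp: "(1 - fps_exp 1) * (\<Sum>j<m. fps_exp (of_nat j :: complex)) = 1 - fps_exp (of_nat m)"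
proof -
  have "(1 - fps_exp (1::complex)) * (\<Sum>j<m. fps_exp 1 ^ j) = 1 - fps_exp 1 ^ m"
    by (rule one_diff_power_eq[symmetric])
  then show ?thesis by (simp add: fps_exp_power_mult)
qed

text \<open>Translation by \<open>m\<close> is multiplication of the series by
  \<open>e^(m u)\<close>, and \<open>1 - e^(m u)\<close> is \<open>1 - e^u\<close> times a geometric
  sum. For a series with denominator \<open>1 - e^u\<close> the right side is therefore an explicit
  finite sum.\<close>

lemma pairing_difference:
  "pairing E (P - pcompose P [:of_nat m, 1:]) =
    (\<Sum>j<m. pairing (fps_exp (of_nat j) * (E * (1 - fps_exp 1))) P)"
proof -
  have "pairing E (P - pcompose P [:of_nat m, 1:]) = pairing ((1 - fps_exp (of_nat m)) * E) P"
    by (simp add: pairing_diff pairing_fps_diff pairing_fps_exp_mult left_diff_distrib)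
  also have "(1 - fps_exp (of_nat m)) * E = (\<Sum>j<m. fps_exp (of_nat j) * (E * (1 - fps_exp 1)))"
    unfolding geometric_fps_exp[symmetric] sum_distrib_left sum_distrib_right by (simp add: algebra_simps)
  finally show ?thesis by (simp add: pairing_fps_sum)
qed

text \<open>The power series \<open>(e\<^sup>x\<^sup>u - 1) / (1 - e\<^sup>u)\<close>.\<close>

definition twist_fps :: "complex \<Rightarrow> complex fps" where
  "twist_fps x = - (fps_shift 1 (fps_exp x - 1) * bernoulli_fps)"

lemma bernoulli_mult_exp: "bernoulli_fps * (fps_exp 1 - 1) = fps_X"
  unfolding fps_X_mult_exp_quotient[symmetric] using bernoulli_exp_quotient
  by (simp add: mult.left_commute)

lemma fps_X_mult_shift: "f $ 0 = 0 \<Longrightarrow> fps_X * fps_shift 1 f = (f :: complex fps)"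
  by (rule fps_ext) auto

lemma twist_fps_mult: "twist_fps x * (1 - fps_exp 1) = fps_exp x - 1"
proof -
  have "twist_fps x * (1 - fps_exp 1) = fps_shift 1 (fps_exp x - 1) * (bernoulli_fps * (fps_exp 1 - 1))"
    by (simp add: twist_fps_def algebra_simps)
  then show ?thesis
    unfolding bernoulli_mult_exp using fps_X_mult_shift[of "fps_exp x - 1"] by (simp add: mult.commute)
qed

text \<open>This exchanges a sum over the coset \<open>x + Z\<close> for the sum over the integers
  that occurs in the cocycle.\<close>

lemma pairing_twist_fps:
  "pairing (twist_fps x) (P - pcompose P [:of_nat m, 1:]) = (\<Sum>j<m. poly P (x + of_nat j) - poly P (of_nat j))"
proof -
  have "fps_exp (of_nat j) * (fps_exp x - 1) = fps_exp (x + of_nat j) - fps_exp (of_nat j)" for j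
    by (simp add: algebra_simps fps_exp_add_mult)
  then show ?thesis
    by (simp add: pairing_difference twist_fps_mult pairing_fps_diff pairing_fps_exp)
qed

text \<open>The power series \<open>1 / (1 - e\<^sup>u) + 1 / u\<close>, whose pairing with \<open>X\<^sup>k\<close> is \<open>\<zeta>(-k)\<close>.\<close>

definition zeta_fps :: "complex fps" where
  "zeta_fps = - fps_shift 1 bernoulli_fps"

lemma bernoulli_fps_0: "bernoulli_fps $ 0 = 1"
  using bernoulli_convolution[of 1] by simp

lemma zeta_fps_mult: "zeta_fps * (1 - fps_exp 1) = 1 - exp_quotient"
proof -
  have X: "fps_X * zeta_fps = 1 - bernoulli_fps"
  proof (rule fps_ext)
    fix n show "(fps_X * zeta_fps) $ n = (1 - bernoulli_fps) $ n"
      by (cases n) (simp_all add: zeta_fps_def bernoulli_fps_0)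
  qed
  have "zeta_fps * (1 - fps_exp 1) = - (fps_X * zeta_fps) * exp_quotient"
    unfolding minus_diff_eq[of "fps_exp 1" 1, symmetric] fps_X_mult_exp_quotient[symmetric]
    by (simp add: algebra_simps)
  also have "\<dots> = 1 - exp_quotient"
    unfolding X using bernoulli_exp_quotient by (simp add: algebra_simps)
  finally show ?thesis .
qed

text \<open>The series \<open>(e^u - 1)/u\<close> represents integration over the unit
  interval.\<close>

lemma pairing_exp_quotient_pderiv: "pairing exp_quotient (pderiv R) = poly R 1 - poly R 0"
proof -
  have "poly R 1 - poly R 0 = pairing (fps_exp 1 - 1) R"
    by (simp add: pairing_fps_diff pairing_fps_1 pairing_fps_exp)
  also have "\<dots> = pairing exp_quotient (pderiv R)"
  proof (cases "pderiv R = 0")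
    case True
    then have "degree R = 0" by (simp add: pderiv_eq_0_iff)
    then show ?thesis using True by (simp add: pairing_def)
  next
    case False
    then have "degree R = Suc (degree (pderiv R))"
      by (cases "degree R") (simp_all add: pderiv_eq_0_iff degree_pderiv)
    then show ?thesis unfolding pairing_def
      by (simp add: sum.atMost_Suc_shift coeff_pderiv exp_quotient_def del: sum.atMost_Suc of_nat_Suc fact_Suc)
         (auto intro!: sum.cong simp: divide_simps of_nat_Suc[symmetric] simp del: of_nat_Suc)
  qed
  finally show ?thesis by simp
qed

text \<open>Exact Euler-Maclaurin summation: \<open>zeta_fps * (1 - e^u)\<close> is evaluation at
  \<open>0\<close> minus integration over the unit interval, so the shifts by \<open>j < m\<close>
  add up to sum minus integral.\<close>

lemma pairing_zeta_fps:
  "pairing zeta_fps (pderiv R - pcompose (pderiv R) [:of_nat m, 1:]) =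
    (\<Sum>j<m. poly (pderiv R) (of_nat j)) - (poly R (of_nat m) - poly R 0)"
proof -
  have "pairing (fps_exp (of_nat j) * (1 - exp_quotient)) (pderiv R) =
     poly (pderiv R) (of_nat j) - (poly R (of_nat (Suc j)) - poly R (of_nat j))" for j
  proof -
    have "pcompose (pderiv R) [:of_nat j, 1:] = pderiv (pcompose R [:of_nat j, 1:])"
      by (simp add: pderiv_pcompose pderiv_pCons)
    then show ?thesis
      by (simp add: right_diff_distrib pairing_fps_diff pairing_fps_exp pairing_fps_exp_mult
          pairing_exp_quotient_pderiv poly_pcompose add.commute)
  qed
  moreover have "(\<Sum>j<m. poly R (of_nat (Suc j)) - poly R (of_nat j)) = poly R (of_nat m) - poly R 0"
    using sum_lessThan_telescope[of "\<lambda>j. poly R (of_nat j)" m] by simp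
  ultimately show ?thesis
    by (simp add: pairing_difference zeta_fps_mult sum_subtractf del: of_nat_Suc)
qed

lemma pairing_zeta_fps_monom:
  assumes "k > 0"
  shows "pairing zeta_fps (monom c k) = c * riemann_zeta (- of_nat k)"
  using riemann_zeta_neg_nat[OF assms] by (simp add: pairing_monom zeta_fps_def)

lemma pderiv_surj: "\<exists>R. pderiv R = (P :: complex poly)"
proof -
  let ?R = "Poly (0 # map (\<lambda>i. coeff P i / of_nat (Suc i)) [0..<Suc (degree P)])"
  have "coeff (pderiv ?R) i = coeff P i" for i
    by (cases "i \<le> degree P") (auto simp: coeff_pderiv nth_default_def coeff_eq_0 simp del: upt_Suc of_nat_Suc)
  then show ?thesis by (auto simp: poly_eq_iff)
qed

text \<open>Algebraic form of \<open>\<integral>\<^sub>0\<^sup>M x\<^sup>a (M - x)\<^sup>b dx\<close>.\<close>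

lemma beta_integral:
  assumes "pderiv R = [:0, 1:] ^ a * [:M, -1:] ^ b"
  shows "poly R M - poly R 0 = fact a * fact b / fact (a + b + 1) * (M :: complex) ^ (a + b + 1)"
  using assms
proof (induction b arbitrary: a R)
  case 0
  let ?S = "smult (1 / of_nat (Suc a)) ([:0, 1:] ^ Suc a) :: complex poly"
  have "pderiv ?S = [:0, 1:] ^ a"
    unfolding pderiv_smult pderiv_power_Suc by (simp add: pderiv_pCons del: of_nat_Suc)
  then have "pderiv (R - ?S) = 0" using 0 by (simp add: pderiv_diff)
  then obtain c where "R - ?S = [:c:]" by (metis pderiv_eq_0_iff degree_eq_zeroE)
  then have "R = [:c:] + ?S" by (simp add: diff_eq_eq)
  then show ?case by (simp add: divide_simps of_nat_Suc[symmetric] del: of_nat_Suc)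
next
  case (Suc b)
  obtain R' where R': "pderiv R' = [:0, 1:] ^ Suc a * [:M, -1:] ^ b" using pderiv_surj by blast
  \<comment> \<open>The boundary term of an integration by parts; it vanishes at both
    \<open>0\<close> and \<open>M\<close>.\<close>
  let ?S = "[:0, 1:] ^ Suc a * [:M, -1:] ^ Suc b"
  have "pderiv ?S = smult (of_nat (Suc a)) (pderiv R) - smult (of_nat (Suc b)) (pderiv R')"
  proof -
    define A B where "A = [:0, 1 :: complex:]" and "B = [:M, -1:]"
    have "pderiv A = 1" "pderiv B = -1" by (simp_all add: A_def B_def pderiv_pCons one_pCons)
    then show ?thesis
      unfolding Suc.prems R' A_def[symmetric] B_def[symmetric] pderiv_mult pderiv_power_Suc
      by (simp add: mult_ac del: of_nat_Suc)
  qed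
  then have "pderiv (?S - smult (of_nat (Suc a)) R + smult (of_nat (Suc b)) R') = 0"
    by (simp add: pderiv_add pderiv_diff pderiv_smult del: power_Suc of_nat_Suc)
  then obtain c where c: "?S - smult (of_nat (Suc a)) R + smult (of_nat (Suc b)) R' = [:c:]"
    by (metis pderiv_eq_0_iff degree_eq_zeroE)
  then have "poly ?S x - of_nat (Suc a) * poly R x + of_nat (Suc b) * poly R' x = c" for x
  proof -
    have "poly ?S x - of_nat (Suc a) * poly R x + of_nat (Suc b) * poly R' x =
        poly (?S - smult (of_nat (Suc a)) R + smult (of_nat (Suc b)) R') x"
      by (simp only: poly_add poly_diff poly_smult)
    then show ?thesis unfolding c by simp
  qed
  from this[of M] this[of 0]
  have "of_nat (Suc a) * (poly R M - poly R 0) = of_nat (Suc b) * (poly R' M - poly R' 0)"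
    by (simp add: algebra_simps)
  also have "poly R' M - poly R' 0 = fact (Suc a) * fact b / fact (Suc a + b + 1) * M ^ (Suc a + b + 1)"
    by (rule Suc.IH[OF R'])
  also have "of_nat (Suc b) * (fact (Suc a) * fact b / fact (Suc a + b + 1) * M ^ (Suc a + b + 1)) =
      of_nat (Suc a) * (fact a * fact (Suc b) / fact (a + Suc b + 1) * M ^ (a + Suc b + 1))"
    unfolding fact_Suc[of a] fact_Suc[of b] by (simp del: of_nat_Suc fact_Suc)
  finally show ?case by (metis mult_left_cancel of_nat_neq_0)
qed

text \<open>\<open>t\<^sup>n f(D)\<close> lies in \<open>\<D>\<^sup>+\<close> when \<open>f = D g\<close> with \<open>g\<close> invariant under \<open>D \<mapsto> - n - D\<close>.\<close>

definition reflective :: "int \<Rightarrow> complex poly \<Rightarrow> bool" where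
  "reflective n f \<longleftrightarrow> (\<forall>x. x * poly f (- of_int n - x) + (of_int n + x) * poly f x = 0)"

lemma reflective_0: "reflective n 0"
  by (simp add: reflective_def)

lemma reflective_add:
  assumes "reflective n f" "reflective n g"
  shows "reflective n (f + g)"
  unfolding reflective_def
proof
  fix x
  have "(x * poly f (- of_int n - x) + (of_int n + x) * poly f x) +
      (x * poly g (- of_int n - x) + (of_int n + x) * poly g x) = 0"
    using assms by (simp add: reflective_def)
  then show "x * poly (f + g) (- of_int n - x) + (of_int n + x) * poly (f + g) x = 0"
    by (simp add: ring_distribs add_ac)
qed

lemma reflective_smult:
  assumes "reflective n f"
  shows "reflective n (smult c f)"
  unfolding reflective_def
proof
  fix x
  have "c * (x * poly f (- of_int n - x) + (of_int n + x) * poly f x) = 0"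
    using assms by (simp add: reflective_def)
  then show "x * poly (smult c f) (- of_int n - x) + (of_int n + x) * poly (smult c f) x = 0"
    by (simp add: algebra_simps)
qed

text \<open>For \<open>n = 0\<close> the identity says nothing at \<open>x = 0\<close>, but
  cancelling the polynomial factor \<open>x\<close> shows that \<open>f\<close> is odd.\<close>

lemma reflective_poly_0:
  assumes "reflective n f"
  shows "poly f 0 = 0"
proof (cases "n = 0")
  case True
  have "[:0, 1:] * (pcompose f [:0, -1:] + f) = 0"
    using assms True by (intro poly_ext) (simp add: reflective_def poly_pcompose ring_distribs)
  then have "pcompose f [:0, -1:] + f = 0" by simp
  from arg_cong[OF this, of "\<lambda>P. poly P 0"] show ?thesis by (simp add: poly_pcompose)
next
  case False
  then show ?thesis using assms[unfolded reflective_def, rule_format, of 0] by simp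
qed

definition bracket_poly :: "int \<Rightarrow> complex poly \<Rightarrow> int \<Rightarrow> complex poly \<Rightarrow> complex poly" where
  "bracket_poly m f n g = pcompose f [:of_int n, 1:] * g - pcompose g [:of_int m, 1:] * f"

lemma poly_bracket_poly:
  "poly (bracket_poly m f n g) x = poly f (x + of_int n) * poly g x - poly g (x + of_int m) * poly f x"
  by (simp add: bracket_poly_def poly_pcompose add.commute)

lemma bracket_poly_swap: "bracket_poly n g m f = - bracket_poly m f n g"
  by (simp add: bracket_poly_def algebra_simps)

text \<open>The factor \<open>x\<close> turns \<open>f(-m - x)\<close> and \<open>g(-n - x)\<close>
  into multiples of \<open>f(x)\<close> and \<open>g(x)\<close>; the new factors
  \<open>m + x\<close> and \<open>n + x\<close> then do the same for \<open>g(-m - n - x)\<close>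
  and \<open>f(-m - n - x)\<close>, and both products acquire the common factor
  \<open>m + n + x\<close>.\<close>

lemma reflective_bracket_poly:
  assumes "reflective m f" "reflective n g"
  shows "reflective (m + n) (bracket_poly m f n g)"
  unfolding reflective_def
proof
  fix x :: complex
  let ?m = "of_int m :: complex" and ?n = "of_int n :: complex"
  note F = assms(1)[unfolded reflective_def, rule_format]
  note G = assms(2)[unfolded reflective_def, rule_format]
  have f1: "x * poly f (- ?m - x) = - (?m + x) * poly f x" using F[of x] by (simp add: algebra_simps add_eq_0_iff)
  have g1: "x * poly g (- ?n - x) = - (?n + x) * poly g x" using G[of x] by (simp add: algebra_simps add_eq_0_iff)
  have f2: "(?n + x) * poly f (- ?m - ?n - x) = - (?m + ?n + x) * poly f (x + ?n)"
  proof -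
    have "- ?m - (?n + x) = - ?m - ?n - x" by simp
    then show ?thesis using F[of "?n + x"] unfolding minus_mult_left[symmetric] eq_neg_iff_add_eq_0
      by (simp only: add_ac)
  qed
  have g2: "(?m + x) * poly g (- ?m - ?n - x) = - (?m + ?n + x) * poly g (x + ?m)"
  proof -
    have "- ?n - (?m + x) = - ?m - ?n - x" by simp
    then show ?thesis using G[of "?m + x"] unfolding minus_mult_left[symmetric] eq_neg_iff_add_eq_0
      by (simp only: add_ac)
  qed
  have "x * poly (bracket_poly m f n g) (- of_int (m + n) - x) =
     (x * poly f (- ?m - x)) * poly g (- ?m - ?n - x) - (x * poly g (- ?n - x)) * poly f (- ?m - ?n - x)"
  proof -
    have "- of_int (m + n) - x + ?n = - ?m - x" "- of_int (m + n) - x + ?m = - ?n - x"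
      "- of_int (m + n) - x = - ?m - ?n - x" by simp_all
    then show ?thesis unfolding poly_bracket_poly by (simp only: right_diff_distrib mult_ac)
  qed
  also have "\<dots> = - poly f x * ((?m + x) * poly g (- ?m - ?n - x)) + poly g x * ((?n + x) * poly f (- ?m - ?n - x))"
    unfolding f1 g1 by (simp add: algebra_simps)
  also have "\<dots> = - (of_int (m + n) + x) * poly (bracket_poly m f n g) x"
    unfolding f2 g2 by (simp add: poly_bracket_poly algebra_simps)
  finally show "x * poly (bracket_poly m f n g) (- of_int (m + n) - x) +
      (of_int (m + n) + x) * poly (bracket_poly m f n g) x = 0"
    by (simp add: algebra_simps)
qed

text \<open>At an integer \<open>i\<close> this is minus the summand of \<open>psi_hom\<close>; at
  \<open>k/p\<close> it is the weight with which the mode of that index enters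
  \<open>R_R_vac\<close>.\<close>

definition vac_poly :: "int \<Rightarrow> complex poly \<Rightarrow> complex poly \<Rightarrow> complex poly" where
  "vac_poly m f g = - (pcompose f [:0, -1:] * pcompose g [:of_int m, -1:])"

lemma poly_vac_poly: "poly (vac_poly m f g) x = - (poly f (- x) * poly g (of_int m - x))"
  by (simp add: vac_poly_def poly_pcompose)

text \<open>The two reflection identities give the symmetry only after multiplication by
  \<open>x (m - x)\<close>. This factor is cancelled in the polynomial ring, so that the endpoints
  are covered as well.\<close>

lemma vac_poly_reflect:
  assumes "reflective m f" "reflective (- m) g"
  shows "poly (vac_poly m f g) (of_int m - x) = poly (vac_poly m f g) x"
proof -
  let ?m = "of_int m :: complex" and ?P = "vac_poly m f g"
  have "[:0, 1:] * [:?m, -1:] * (pcompose ?P [:?m, -1:] - ?P) = 0"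
  proof (rule poly_ext)
    fix y
    have f1: "y * poly f (y - ?m) = (?m - y) * poly f (- y)"
      using assms(1)[unfolded reflective_def, rule_format, of "- y"] by (simp add: algebra_simps)
    have g1: "(?m - y) * poly g y = y * poly g (?m - y)"
      using assms(2)[unfolded reflective_def, rule_format, of "y"] by (simp add: algebra_simps)
    have "y * (?m - y) * poly ?P (?m - y) = - (y * poly f (y - ?m)) * ((?m - y) * poly g y)"
      by (simp add: poly_vac_poly algebra_simps)
    also have "\<dots> = y * (?m - y) * poly ?P y"
      unfolding f1 g1 by (simp add: poly_vac_poly algebra_simps)
    finally show "poly ([:0, 1:] * [:?m, -1:] * (pcompose ?P [:?m, -1:] - ?P)) y = poly 0 y"
      by (simp add: poly_pcompose algebra_simps)
  qed
  then have "pcompose ?P [:?m, -1:] = ?P" by (simp del: mult_pCons_left)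
  from arg_cong[OF this, of "\<lambda>P. poly P x"] show ?thesis by (simp add: poly_pcompose)
qed

text \<open>Up to sign the two products in the bracket are \<open>P(m - x)\<close> and
  \<open>P(-x)\<close>, which the symmetry of \<open>P\<close> turns into \<open>P(x)\<close> and
  \<open>P(x + m)\<close>.\<close>

lemma bracket_poly_eq_vac_poly:
  assumes "reflective (int m) f" "reflective (- int m) g"
  shows "bracket_poly (int m) f (- int m) g =
    - (vac_poly (int m) f g - pcompose (vac_poly (int m) f g) [:of_nat m, 1:])"
proof (rule poly_ext)
  fix x
  show "poly (bracket_poly (int m) f (- int m) g) x =
    poly (- (vac_poly (int m) f g - pcompose (vac_poly (int m) f g) [:of_nat m, 1:])) x"
    using vac_poly_reflect[OF assms, of x] vac_poly_reflect[OF assms, of "- x"]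
    by (simp add: poly_pcompose poly_bracket_poly) (simp add: poly_vac_poly algebra_simps)
qed

lemma psi_hom_eq_vac_poly:
  assumes "m > 0" "reflective (int m) f" "reflective (- int m) g"
  shows "psi_hom (int m) f (- int m) g = - (\<Sum>j<m. poly (vac_poly (int m) f g) (of_nat j))"
proof -
  let ?P = "vac_poly (int m) f g"
  \<comment> \<open>Both endpoints contribute nothing, so summing over \<open>1..m\<close> is the
    same as summing over \<open>0..m-1\<close>.\<close>
  have 0: "poly ?P 0 = 0" "poly ?P (of_nat m) = 0"
    using reflective_poly_0[OF assms(2)] reflective_poly_0[OF assms(3)] by (simp_all add: poly_vac_poly)
  have "psi_hom (int m) f (- int m) g = (\<Sum>i=1..int m. poly f (- of_int i) * poly g (of_int (int m - i)))"
    using assms(1) by (simp add: psi_hom_def)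
  also have "\<dots> = (\<Sum>j\<in>{1..m}. - poly ?P (of_nat j))"
    by (rule sum.reindex_bij_witness[of _ int nat]) (auto simp: poly_vac_poly of_nat_nat)
  also have "\<dots> = - (\<Sum>j\<in>{1..m}. poly ?P (of_nat j))" by (simp add: sum_negf)
  also have "(\<Sum>j\<in>{1..m}. poly ?P (of_nat j)) = (\<Sum>j\<in>{..m}. poly ?P (of_nat j))"
    using 0 by (intro sum.mono_neutral_left) (auto simp: Suc_le_eq)
  also have "\<dots> = (\<Sum>j<m. poly ?P (of_nat j))"
    using 0 by (simp add: lessThan_Suc_atMost[symmetric])
  finally show ?thesis .
qed

lemma psi_hom_swap: "psi_hom n g m f = - psi_hom m f n g"
  by (simp add: psi_hom_def)

text \<open>The eigenvalue of \<open>f(D)\<close> on the vacuum. For \<open>f = gen_poly 0 r\<close>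
  it is the scalar term of the vertex operator, see \<open>diff_coeff_scalar_series\<close>.\<close>

definition vac_scalar :: "nat \<Rightarrow> (int \<Rightarrow> nat) \<Rightarrow> complex poly \<Rightarrow> complex" where
  "vac_scalar p D f = - (1/2) * (\<Sum>k<p. of_nat (D (int k)) * pairing (twist_fps (of_nat k / of_nat p)) f)"

lemma vac_scalar_add: "vac_scalar p D (f + g) = vac_scalar p D f + vac_scalar p D g"
  by (simp add: vac_scalar_def pairing_add ring_distribs sum.distrib)

lemma vac_scalar_smult: "vac_scalar p D (smult c f) = c * vac_scalar p D f"
  by (simp add: vac_scalar_def pairing_smult sum_distrib_left algebra_simps)

text \<open>Splitting \<open>k < p m\<close> into residue classes modulo \<open>p\<close> gives sums
  over \<open>k/p + j\<close>, \<open>j < m\<close>. By \<open>pairing_twist_fps\<close> each is a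
  scalar pairing plus the sum over the integers; the latter is common to all classes and so is
  weighted with the total dimension, which is the central term.\<close>

lemma vac_scalar_bracket_poly:
  assumes "m > 0" "reflective (int m) f" "reflective (- int m) g" "p > 0"
    and per: "\<And>k. D (k + int p) = D k"
  shows "vac_scalar p D (bracket_poly (int m) f (- int m) g)
     - of_nat (\<Sum>k<p. D (int k)) / 2 * psi_hom (int m) f (- int m) g =
    1/2 * (\<Sum>k<p * m. of_nat (D (int k)) * poly (vac_poly (int m) f g) (of_nat k / of_nat p))"
proof -
  let ?P = "vac_poly (int m) f g"
  have per': "D (int (k + j * p)) = D (int k)" for k j
  proof (induction j)
    case (Suc j)
    have "int (k + Suc j * p) = int (k + j * p) + int p" by simp
    then show ?case using Suc per by metis
  qed simp
  have "(\<Sum>k<p * m. of_nat (D (int k)) * poly ?P (of_nat k / of_nat p)) =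
     (\<Sum>j<m. \<Sum>k<p. of_nat (D (int k)) * poly ?P (of_nat k / of_nat p + of_nat j))"
  proof -
    have "(\<Sum>k<p * m. of_nat (D (int k)) * poly ?P (of_nat k / of_nat p)) =
       (\<Sum>j<m. \<Sum>k\<in>{j * p..<j * p + p}. of_nat (D (int k)) * poly ?P (of_nat k / of_nat p))"
      by (simp add: sum.nat_group mult.commute)
    also have "\<dots> = (\<Sum>j<m. \<Sum>k<p. of_nat (D (int (k + j * p))) * poly ?P (of_nat (k + j * p) / of_nat p))"
    proof (rule sum.cong[OF refl])
      fix j
      show "(\<Sum>k\<in>{j * p..<j * p + p}. of_nat (D (int k)) * poly ?P (of_nat k / of_nat p)) =
          (\<Sum>k<p. of_nat (D (int (k + j * p))) * poly ?P (of_nat (k + j * p) / of_nat p))"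
        by (rule sum.reindex_bij_witness[of _ "\<lambda>k. k + j * p" "\<lambda>k. k - j * p"]) auto
    qed
    also have "\<dots> = (\<Sum>j<m. \<Sum>k<p. of_nat (D (int k)) * poly ?P (of_nat k / of_nat p + of_nat j))"
      unfolding per' using assms(4) by (simp add: add_divide_distrib)
    finally show ?thesis .
  qed
  also have "\<dots> = (\<Sum>k<p. of_nat (D (int k)) * (\<Sum>j<m. poly ?P (of_nat k / of_nat p + of_nat j)))"
    by (subst sum.swap) (simp add: sum_distrib_left)
  also have "\<dots> = (\<Sum>k<p. of_nat (D (int k)) * (pairing (twist_fps (of_nat k / of_nat p)) (?P - pcompose ?P [:of_nat m, 1:])
      + (\<Sum>j<m. poly ?P (of_nat j))))"
    by (simp add: pairing_twist_fps sum_subtractf)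
  also have "\<dots> = 2 * (vac_scalar p D (bracket_poly (int m) f (- int m) g)
     - of_nat (\<Sum>k<p. D (int k)) / 2 * psi_hom (int m) f (- int m) g)"
    unfolding vac_scalar_def bracket_poly_eq_vac_poly[OF assms(2,3)] psi_hom_eq_vac_poly[OF assms(1-3)] pairing_minus
    by (simp add: ring_distribs sum.distrib sum_negf sum_distrib_right)
  finally show ?thesis by simp
qed

section \<open>Quadratic operators on a Fock space\<close>

text \<open>\<open>a q k\<close> stands for \<open>\<alpha>\<^sub>q(k/p)\<close>, \<open>M k\<close> for the matrix of the projection onto \<open>\<hh>\<^sub>(\<^sub>k\<^sub>)\<close> in the
  basis \<open>\<alpha>\<close>, and \<open>D k\<close> for its rank.\<close>

locale fock = vector_space scale
  for scale :: "complex \<Rightarrow> 'v::ab_group_add \<Rightarrow> 'v" (infixr \<open>\<odot>\<close> 75) +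
  fixes a :: "nat \<Rightarrow> int \<Rightarrow> 'v \<Rightarrow> 'v" and v0 :: 'v and d p :: nat
    and M :: "int \<Rightarrow> nat \<Rightarrow> nat \<Rightarrow> complex" and D :: "int \<Rightarrow> nat"
  assumes p_pos: "p > 0"
    and a_add: "q \<in> {1..d} \<Longrightarrow> a q k (u + v) = a q k u + a q k v"
    and a_scale: "q \<in> {1..d} \<Longrightarrow> a q k (c \<odot> v) = c \<odot> a q k v"
    and a_comm: "q \<in> {1..d} \<Longrightarrow> q' \<in> {1..d} \<Longrightarrow>
      a q k (a q' l v) = a q' l (a q k v) + (if k + l = 0 then (of_int k / of_nat p * M k q q') \<odot> v else 0)"
    and M_proj: "q \<in> {1..d} \<Longrightarrow> (\<Sum>q'=1..d. M k q q' \<odot> a q' (k + int p * n) v) = a q (k + int p * n) v"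
    and M_sym: "q \<in> {1..d} \<Longrightarrow> q' \<in> {1..d} \<Longrightarrow> M (- k) q q' = M k q' q"
    and M_trace: "(\<Sum>q=1..d. M k q q) = of_nat (D k)"
    and D_periodic: "D (k + int p) = D k"
    and D_sum: "(\<Sum>k<p. D (int k)) = d"
    and a_vac: "q \<in> {1..d} \<Longrightarrow> k \<ge> 0 \<Longrightarrow> a q k v0 = 0"
    and generated [consumes 0, case_names vac add scale act]: "P v0 \<Longrightarrow> (\<And>u v. P u \<Longrightarrow> P v \<Longrightarrow> P (u + v)) \<Longrightarrow>
      (\<And>c v. P v \<Longrightarrow> P (c \<odot> v)) \<Longrightarrow> (\<And>q k v. q \<in> {1..d} \<Longrightarrow> P v \<Longrightarrow> P (a q k v)) \<Longrightarrow> P v"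
begin

definition linop :: "('v \<Rightarrow> 'v) \<Rightarrow> bool" where
  "linop X \<longleftrightarrow> (\<forall>u v. X (u + v) = X u + X v) \<and> (\<forall>c v. X (c \<odot> v) = c \<odot> X v)"

lemma linop_add: "linop X \<Longrightarrow> X (u + v) = X u + X v"
  and linop_scale: "linop X \<Longrightarrow> X (c \<odot> v) = c \<odot> X v"
  by (simp_all add: linop_def)

lemma linop_0: "linop X \<Longrightarrow> X 0 = 0"
  using linop_scale[of X 0 0] by simp

lemma linop_diff: "linop X \<Longrightarrow> X (u - v) = X u - X v"
  using linop_add[of X "u - v" v] by simp

lemma linop_uminus: "linop X \<Longrightarrow> X (- u) = - X u"
  using linop_scale[of X "-1" u] by simp

lemma linop_sum: "linop X \<Longrightarrow> X (\<Sum>i\<in>I. f i) = (\<Sum>i\<in>I. X (f i))"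
  by (induction I rule: infinite_finite_induct) (simp_all add: linop_0 linop_add)

lemma linop_a: "q \<in> {1..d} \<Longrightarrow> linop (a q k)"
  by (simp add: linop_def a_add a_scale)

lemma linop_plus: "linop X \<Longrightarrow> linop Y \<Longrightarrow> linop (\<lambda>v. X v + Y v)"
  and linop_minus: "linop X \<Longrightarrow> linop Y \<Longrightarrow> linop (\<lambda>v. X v - Y v)"
  and linop_compose: "linop X \<Longrightarrow> linop Y \<Longrightarrow> linop (\<lambda>v. X (Y v))"
  and linop_const_scale: "linop (\<lambda>v. c \<odot> v)"
  by (auto simp: linop_def algebra_simps scale_right_distrib scale_right_diff_distrib)

lemma linop_sum_fun: "(\<And>i. i \<in> I \<Longrightarrow> linop (X i)) \<Longrightarrow> linop (\<lambda>v. \<Sum>i\<in>I. X i v)"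
  unfolding linop_def by (simp add: sum.distrib scale_sum_right)

lemma annihilated: "\<exists>K\<ge>0. \<forall>q\<in>{1..d}. \<forall>k>K. a q k v = 0"
proof (induction v rule: generated)
  case vac
  then show ?case by (intro exI[of _ 0]) (auto simp: a_vac)
next
  case (add u v)
  then obtain K L where "K \<ge> 0" "L \<ge> 0" "\<forall>q\<in>{1..d}. \<forall>k>K. a q k u = 0" "\<forall>q\<in>{1..d}. \<forall>k>L. a q k v = 0"
    by blast
  then show ?case by (intro exI[of _ "max K L"]) (auto simp: a_add)
next
  case (scale c v)
  then show ?case by (metis a_scale scale_zero_right)
next
  case (act q l v)
  then obtain K where K: "K \<ge> 0" "\<forall>q\<in>{1..d}. \<forall>k>K. a q k v = 0" by blast
  have "a q' k (a q l v) = 0" if "q' \<in> {1..d}" "k > max K (- l)" for q' k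
    using a_comm[OF that(1) act(1), of k l v] K that act(1) linop_0[OF linop_a[OF act(1)]] by simp
  then show ?case using K by (intro exI[of _ "max K (- l)"]) auto
qed

section \<open>Normally ordered quadratic operators\<close>

definition nprod :: "nat \<Rightarrow> int \<Rightarrow> int \<Rightarrow> 'v \<Rightarrow> 'v" where
  "nprod q k l v = (if k > 0 then a q l (a q k v) else a q k (a q l v))"

definition Q :: "int \<Rightarrow> (int \<Rightarrow> complex) \<Rightarrow> 'v \<Rightarrow> 'v" where
  "Q n w v = (1/2) \<odot> (\<Sum>q=1..d. Sum_any (\<lambda>k. w k \<odot> nprod q k (int p * n - k) v))"

text \<open>Turns \<open>Sum_any\<close> into a sum over an explicit finite set. Such sets can be
  enlarged, hence shared by several vectors.\<close>

definition supports :: "int \<Rightarrow> int set \<Rightarrow> 'v \<Rightarrow> bool" where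
  "supports n F v \<longleftrightarrow> finite F \<and> (\<forall>q\<in>{1..d}. \<forall>k. k \<notin> F \<longrightarrow> nprod q k (int p * n - k) v = 0)"

lemma supports_mono: "supports n F v \<Longrightarrow> finite G \<Longrightarrow> F \<subseteq> G \<Longrightarrow> supports n G v"
  unfolding supports_def by blast

lemma ex_supports: "\<exists>F. supports n F v"
proof -
  obtain K where K: "K \<ge> 0" "\<forall>q\<in>{1..d}. \<forall>k>K. a q k v = 0" using annihilated by blast
  \<comment> \<open>Above \<open>K\<close> the mode \<open>k\<close> acts first and kills
    \<open>v\<close>; below the lower bound \<open>k\<close> is negative and
    \<open>p n - k > K\<close> acts first.\<close>
  have "supports n {min 0 (int p * n - K)..K} v"
    using K by (auto simp: supports_def nprod_def linop_0[OF linop_a])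
  then show ?thesis by blast
qed

lemma Q_eq:
  assumes "supports n F v"
  shows "Q n w v = (1/2) \<odot> (\<Sum>q=1..d. \<Sum>k\<in>F. w k \<odot> nprod q k (int p * n - k) v)"
  unfolding Q_def using assms
  by (intro arg_cong[where f = "\<lambda>v. (1/2) \<odot> v"] sum.cong refl Sum_any.expand_superset)
     (auto simp: supports_def)

lemma nprod_add: "q \<in> {1..d} \<Longrightarrow> nprod q k l (u + v) = nprod q k l u + nprod q k l v"
  and nprod_scale: "q \<in> {1..d} \<Longrightarrow> nprod q k l (c \<odot> v) = c \<odot> nprod q k l v"
  by (simp_all add: nprod_def a_add a_scale)

lemma linop_Q: "linop (Q n w)"
  unfolding linop_def
proof (intro conjI allI)
  fix u v c
  obtain F1 F2 where "supports n F1 u" "supports n F2 v" using ex_supports by blast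
  then have F: "supports n (F1 \<union> F2) u" "supports n (F1 \<union> F2) v"
    by (auto intro: supports_mono simp: supports_def)
  then have F': "supports n (F1 \<union> F2) (u + v)" "supports n (F1 \<union> F2) (c \<odot> v)"
    by (auto simp: supports_def nprod_add nprod_scale)
  show "Q n w (u + v) = Q n w u + Q n w v"
    unfolding Q_eq[OF F(1)] Q_eq[OF F(2)] Q_eq[OF F'(1)]
    by (simp add: nprod_add scale_right_distrib sum.distrib)
  show "Q n w (c \<odot> v) = c \<odot> Q n w v"
    unfolding Q_eq[OF F(2)] Q_eq[OF F'(2)]
    by (simp add: nprod_scale scale_sum_right mult_ac)
qed

lemma Q_weight_add: "Q n (\<lambda>k. w k + w' k) v = Q n w v + Q n w' v"
proof -
  obtain F where "supports n F v" using ex_supports by blast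
  from Q_eq[OF this] show ?thesis by (simp add: scale_left_distrib sum.distrib scale_right_distrib)
qed

lemma Q_weight_scale: "Q n (\<lambda>k. c * w k) v = c \<odot> Q n w v"
proof -
  obtain F where "supports n F v" using ex_supports by blast
  from Q_eq[OF this] show ?thesis by (simp add: scale_sum_right mult_ac)
qed

text \<open>Each contraction is a scalar, so both orderings in \<open>nprod\<close> produce the same
  two correction terms.\<close>

lemma nprod_comm:
  assumes "q \<in> {1..d}" "q' \<in> {1..d}"
  shows "nprod q k m (a q' l v) = a q' l (nprod q k m v)
     + (if m + l = 0 then (of_int m / of_nat p * M m q q') \<odot> a q k v else 0)
     + (if k + l = 0 then (of_int k / of_nat p * M k q q') \<odot> a q m v else 0)"
proof -
  let ?m = "if m + l = 0 then (of_int m / of_nat p * M m q q') \<odot> v else 0"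
    and ?k = "if k + l = 0 then (of_int k / of_nat p * M k q q') \<odot> v else 0"
  have m: "a q m (a q' l v) = a q' l (a q m v) + ?m" and k: "a q k (a q' l v) = a q' l (a q k v) + ?k"
    and mk: "a q m (a q' l (a q k v)) = a q' l (a q m (a q k v))
       + (if m + l = 0 then (of_int m / of_nat p * M m q q') \<odot> a q k v else 0)"
    and km: "a q k (a q' l (a q m v)) = a q' l (a q k (a q m v))
       + (if k + l = 0 then (of_int k / of_nat p * M k q q') \<odot> a q m v else 0)"
    using a_comm[OF assms] by blast+
  show ?thesis
    unfolding nprod_def m k a_add[OF assms(1)] mk km
    by (simp add: a_scale[OF assms(1)] linop_0[OF linop_a[OF assms(1)]])
qed

lemma Q_comm:
  assumes q': "q' \<in> {1..d}"
  shows "Q n w (a q' l v) = a q' l (Q n w v) +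
    (- (of_int l / of_nat p) / 2 * (w (- l) + w (int p * n + l))) \<odot> a q' (l + int p * n) v"
proof -
  obtain F1 F2 where F12: "supports n F1 v" "supports n F2 (a q' l v)" using ex_supports by blast
  \<comment> \<open>The two indices at which the mode \<open>l\<close> contracts with a factor are
    added, so that the correction sums collapse onto them.\<close>
  define F where "F = insert (- l) (insert (int p * n + l) (F1 \<union> F2))"
  have F: "finite F" "- l \<in> F" "int p * n + l \<in> F" "supports n F v" "supports n F (a q' l v)"
    using F12 by (auto simp: F_def supports_def)
  let ?c = "- (of_int l / of_nat p) :: complex" and ?b = "a q' (l + int p * n) v"
  \<comment> \<open>Contraction leaves the matrix of the eigenprojection; the mode
    \<open>l + p n\<close> lies in the same eigenspace and absorbs it.\<close>
  have M: "(\<Sum>q=1..d. M (- l) q q' \<odot> a q (l + int p * n) v) = ?b"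
    using M_proj[OF q', of l n v] q' by (simp add: M_sym cong: sum.cong_simp)
  have S1: "(\<Sum>q=1..d. \<Sum>k\<in>F. w k \<odot> (if int p * n - k + l = 0 then
        (of_int (int p * n - k) / of_nat p * M (int p * n - k) q q') \<odot> a q k v else 0))
      = (w (int p * n + l) * ?c) \<odot> ?b"
  proof -
    have "(\<Sum>k\<in>F. w k \<odot> (if int p * n - k + l = 0 then
        (of_int (int p * n - k) / of_nat p * M (int p * n - k) q q') \<odot> a q k v else 0))
      = (w (int p * n + l) * ?c) \<odot> M (- l) q q' \<odot> a q (l + int p * n) v" for q
    proof -
      have "(\<Sum>k\<in>F. w k \<odot> (if int p * n - k + l = 0 then
        (of_int (int p * n - k) / of_nat p * M (int p * n - k) q q') \<odot> a q k v else 0)) =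
       (\<Sum>k\<in>F. if k = int p * n + l then (w (int p * n + l) * ?c) \<odot> M (- l) q q' \<odot> a q (l + int p * n) v else 0)"
        by (intro sum.cong refl) (auto simp: add.commute)
      then show ?thesis using F by simp
    qed
    then show ?thesis by (simp only: scale_sum_right[symmetric] M)
  qed
  have S2: "(\<Sum>q=1..d. \<Sum>k\<in>F. w k \<odot> (if k + l = 0 then
        (of_int k / of_nat p * M k q q') \<odot> a q (int p * n - k) v else 0)) = (w (- l) * ?c) \<odot> ?b"
  proof -
    have "(\<Sum>k\<in>F. w k \<odot> (if k + l = 0 then
        (of_int k / of_nat p * M k q q') \<odot> a q (int p * n - k) v else 0))
      = (w (- l) * ?c) \<odot> M (- l) q q' \<odot> a q (l + int p * n) v" for q
    proof -
      have "(\<Sum>k\<in>F. w k \<odot> (if k + l = 0 then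
        (of_int k / of_nat p * M k q q') \<odot> a q (int p * n - k) v else 0)) =
       (\<Sum>k\<in>F. if k = - l then (w (- l) * ?c) \<odot> M (- l) q q' \<odot> a q (l + int p * n) v else 0)"
        by (intro sum.cong refl) (auto simp: add.commute add_eq_0_iff)
      then show ?thesis using F by simp
    qed
    then show ?thesis by (simp only: scale_sum_right[symmetric] M)
  qed
  have lin: "(1/2) \<odot> (u + (x * c) \<odot> b + (y * c) \<odot> b) = (1/2) \<odot> u + (c / 2 * (y + x)) \<odot> b"
    for u b and x y c :: complex
    by (simp add: scale_right_distrib scale_left_distrib[symmetric] add_divide_distrib ring_distribs mult_ac add_ac)
  have "Q n w (a q' l v) = (1/2) \<odot> ((\<Sum>q=1..d. \<Sum>k\<in>F. w k \<odot> a q' l (nprod q k (int p * n - k) v))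
     + (w (int p * n + l) * ?c) \<odot> ?b + (w (- l) * ?c) \<odot> ?b)"
    unfolding Q_eq[OF F(5)] S1[symmetric] S2[symmetric]
    by (simp add: nprod_comm[OF _ q'] scale_right_distrib sum.distrib del: scale_scale cong: sum.cong_simp)
  also have "\<dots> = a q' l (Q n w v) + (?c / 2 * (w (- l) + w (int p * n + l))) \<odot> ?b"
    unfolding Q_eq[OF F(4)] lin by (simp add: linop_sum[OF linop_a[OF q']] a_scale[OF q'])
  finally show ?thesis by simp
qed

definition acts_as :: "('v \<Rightarrow> 'v) \<Rightarrow> complex poly \<Rightarrow> int \<Rightarrow> bool" where
  "acts_as X f n \<longleftrightarrow> (\<forall>q\<in>{1..d}. \<forall>l v.
     X (a q l v) = a q l (X v) + poly f (of_int l / of_nat p) \<odot> a q (l + int p * n) v)"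

lemma acts_asD: "acts_as X f n \<Longrightarrow> q \<in> {1..d} \<Longrightarrow>
    X (a q l v) = a q l (X v) + poly f (of_int l / of_nat p) \<odot> a q (l + int p * n) v"
  by (simp add: acts_as_def)

lemma acts_as_commutator:
  assumes "linop X" "linop Y" "acts_as X f m" "acts_as Y g n"
  shows "acts_as (\<lambda>v. X (Y v) - Y (X v)) (bracket_poly m f n g) (m + n)"
proof -
  have *: "of_int (l + int p * n) / of_nat p = (of_int l / of_nat p + of_int n :: complex)" for l n
    using p_pos by (simp add: field_simps)
  have idx: "l + int p * n + int p * m = l + int p * (m + n)" "l + int p * m + int p * n = l + int p * (m + n)" for l
    by (simp_all add: ring_distribs)
  show ?thesis unfolding acts_as_def
  proof (intro ballI allI)
    fix q l v assume q: "q \<in> {1..d}"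
    let ?A = "a q (l + int p * (m + n)) v" and ?x = "of_int l / of_nat p :: complex"
    have XY: "X (Y (a q l v)) = a q l (X (Y v)) + poly f ?x \<odot> a q (l + int p * m) (Y v)
        + poly g ?x \<odot> (a q (l + int p * n) (X v) + poly f (?x + of_int n) \<odot> ?A)"
      by (simp only: acts_asD[OF assms(4) q] acts_asD[OF assms(3) q] linop_add[OF assms(1)] linop_scale[OF assms(1)] * idx)
    have YX: "Y (X (a q l v)) = a q l (Y (X v)) + poly g ?x \<odot> a q (l + int p * n) (X v)
        + poly f ?x \<odot> (a q (l + int p * m) (Y v) + poly g (?x + of_int m) \<odot> ?A)"
      by (simp only: acts_asD[OF assms(4) q] acts_asD[OF assms(3) q] linop_add[OF assms(2)] linop_scale[OF assms(2)] * idx)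
    have br: "poly (bracket_poly m f n g) ?x \<odot> ?A =
        poly g ?x \<odot> poly f (?x + of_int n) \<odot> ?A - poly f ?x \<odot> poly g (?x + of_int m) \<odot> ?A"
      by (simp add: poly_bracket_poly scale_left_diff_distrib mult_ac)
    show "X (Y (a q l v)) - Y (X (a q l v)) = a q l (X (Y v) - Y (X v)) +
        poly (bracket_poly m f n g) ?x \<odot> ?A"
      unfolding XY YX br linop_diff[OF linop_a[OF q]] scale_right_distrib by simp
  qed
qed

lemma acts_as_minus:
  assumes "acts_as X f n" "acts_as Y g n"
  shows "acts_as (\<lambda>v. X v - Y v) (f - g) n"
  unfolding acts_as_def
proof (intro ballI allI)
  fix q l v assume q: "q \<in> {1..d}"
  show "X (a q l v) - Y (a q l v) = a q l (X v - Y v) + poly (f - g) (of_int l / of_nat p) \<odot> a q (l + int p * n) v"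
    by (simp add: acts_asD[OF assms(1) q] acts_asD[OF assms(2) q] linop_diff[OF linop_a[OF q]] scale_left_diff_distrib)
qed

lemma acts_as_scale:
  assumes "acts_as X f n"
  shows "acts_as (\<lambda>v. c \<odot> X v) (smult c f) n"
  unfolding acts_as_def by (simp add: acts_asD[OF assms] scale_right_distrib a_scale)

lemma acts_as_scalar: "acts_as (\<lambda>v. c \<odot> v) 0 n"
  unfolding acts_as_def by (simp add: a_scale)

lemma eq_0_if_commutes:
  assumes "linop X" "acts_as X 0 n" "X v0 = 0"
  shows "X v = 0"
  by (induction v rule: generated)
     (simp_all add: assms linop_add[OF assms(1)] linop_scale[OF assms(1)] acts_asD[OF assms(2)] linop_0[OF linop_a])

text \<open>Zero modes commute with all modes, since the bracket carries the factor
  \<open>k = 0\<close>, and they kill the generating vacuum.\<close>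

lemma a_0: "q \<in> {1..d} \<Longrightarrow> a q 0 v = 0"
  by (induction v rule: generated)
     (simp_all add: a_vac a_add a_scale linop_0[OF linop_a] a_comm[of q _ 0])

text \<open>On a vector killed by all nonnegative modes only pairs of two negative modes survive,
  that is \<open>p n < k < 0\<close>; for \<open>n >= 0\<close> there are none.\<close>

lemma Q_singular:
  assumes u: "\<And>q k. q \<in> {1..d} \<Longrightarrow> k \<ge> 0 \<Longrightarrow> a q k u = 0"
  shows "Q n w u = (1/2) \<odot> (\<Sum>q=1..d. \<Sum>k\<in>{int p * n<..<0}. w k \<odot> a q k (a q (int p * n - k) u))"
proof -
  obtain F0 where F0: "supports n F0 u" using ex_supports by blast
  let ?F = "F0 \<union> {int p * n<..<0}"
  have "supports n ?F u" by (rule supports_mono[OF F0]) (use F0 in \<open>auto simp: supports_def\<close>)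
  then have "Q n w u = (1/2) \<odot> (\<Sum>q=1..d. \<Sum>k\<in>?F. w k \<odot> nprod q k (int p * n - k) u)"
    by (rule Q_eq)
  also have "\<dots> = (1/2) \<odot> (\<Sum>q=1..d. \<Sum>k\<in>{int p * n<..<0}. w k \<odot> a q k (a q (int p * n - k) u))"
  proof (intro arg_cong[where f = "\<lambda>v. (1/2) \<odot> v"] sum.cong[OF refl])
    fix q assume q: "q \<in> {1..d}"
    have z: "nprod q k (int p * n - k) u = 0" if "k \<notin> {int p * n<..<0}" for k
      using that q by (cases "k = 0") (auto simp: nprod_def u a_0 linop_0[OF linop_a])
    have "(\<Sum>k\<in>?F. w k \<odot> nprod q k (int p * n - k) u) = (\<Sum>k\<in>{int p * n<..<0}. w k \<odot> nprod q k (int p * n - k) u)"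
      using F0 z by (intro sum.mono_neutral_right) (auto simp: supports_def)
    also have "\<dots> = (\<Sum>k\<in>{int p * n<..<0}. w k \<odot> a q k (a q (int p * n - k) u))"
      by (intro sum.cong) (auto simp: nprod_def)
    finally show "(\<Sum>k\<in>?F. w k \<odot> nprod q k (int p * n - k) u) = \<dots>" .
  qed
  finally show ?thesis .
qed

lemma Q_singular_nonneg:
  assumes "\<And>q k. q \<in> {1..d} \<Longrightarrow> k \<ge> 0 \<Longrightarrow> a q k u = 0" "n \<ge> 0"
  shows "Q n w u = 0"
proof -
  have "{int p * n<..<0} = {}" using assms(2) by (auto simp: not_less zero_le_mult_iff)
  then show ?thesis using Q_singular[OF assms(1)] by simp
qed

text \<open>Dividing by \<open>k/p = 0\<close> is harmless, since the zero modes act as \<open>0\<close>.\<close>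

definition weight :: "complex poly \<Rightarrow> int \<Rightarrow> complex" where
  "weight f k = poly f (- (of_int k / of_nat p)) / (of_int k / of_nat p)"

definition R :: "int \<Rightarrow> complex poly \<Rightarrow> 'v \<Rightarrow> 'v" where
  "R n f v = Q n (weight f) v + (if n = 0 then vac_scalar p D f \<odot> v else 0)"

lemma R_poly_add: "R n (f + g) v = R n f v + R n g v"
proof -
  have "weight (f + g) = (\<lambda>k. weight f k + weight g k)"
    by (rule ext) (simp only: weight_def poly_add add_divide_distrib)
  then show ?thesis by (simp add: R_def Q_weight_add vac_scalar_add scale_left_distrib)
qed

lemma R_poly_smult: "R n (smult c f) v = c \<odot> R n f v"
proof -
  have "weight (smult c f) = (\<lambda>k. c * weight f k)"
    by (simp add: weight_def fun_eq_iff)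
  then show ?thesis by (simp add: R_def Q_weight_scale vac_scalar_smult scale_right_distrib)
qed

lemma R_poly_0: "R n 0 v = 0"
  using R_poly_smult[of n 0 0 v] by simp

lemma R_poly_minus: "R n (- f) v = - R n f v"
  using R_poly_smult[of n "-1" f v] by simp

lemma linop_R: "linop (R n f)"
  unfolding R_def by (cases "n = 0") (simp_all add: linop_plus linop_Q linop_const_scale)

text \<open>By the choice of \<open>weight\<close> the contraction at \<open>-l\<close> contributes
  half of \<open>f(l/p)\<close>; the one at \<open>p n + l\<close> contributes the same amount by
  reflection.\<close>

lemma acts_as_R:
  assumes "reflective n f"
  shows "acts_as (R n f) f n"
  unfolding acts_as_def
proof (intro ballI allI)
  fix q l v assume q: "q \<in> {1..d}"
  let ?x = "of_int l / of_nat p :: complex" and ?A = "a q (l + int p * n) v"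
  have p: "of_int (int p * n + l) / of_nat p = of_int n + ?x"
    using p_pos by (simp add: field_simps)
  have "(- ?x / 2 * (weight f (- l) + weight f (int p * n + l))) \<odot> ?A = poly f ?x \<odot> ?A"
  proof (cases "l + int p * n = 0")
    \<comment> \<open>Here \<open>weight\<close> is a division by zero, but the resulting mode is a
      zero mode and vanishes.\<close>
    case True
    then show ?thesis by (simp add: a_0[OF q])
  next
    case False
    then have "of_int n + ?x \<noteq> 0"
      unfolding p[symmetric] using p_pos by (metis add.commute divide_eq_0_iff of_int_eq_0_iff of_nat_eq_0_iff not_gr_zero)
    moreover have "?x * poly f (- (of_int n + ?x)) = - ((of_int n + ?x) * poly f ?x)"
      using assms[unfolded reflective_def, rule_format, of ?x]
      by (simp only: eq_neg_iff_add_eq_0 minus_add_distrib diff_conv_add_uminus)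
    ultimately have "?x * weight f (int p * n + l) = - poly f ?x"
      unfolding weight_def p times_divide_eq_right by (metis nonzero_mult_div_cancel_left minus_divide_left)
    moreover have "?x * weight f (- l) = - poly f ?x"
      using reflective_poly_0[OF assms] p_pos by (cases "l = 0") (simp_all add: weight_def)
    moreover have "- x / 2 * (u + u') = y" if "x * u' = - y" "x * u = - y" for x u u' y :: complex
      using that by algebra
    ultimately have "- ?x / 2 * (weight f (- l) + weight f (int p * n + l)) = poly f ?x"
      by blast
    then show ?thesis by simp
  qed
  then show "R n f (a q l v) = a q l (R n f v) + poly f ?x \<odot> ?A"
    unfolding R_def Q_comm[OF q] by (simp add: a_add[OF q] a_scale[OF q] linop_0[OF linop_a[OF q]])
qed

section \<open>The grading\<close>

definition degree_op :: "'v \<Rightarrow> 'v" where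
  "degree_op = Q 0 (\<lambda>_. 1)"

lemma linop_degree_op: "linop degree_op"
  by (simp add: degree_op_def linop_Q)

lemma acts_as_degree_op: "acts_as degree_op [:0, -1:] 0"
  unfolding acts_as_def degree_op_def by (simp add: Q_comm)

lemma degree_op_singular: "(\<And>q k. q \<in> {1..d} \<Longrightarrow> k \<ge> 0 \<Longrightarrow> a q k u = 0) \<Longrightarrow> degree_op u = 0"
  unfolding degree_op_def by (rule Q_singular_nonneg) auto

lemma degree_op_vac: "degree_op v0 = 0"
  by (rule degree_op_singular) (rule a_vac)

lemma Q_vac: "n \<ge> 0 \<Longrightarrow> Q n w v0 = 0"
  by (rule Q_singular_nonneg) (auto simp: a_vac)

lemma R_vac: "n > 0 \<Longrightarrow> R n f v0 = 0"
  and R_0_vac: "R 0 f v0 = vac_scalar p D f \<odot> v0"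
  by (simp_all add: R_def Q_vac)

lemma degree_op_Q_vac: "degree_op (Q n w v0) = (- of_int n) \<odot> Q n w v0"
proof -
  have "degree_op (a q k (a q (int p * n - k) v0)) = (- of_int n) \<odot> a q k (a q (int p * n - k) v0)"
    if q: "q \<in> {1..d}" for q k
  proof -
    have "degree_op (a q k (a q (int p * n - k) v0)) =
      (- (of_int (int p * n - k) / of_nat p) - of_int k / of_nat p) \<odot> a q k (a q (int p * n - k) v0)"
      by (simp add: acts_asD[OF acts_as_degree_op q] degree_op_vac a_add[OF q] a_scale[OF q] linop_0[OF linop_a[OF q]]
          linop_uminus[OF linop_a[OF q]] scale_left_diff_distrib)
    also have "- (of_int (int p * n - k) / of_nat p) - of_int k / of_nat p = (- of_int n :: complex)"
      using p_pos by (simp add: divide_simps)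
    finally show ?thesis .
  qed
  moreover have "Q n w v0 = (1/2) \<odot> (\<Sum>q=1..d. \<Sum>k\<in>{int p * n<..<0}. w k \<odot> a q k (a q (int p * n - k) v0))"
    by (rule Q_singular) (rule a_vac)
  ultimately show ?thesis
    by (simp add: linop_sum[OF linop_degree_op] linop_scale[OF linop_degree_op] scale_sum_right mult_ac cong: sum.cong_simp)
qed

text \<open>An instance of the commutator formula that is settled first, as the general case relies
  on it. The bracket of \<open>-D\<close> with \<open>t^n f(D)\<close> is \<open>-n\<close> times
  the latter, so the difference commutes with all modes, and it kills the vacuum.\<close>

lemma degree_op_R_comm:
  assumes "reflective n f"
  shows "degree_op (R n f v) = R n f (degree_op v) + (- of_int n) \<odot> R n f v"
proof -
  let ?X = "\<lambda>v. degree_op (R n f v) - R n f (degree_op v) - (- of_int n) \<odot> R n f v"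
  have acts_as: "acts_as ?X (bracket_poly 0 [:0, -1:] n f - smult (- of_int n) f) n"
  proof -
    have "acts_as (\<lambda>v. degree_op (R n f v) - R n f (degree_op v)) (bracket_poly 0 [:0, -1:] n f) n"
      using acts_as_commutator[OF linop_degree_op linop_R acts_as_degree_op acts_as_R[OF assms]] by simp
    then show ?thesis by (rule acts_as_minus[OF _ acts_as_scale[OF acts_as_R[OF assms]]])
  qed
  have 0: "bracket_poly 0 [:0, -1:] n f - smult (- of_int n) f = 0"
    by (rule poly_ext) (simp add: poly_bracket_poly algebra_simps)
  have lin: "linop ?X"
    by (rule linop_minus[OF linop_minus[OF linop_compose[OF linop_degree_op linop_R] linop_compose[OF linop_R linop_degree_op]]
          linop_compose[OF linop_const_scale linop_R]])
  have "?X v0 = 0"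
    by (cases "n = 0") (simp_all add: degree_op_vac linop_0[OF linop_R] linop_0[OF linop_Q] R_def linop_add[OF linop_degree_op] linop_scale[OF linop_degree_op] degree_op_Q_vac)
  from eq_0_if_commutes[OF lin acts_as[unfolded 0] this] have "?X v = 0" .
  then show ?thesis by (simp add: algebra_simps)
qed

section \<open>The defect of the bracket relation\<close>

definition defect :: "int \<Rightarrow> complex poly \<Rightarrow> int \<Rightarrow> complex poly \<Rightarrow> 'v \<Rightarrow> 'v" where
  "defect m f n g v = R m f (R n g v) - R n g (R m f v) - R (m + n) (bracket_poly m f n g) v"

lemma linop_defect: "linop (defect m f n g)"
  unfolding defect_def 
  by (rule linop_minus[OF linop_minus[OF linop_compose[OF linop_R linop_R] linop_compose[OF linop_R linop_R]] linop_R])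

lemma acts_as_defect:
  assumes "reflective m f" "reflective n g"
  shows "acts_as (defect m f n g) 0 (m + n)"
  using acts_as_minus[OF acts_as_commutator[OF linop_R linop_R acts_as_R[OF assms(1)] acts_as_R[OF assms(2)]]
      acts_as_R[OF reflective_bracket_poly[OF assms]]]
  unfolding defect_def by simp

text \<open>The operator \<open>degree_op\<close> measures the degree, hence a nonzero degree is incompatible with
  \<open>defect m f n g v0\<close> being annihilated by all nonnegative modes.\<close>

lemma defect_vac_nonzero_degree:
  assumes "reflective m f" "reflective n g" "m + n \<noteq> 0"
  shows "defect m f n g v0 = 0"
proof -
  let ?u = "defect m f n g v0"
  have "a q k ?u = 0" if "q \<in> {1..d}" "k \<ge> 0" for q k
    using acts_asD[OF acts_as_defect[OF assms(1,2)] that(1), of k v0] a_vac[OF that]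
    by (simp add: linop_0[OF linop_defect])
  then have "degree_op ?u = 0" by (rule degree_op_singular)
  moreover have "degree_op ?u = (- of_int (m + n)) \<odot> ?u"
    unfolding defect_def
    by (simp add: linop_diff[OF linop_degree_op] degree_op_R_comm[OF assms(1)] degree_op_R_comm[OF assms(2)]
        degree_op_R_comm[OF reflective_bracket_poly[OF assms(1,2)]] linop_diff[OF linop_R] linop_scale[OF linop_R]
        linop_uminus[OF linop_R] degree_op_vac linop_0[OF linop_R] scale_right_diff_distrib scale_left_diff_distrib)
  ultimately show ?thesis using assms(3) by (metis neg_equal_0_iff_equal of_int_eq_0_iff scale_eq_0_iff)
qed

lemma R_R_vac:
  assumes m: "m > 0" and f: "reflective (int m) f" and g: "reflective (- int m) g"
  shows "R (int m) f (R (- int m) g v0) =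
    (1/2 * (\<Sum>k<p * m. of_nat (D (int k)) * poly (vac_poly (int m) f g) (of_nat k / of_nat p))) \<odot> v0"
proof -
  let ?m = "int m" and ?P = "vac_poly (int m) f g"
  let ?I = "{int p * - ?m<..<0}"
  have step: "R ?m f (a q k (a q (int p * - ?m - k) v0)) =
     (poly f (of_int k / of_nat p) * (of_int (k + int p * ?m) / of_nat p * M (k + int p * ?m) q q)) \<odot> v0"
    if q: "q \<in> {1..d}" and k: "k \<in> ?I" for q k
  proof -
    let ?l = "int p * - ?m - k"
    \<comment> \<open>The commutator yields the mode \<open>l + p m = -k > 0\<close>, which kills
      the vacuum. Hence only the outer mode \<open>k\<close> is moved, and then contracted with
      \<open>l\<close>.\<close>
    have 1: "R ?m f (a q ?l v0) = 0"
      using k m acts_asD[OF acts_as_R[OF f] q, of ?l v0]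
      by (simp add: R_vac linop_0[OF linop_a[OF q]] a_vac[OF q])
    have "R ?m f (a q k (a q ?l v0)) = poly f (of_int k / of_nat p) \<odot> a q (k + int p * ?m) (a q ?l v0)"
      using acts_asD[OF acts_as_R[OF f] q, of k "a q ?l v0"] unfolding 1 linop_0[OF linop_a[OF q]] by simp
    also have "a q (k + int p * ?m) (a q ?l v0) = (of_int (k + int p * ?m) / of_nat p * M (k + int p * ?m) q q) \<odot> v0"
      unfolding a_comm[OF q q, of "k + int p * ?m" ?l] using k by (simp add: a_vac[OF q] linop_0[OF linop_a[OF q]])
    finally show ?thesis by simp
  qed
  have val: "weight g k * (poly f (of_int k / of_nat p) * (of_int (k + int p * ?m) / of_nat p)) =
      poly ?P (of_int (k + int p * ?m) / of_nat p)" if k: "k \<in> ?I" for k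
  proof -
    let ?x = "of_int k / of_nat p + of_nat m :: complex"
    have x: "of_int (k + int p * ?m) / of_nat p = ?x" using p_pos by (simp add: field_simps)
    have k0: "of_int k / of_nat p \<noteq> (0::complex)" using k p_pos by simp
    have "?x * poly f (of_int k / of_nat p) = - (of_int k / of_nat p) * poly f (- ?x)"
    proof -
      have e: "- of_int ?m - - ?x = of_int k / of_nat p" "of_int ?m + - ?x = - (of_int k / of_nat p)" by simp_all
      have "x * F = - K * G" if "- x * F + - K * G = 0" for x F K G :: complex
        using that by algebra
      then show ?thesis
        using f[unfolded reflective_def, rule_format, of "- ?x"] unfolding e by blast
    qed
    note fx = this
    have "weight g k * (poly f (of_int k / of_nat p) * ?x) = - (poly f (- ?x) * poly g (- (of_int k / of_nat p)))"
    proof -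
      have "G / K * (F * x) = - (F' * G)" if "x * F = - K * F'" "K \<noteq> 0" for x F F' G K :: complex
        using that by (simp add: divide_simps) (metis mult.commute mult.left_commute mult_minus_left)
      then show ?thesis using k0 fx unfolding weight_def by blast
    qed
    then show ?thesis unfolding x poly_vac_poly by (simp add: algebra_simps)
  qed
  have "R (- ?m) g v0 = Q (- ?m) (weight g) v0" using m by (simp add: R_def)
  also have "\<dots> = (1/2) \<odot> (\<Sum>q=1..d. \<Sum>k\<in>?I. weight g k \<odot> a q k (a q (int p * - ?m - k) v0))"
    by (rule Q_singular) (rule a_vac)
  finally have "R ?m f (R (- ?m) g v0) =
      (1/2) \<odot> (\<Sum>q=1..d. \<Sum>k\<in>?I. weight g k \<odot> R ?m f (a q k (a q (int p * - ?m - k) v0)))"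
    by (simp only: linop_sum[OF linop_R] linop_scale[OF linop_R])
  also have "\<dots> = (1/2) \<odot> (\<Sum>q=1..d. \<Sum>k\<in>?I. (poly ?P (of_int (k + int p * ?m) / of_nat p) * M (k + int p * ?m) q q) \<odot> v0)"
    using val by (intro arg_cong[where f = "\<lambda>v. (1/2) \<odot> v"] sum.cong refl) (simp only: step scale_scale mult.assoc[symmetric])
  also have "\<dots> = (1/2 * (\<Sum>k\<in>?I. poly ?P (of_int (k + int p * ?m) / of_nat p) * of_nat (D (k + int p * ?m)))) \<odot> v0"
    unfolding M_trace[symmetric] by (subst sum.swap) (simp add: scale_sum_left[symmetric] sum_distrib_left)
  also have "(\<Sum>k\<in>?I. poly ?P (of_int (k + int p * ?m) / of_nat p) * of_nat (D (k + int p * ?m))) =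
      (\<Sum>k\<in>{0<..<p * m}. of_nat (D (int k)) * poly ?P (of_nat k / of_nat p))"
    by (rule sum.reindex_bij_witness[of _ "\<lambda>j. int j - int p * ?m" "\<lambda>k. nat (k + int p * ?m)"])
       (auto simp: mult.commute nat_less_iff simp flip: of_nat_mult)
  also have "\<dots> = (\<Sum>k<p * m. of_nat (D (int k)) * poly ?P (of_nat k / of_nat p))"
    using reflective_poly_0[OF f] by (intro sum.mono_neutral_left) (auto simp: poly_vac_poly)
  finally show ?thesis .
qed

text \<open>For \<open>m = -n > 0\<close> the product in the other order dies on the vacuum, so
  \<open>R_R_vac\<close> gives everything; \<open>m < 0\<close> follows by antisymmetry, and for
  \<open>m = n = 0\<close> scalars commute.\<close>

lemma defect_vac:
  assumes "reflective m f" "reflective n g"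
  shows "defect m f n g v0 = (- (of_nat d / 2) * psi_hom m f n g) \<odot> v0"
proof -
  have pos: "defect (int m) f (- int m) g v0 = (- (of_nat d / 2) * psi_hom (int m) f (- int m) g) \<odot> v0"
    if "m > 0" "reflective (int m) f" "reflective (- int m) g" for m f g
  proof -
    have eq: "1/2 * (\<Sum>k<p * m. of_nat (D (int k)) * poly (vac_poly (int m) f g) (of_nat k / of_nat p)) =
      vac_scalar p D (bracket_poly (int m) f (- int m) g) - of_nat d / 2 * psi_hom (int m) f (- int m) g"
      using vac_scalar_bracket_poly[OF that p_pos, of D] D_periodic D_sum by simp
    show ?thesis
      unfolding defect_def R_R_vac[OF that] eq using that(1)
      by (simp add: R_vac linop_0[OF linop_R] R_0_vac scale_left_diff_distrib)
  qed
  consider "m + n \<noteq> 0" | "m = 0" "n = 0" | "m > 0" "n = - m" | "n > 0" "m = - n" by linarith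
  then show ?thesis
  proof cases
    case 1
    then show ?thesis using defect_vac_nonzero_degree[OF assms] by (simp add: psi_hom_def)
  next
    case 2
    then show ?thesis
      by (simp add: defect_def R_0_vac linop_scale[OF linop_R] bracket_poly_def R_poly_0 psi_hom_def mult.commute)
  next
    case 3
    then show ?thesis using pos[of "nat m" f g] assms by simp
  next
    case 4
    have "defect n g m f v0 = (- (of_nat d / 2) * psi_hom n g m f) \<odot> v0"
      using pos[of "nat n" g f] 4 assms by simp
    moreover have "defect m f n g v0 = - defect n g m f v0"
      unfolding defect_def bracket_poly_swap[of n g m f] R_poly_minus by (simp add: add.commute)
    ultimately show ?thesis by (simp add: psi_hom_swap[of n g m f])
  qed
qed

theorem R_commutator:
  assumes "reflective m f" "reflective n g"
  shows "R m f (R n g v) - R n g (R m f v) =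
    R (m + n) (bracket_poly m f n g) v + (- (of_nat d / 2) * psi_hom m f n g) \<odot> v"
proof -
  let ?X = "\<lambda>v. defect m f n g v - (- (of_nat d / 2) * psi_hom m f n g) \<odot> v"
  have acts_as: "acts_as ?X 0 (m + n)"
    using acts_as_minus[OF acts_as_defect[OF assms] acts_as_scalar] unfolding diff_self .
  have "?X v0 = 0" by (simp add: defect_vac[OF assms])
  from eq_0_if_commutes[OF linop_minus[OF linop_defect linop_const_scale] acts_as this] have "?X v = 0" .
  then show ?thesis by (simp add: defect_def algebra_simps)
qed

end

section \<open>The twisted Heisenberg algebra\<close>

lemma lookup_map_0: "f 0 = 0 \<Longrightarrow> Poly_Mapping.lookup (Poly_Mapping.map f A) k = f (Poly_Mapping.lookup A k)"
  by (simp add: Poly_Mapping.map.rep_eq when_def)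

lemma map_zero: "Poly_Mapping.map f 0 = 0"
  by (rule poly_mapping_eqI) (simp add: Poly_Mapping.map.rep_eq)

lemma sum_single_lookup: "(\<Sum>k\<in>Poly_Mapping.keys f. Poly_Mapping.single k (Poly_Mapping.lookup f k)) = f"
proof (rule poly_mapping_eqI)
  fix k
  have "Poly_Mapping.lookup (\<Sum>k\<in>Poly_Mapping.keys f. Poly_Mapping.single k (Poly_Mapping.lookup f k)) k =
     (\<Sum>l\<in>Poly_Mapping.keys f. if l = k then Poly_Mapping.lookup f k else 0)"
    unfolding lookup_sum by (intro sum.cong) (auto simp: lookup_single when_def)
  then show "Poly_Mapping.lookup (\<Sum>k\<in>Poly_Mapping.keys f. Poly_Mapping.single k (Poly_Mapping.lookup f k)) k =
     Poly_Mapping.lookup f k"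
    by (simp add: not_in_keys_iff_lookup_eq_zero)
qed

locale twisted =
  fixes H :: "'h::ab_group_add twisted_data" and d :: nat and \<alpha> :: "nat \<Rightarrow> 'h"
  assumes twisted_space: "twisted_space H" and orthonormal: "orthonormal_basis H d \<alpha>"
begin

sublocale V: vector_space "scl H"
  using twisted_space by (simp add: twisted_space_def)

abbreviation "p \<equiv> period H"
abbreviation "\<omega> \<equiv> omega H"
abbreviation "B \<equiv> form H"
abbreviation "\<nu> \<equiv> isom H"
abbreviation smul (infixr \<open>\<cdot>\<close> 75) where "c \<cdot> x \<equiv> scl H c x"

lemma p_pos: "p > 0" and period: "(\<nu> ^^ p) = id"
  and omega_p: "\<omega> ^ p = 1" and omega_primitive: "0 < k \<Longrightarrow> k < p \<Longrightarrow> \<omega> ^ k \<noteq> 1"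
  using twisted_space by (auto simp: twisted_space_def)

lemma form_add: "B (x + y) z = B x z + B y z"
  and form_scale: "B (c \<cdot> x) y = c * B x y"
  and form_sym: "B x y = B y x"
  and form_isom: "B (\<nu> x) (\<nu> y) = B x y"
  using twisted_space by (auto simp: twisted_space_def)

lemma form_scale_right: "B y (c \<cdot> x) = c * B y x"
  by (subst (1 2) form_sym[of y]) (rule form_scale)

lemma form_0: "B 0 x = 0"
  using form_scale[of 0 0 x] by simp

lemma form_sum: "B (\<Sum>i\<in>I. f i) y = (\<Sum>i\<in>I. B (f i) y)"
  by (induction I rule: infinite_finite_induct) (simp_all add: form_add form_0)

lemma form_sum_right: "B y (\<Sum>i\<in>I. f i) = (\<Sum>i\<in>I. B y (f i))"
  using form_sum[of f I y] by (simp add: form_sym[of _ y])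

lemma isom_add: "\<nu> (x + y) = \<nu> x + \<nu> y"
  and isom_scale: "\<nu> (c \<cdot> x) = c \<cdot> \<nu> x"
proof -
  interpret Vector_Spaces.linear "scl H" "scl H" \<nu> using twisted_space by (simp add: twisted_space_def)
  show "\<nu> (x + y) = \<nu> x + \<nu> y" "\<nu> (c \<cdot> x) = c \<cdot> \<nu> x" by (simp_all add: add scale)
qed

lemma isom_0: "\<nu> 0 = 0"
  using isom_scale[of 0 0] by simp

lemma isom_sum: "\<nu> (\<Sum>i\<in>I. f i) = (\<Sum>i\<in>I. \<nu> (f i))"
  by (induction I rule: infinite_finite_induct) (simp_all add: isom_add isom_0)

lemma funpow_isom_add: "(\<nu> ^^ j) (x + y) = (\<nu> ^^ j) x + (\<nu> ^^ j) y"
  and funpow_isom_scale: "(\<nu> ^^ j) (c \<cdot> x) = c \<cdot> (\<nu> ^^ j) x"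
  and form_funpow_isom: "B ((\<nu> ^^ j) x) ((\<nu> ^^ j) y) = B x y"
  by (induction j) (simp_all add: isom_add isom_scale form_isom)

lemma omega_nonzero: "\<omega> \<noteq> 0"
  using omega_p p_pos by (metis power_0_left zero_neq_one not_gr_zero)

lemma omega_powi_period: "\<omega> powi (k + int p * n) = \<omega> powi k"
  using omega_nonzero omega_p by (simp add: power_int_add power_int_mult)

lemma omega_powi_eq_1_iff: "\<omega> powi k = 1 \<longleftrightarrow> int p dvd k"
proof -
  have "\<omega> powi k = \<omega> powi (k mod int p)"
    using omega_powi_period[of "k mod int p" "k div int p"] by (simp add: add.commute)
  also have "\<dots> = \<omega> ^ nat (k mod int p)"
    using p_pos by (simp add: power_int_def)
  also have "\<dots> = 1 \<longleftrightarrow> k mod int p = 0"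
  proof -
    have "0 \<le> k mod int p" "k mod int p < int p" using p_pos by simp_all
    then show ?thesis
      using omega_primitive[of "nat (k mod int p)"] by (cases "k mod int p = 0") (auto simp: nat_less_iff)
  qed
  finally show ?thesis by (simp add: dvd_eq_mod_eq_0)
qed

lemma omega_powi_sum: "(\<Sum>j<p. \<omega> powi (k * int j)) = (if int p dvd k then of_nat p else 0)"
proof -
  have z: "\<omega> powi (k * int j) = (\<omega> powi k) ^ j" for j
    by (simp add: power_int_mult)
  have 1: "(\<omega> powi k) ^ p = 1"
    using omega_nonzero omega_p by (metis z mult.commute power_int_mult power_int_of_nat power_int_1_left)
  have "(1 - \<omega> powi k) * (\<Sum>j<p. (\<omega> powi k) ^ j) = 0"
    using one_diff_power_eq[of "\<omega> powi k" p] 1 by simp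
  then show ?thesis unfolding z using omega_powi_eq_1_iff[of k] by auto
qed

text \<open>The discrete Fourier formula for the eigenprojection. It makes linearity, periodicity
  and adjoints computable and is identified with the description by unique existence in
  \<open>eproj_eq_proj\<close>.\<close>

definition proj :: "int \<Rightarrow> 'h \<Rightarrow> 'h" where
  "proj k x = (1 / of_nat p) \<cdot> (\<Sum>j<p. (\<omega> powi (- k * int j)) \<cdot> (\<nu> ^^ j) x)"

lemma proj_add: "proj k (x + y) = proj k x + proj k y"
  by (simp add: proj_def funpow_isom_add V.scale_right_distrib sum.distrib)

lemma proj_scale: "proj k (c \<cdot> x) = c \<cdot> proj k x"
  by (simp add: proj_def funpow_isom_scale V.scale_sum_right mult_ac)

lemma proj_0: "proj k 0 = 0"
  using proj_scale[of k 0 0] by simp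

lemma proj_sum: "proj k (\<Sum>i\<in>I. f i) = (\<Sum>i\<in>I. proj k (f i))"
  by (induction I rule: infinite_finite_induct) (simp_all add: proj_add proj_0)

lemma proj_periodic: "proj (k + int p * n) x = proj k x"
proof -
  have "\<omega> powi (- (k + int p * n) * int j) = \<omega> powi (- k * int j)" for j
    using omega_powi_period[of "- k * int j" "- n * int j"] by (simp add: algebra_simps)
  then show ?thesis by (simp add: proj_def)
qed

lemma proj_in_eigenspace: "proj k x \<in> eigenspace H k"
proof -
  let ?t = "\<lambda>j. (\<omega> powi (- k * int j)) \<cdot> (\<nu> ^^ j) x"
  have "\<omega> powi k * \<omega> powi (- k * int (Suc j)) = \<omega> powi (- k * int j)" for j
    using omega_nonzero by (simp add: power_int_add[symmetric] algebra_simps)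
  then have s: "\<nu> (?t j) = (\<omega> powi k) \<cdot> ?t (Suc j)" for j
    by (simp add: isom_scale)
  have "?t p = ?t 0"
    using period omega_powi_period[of 0 "- k"] by (simp add: mult.commute)
  then have "(\<Sum>j<p. ?t (Suc j)) = (\<Sum>j<p. ?t j)"
    using sum.lessThan_Suc_shift[of ?t p] by (simp add: add.commute)
  then have "\<nu> (\<Sum>j<p. ?t j) = (\<omega> powi k) \<cdot> (\<Sum>j<p. ?t j)"
    by (simp only: isom_sum s V.scale_sum_right[symmetric])
  then show ?thesis
    unfolding eigenspace_def proj_def mem_Collect_eq isom_scale by (simp only: V.scale_left_commute)
qed

lemma funpow_eigenspace: "x \<in> eigenspace H l \<Longrightarrow> (\<nu> ^^ j) x = (\<omega> powi (l * int j)) \<cdot> x"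
proof (induction j)
  case (Suc j)
  then have "(\<nu> ^^ Suc j) x = (\<omega> powi (l * int j) * \<omega> powi l) \<cdot> x"
    by (simp add: isom_scale eigenspace_def)
  also have "\<omega> powi (l * int j) * \<omega> powi l = \<omega> powi (l * int (Suc j))"
    using omega_nonzero by (simp add: power_int_add[symmetric] algebra_simps)
  finally show ?case .
qed simp

lemma proj_eigenspace:
  assumes "x \<in> eigenspace H l"
  shows "proj k x = (if int p dvd l - k then x else 0)"
proof -
  have "\<omega> powi (- k * int j) * \<omega> powi (l * int j) = \<omega> powi ((l - k) * int j)" for j
    using omega_nonzero by (simp add: power_int_add[symmetric] algebra_simps)
  then have "proj k x = (1 / of_nat p * (\<Sum>j<p. \<omega> powi ((l - k) * int j))) \<cdot> x"
    by (simp add: proj_def funpow_eigenspace[OF assms] V.scale_sum_left[symmetric])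
  then show ?thesis using p_pos by (simp add: omega_powi_sum)
qed

lemma sum_proj: "(\<Sum>k<p. proj (int k) x) = x"
proof -
  have "(\<Sum>k<p. proj (int k) x) = (1 / of_nat p) \<cdot> (\<Sum>j<p. (\<Sum>k<p. \<omega> powi (- int j * int k)) \<cdot> (\<nu> ^^ j) x)"
    unfolding proj_def V.scale_sum_right[symmetric] V.scale_sum_left
    by (subst sum.swap) (simp add: mult.commute)
  also have "(\<Sum>j<p. (\<Sum>k<p. \<omega> powi (- int j * int k)) \<cdot> (\<nu> ^^ j) x) = (\<Sum>j<p. if j = 0 then of_nat p \<cdot> x else 0)"
    unfolding omega_powi_sum by (intro sum.cong refl) (auto dest: zdvd_imp_le)
  finally show ?thesis using p_pos by simp
qed

lemma eproj_eq_proj: "eproj H k x = proj k x"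
proof -
  let ?r = "nat (k mod int p)"
  have r: "?r < p" "int ?r = k mod int p" using p_pos by (simp_all add: nat_less_iff)
  have pr: "proj (int ?r) x = proj k x"
    unfolding r(2) by (metis mod_mult_div_eq proj_periodic)
  have uniq: "\<gamma> ?r = proj k x" if "\<forall>k<p. \<gamma> k \<in> eigenspace H (int k)" "x = (\<Sum>k<p. \<gamma> k)" for \<gamma>
  proof -
    have "proj (int ?r) x = (\<Sum>l<p. proj (int ?r) (\<gamma> l))"
      using that(2) proj_sum by blast
    also have "\<dots> = (\<Sum>l<p. if l = ?r then \<gamma> ?r else 0)"
    proof (rule sum.cong[OF refl])
      fix l assume l: "l \<in> {..<p}"
      have "int p dvd int l - int ?r \<longleftrightarrow> l = ?r"
        using l r by (auto simp: mod_eq_dvd_iff[symmetric])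
      then show "proj (int ?r) (\<gamma> l) = (if l = ?r then \<gamma> ?r else 0)"
        using proj_eigenspace[of "\<gamma> l" "int l" "int ?r"] that(1) l by auto
    qed
    finally show ?thesis using r pr by simp
  qed
  show ?thesis unfolding eproj_def
  proof (rule the_equality)
    show "\<exists>\<gamma>. (\<forall>k<p. \<gamma> k \<in> eigenspace H (int k)) \<and> x = (\<Sum>k<p. \<gamma> k) \<and> proj k x = \<gamma> ?r"
      by (intro exI[of _ "\<lambda>k. proj (int k) x"]) (simp only: proj_in_eigenspace sum_proj pr simp_thms)
  qed (use uniq in blast)
qed

lemma proj_adjoint: "B (proj k x) y = B x (proj (- k) y)"
proof -
  have "B ((\<nu> ^^ j) x) y = B x ((\<nu> ^^ (p - j)) y)" if "j \<le> p" for j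
  proof -
    have "(\<nu> ^^ (p - j)) ((\<nu> ^^ j) x) = x"
      using period that by (metis comp_apply funpow_add id_apply le_add_diff_inverse2)
    then show ?thesis using form_funpow_isom[of "p - j" "(\<nu> ^^ j) x" y] by simp
  qed
  then have "B (proj k x) y = 1 / of_nat p * (\<Sum>j<p. \<omega> powi (- k * int j) * B x ((\<nu> ^^ (p - j)) y))"
    by (simp add: proj_def form_scale form_sum)
  also have "(\<Sum>j<p. \<omega> powi (- k * int j) * B x ((\<nu> ^^ (p - j)) y)) =
      (\<Sum>j<p. \<omega> powi (- (- k) * int j) * B x ((\<nu> ^^ j) y))"
  \<comment> \<open>Negation modulo \<open>p\<close>; the index \<open>0\<close> is fixed, as
    \<open>p - 0\<close> would leave the range.\<close>
  proof (rule sum.reindex_bij_witness[of _ "\<lambda>j. if j = 0 then 0 else p - j" "\<lambda>j. if j = 0 then 0 else p - j"])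
    fix j assume j: "j \<in> {..<p}"
    show "\<omega> powi (- (- k) * int (if j = 0 then 0 else p - j)) * B x ((\<nu> ^^ (if j = 0 then 0 else p - j)) y) =
      \<omega> powi (- k * int j) * B x ((\<nu> ^^ (p - j)) y)"
    proof (cases "j = 0")
      case True
      then show ?thesis using period by simp
    next
      case False
      have "- (- k) * int (p - j) = - k * int j + int p * k"
        using j by (simp add: of_nat_diff algebra_simps)
      then show ?thesis using False by (simp only: if_False omega_powi_period)
    qed
  qed auto
  finally show ?thesis by (simp add: proj_def form_scale_right form_sum_right)
qed

lemma proj_proj: "proj k (proj k x) = proj k x"
  using proj_eigenspace[OF proj_in_eigenspace, of k k x] by simp

lemma orthonormal_form: "i \<in> {1..d} \<Longrightarrow> j \<in> {1..d} \<Longrightarrow> B (\<alpha> i) (\<alpha> j) = (if i = j then 1 else 0)"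
  and span_orthonormal: "V.span (\<alpha> ` {1..d}) = UNIV"
  and inj_orthonormal: "inj_on \<alpha> {1..d}"
  using orthonormal by (auto simp: orthonormal_basis_def)

lemma orthonormal_expansion: "(\<Sum>q=1..d. B x (\<alpha> q) \<cdot> \<alpha> q) = x"
proof -
  obtain u where "x = (\<Sum>v\<in>\<alpha> ` {1..d}. u v \<cdot> v)"
    using span_orthonormal V.span_finite[of "\<alpha> ` {1..d}"] by auto
  then have x: "x = (\<Sum>i=1..d. u (\<alpha> i) \<cdot> \<alpha> i)"
    using sum.reindex[OF inj_orthonormal] by (simp add: o_def)
  have "B x (\<alpha> q) = u (\<alpha> q)" if q: "q \<in> {1..d}" for q
  proof -
    have "B x (\<alpha> q) = (\<Sum>i=1..d. u (\<alpha> i) * B (\<alpha> i) (\<alpha> q))"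
      by (subst x) (simp add: form_sum form_scale)
    also have "\<dots> = (\<Sum>i=1..d. if i = q then u (\<alpha> q) else 0)"
      using q by (intro sum.cong refl) (auto simp: orthonormal_form simp del: atLeastAtMost_iff)
    finally show ?thesis using q by simp
  qed
  then have "(\<Sum>q=1..d. B x (\<alpha> q) \<cdot> \<alpha> q) = (\<Sum>i=1..d. u (\<alpha> i) \<cdot> \<alpha> i)"
    by (intro sum.cong refl) simp
  then show ?thesis using x by simp
qed

text \<open>In coordinates with respect to a basis \<open>W\<close> of the eigenspace, swapping the
  sums leaves for each \<open>b\<close> in \<open>W\<close> the \<open>b\<close>-coordinate of
  \<open>proj k b = b\<close>, which is \<open>1\<close>.\<close>

lemma trace_proj: "(\<Sum>q=1..d. B (proj k (\<alpha> q)) (\<alpha> q)) = of_nat (edim H k)"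
proof -
  obtain W where W: "W \<subseteq> eigenspace H k" "V.independent W" "eigenspace H k \<subseteq> V.span W"
      "card W = V.dim (eigenspace H k)"
    using V.basis_exists by blast
  have fin: "finite W"
    using V.independent_span_bound[of "\<alpha> ` {1..d}" W] W(2) span_orthonormal by auto
  let ?r = "\<lambda>x. V.representation W (proj k x)"
  have sp: "proj k x \<in> V.span W" for x using W(3) proj_in_eigenspace by blast
  have "B (proj k (\<alpha> q)) (\<alpha> q) = (\<Sum>b\<in>W. ?r (\<alpha> q) b * B b (\<alpha> q))" for q
  proof -
    have "proj k (\<alpha> q) = (\<Sum>b\<in>W. ?r (\<alpha> q) b \<cdot> b)"
      using V.sum_representation_eq[OF W(2) sp fin subset_refl] by simp
    then have "B (proj k (\<alpha> q)) (\<alpha> q) = B (\<Sum>b\<in>W. ?r (\<alpha> q) b \<cdot> b) (\<alpha> q)" by simp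
    then show ?thesis by (simp add: form_sum form_scale)
  qed
  then have "(\<Sum>q=1..d. B (proj k (\<alpha> q)) (\<alpha> q)) = (\<Sum>b\<in>W. \<Sum>q=1..d. ?r (\<alpha> q) b * B b (\<alpha> q))"
    by (simp add: sum.swap[of _ W])
  also have "\<dots> = (\<Sum>b\<in>W. 1)"
  proof (rule sum.cong[OF refl])
    fix b assume b: "b \<in> W"
    have "proj k b = (\<Sum>q=1..d. B b (\<alpha> q) \<cdot> proj k (\<alpha> q))"
      by (subst orthonormal_expansion[of b, symmetric]) (simp add: proj_sum proj_scale)
    then have "?r b = (\<lambda>c. \<Sum>q=1..d. B b (\<alpha> q) * ?r (\<alpha> q) c)"
      by (simp add: V.representation_sum[OF W(2)] V.representation_scale[OF W(2)] sp V.span_scale)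
    moreover have "proj k b = b" using b W(1) proj_eigenspace[of b k k] by auto
    moreover have "V.representation W b b = 1" using V.representation_basis[OF W(2) b] by simp
    ultimately show "(\<Sum>q=1..d. ?r (\<alpha> q) b * B b (\<alpha> q)) = 1" by (metis (no_types, lifting) mult.commute sum.cong)
  qed
  finally show ?thesis using W(4) by (simp add: edim_def)
qed

lemma edim_periodic: "edim H (k + int p) = edim H k"
  using omega_powi_period[of k 1] by (simp add: edim_def eigenspace_def)

lemma edim_sum: "(\<Sum>k<p. edim H (int k)) = d"
proof -
  have "of_nat (\<Sum>k<p. edim H (int k)) = (\<Sum>q=1..d. B (\<Sum>k<p. proj (int k) (\<alpha> q)) (\<alpha> q))"
    by (simp add: trace_proj[symmetric] form_sum sum.swap[of _ "{..<p}"])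
  also have "\<dots> = (\<Sum>q=1..d. 1)"
    unfolding sum_proj by (intro sum.cong refl) (simp add: orthonormal_form del: atLeastAtMost_iff)
  also have "\<dots> = (of_nat d :: complex)" by simp
  finally show ?thesis by (simp only: of_nat_eq_iff)
qed

end

lemma module_scale_words: "module scale_words"
proof unfold_locales
  fix a b :: complex and x y :: "'g list \<Rightarrow>\<^sub>0 complex"
  have l: "Poly_Mapping.lookup (Poly_Mapping.map (\<lambda>z. c * z) w) u = c * Poly_Mapping.lookup w u"
    for c and w :: "'g list \<Rightarrow>\<^sub>0 complex" and u
    by (rule lookup_map_0) simp
  show "scale_words a (x + y) = scale_words a x + scale_words a y"
    by (rule poly_mapping_eqI) (simp only: lookup_add l distrib_left)
  show "scale_words (a + b) x = scale_words a x + scale_words b x"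
    by (rule poly_mapping_eqI) (simp only: lookup_add l, simp only: distrib_right)
  show "scale_words a (scale_words b x) = scale_words (a * b) x"
    by (rule poly_mapping_eqI) (simp only: l, simp only: mult.assoc)
  show "scale_words 1 x = x"
    by (rule poly_mapping_eqI) (simp only: l, simp only: mult_1_left)
qed

locale twisted_fock = twisted H d \<alpha>
  for H :: "'h::ab_group_add twisted_data" and d \<alpha> +
  fixes S :: "('h hhat, 'v::ab_group_add) lie_module"
  assumes S: "is_S_nu H S"
begin

section \<open>The induced module as a Fock space\<close>

abbreviation "G \<equiv> hhat_carrier H"

lemma rep: "lie_representation G (hhat_scale H) (hhat_bracket H) (mscl S) (act S)"
  using S by (simp add: is_S_nu_def is_induced_module_def)

sublocale M: vector_space "mscl S"
  using rep by (simp add: lie_representation_def)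

abbreviation smulV (infixr \<open>\<odot>\<close> 75) where "c \<odot> v \<equiv> mscl S c v"

lemma act_add: "x \<in> G \<Longrightarrow> y \<in> G \<Longrightarrow> act S (x + y) v = act S x v + act S y v"
  and act_scale: "x \<in> G \<Longrightarrow> act S (hhat_scale H c x) v = c \<odot> act S x v"
  and act_bracket: "x \<in> G \<Longrightarrow> y \<in> G \<Longrightarrow> act S (hhat_bracket H x y) v = act S x (act S y v) - act S y (act S x v)"
  and act_linear: "x \<in> G \<Longrightarrow> Vector_Spaces.linear (mscl S) (mscl S) (act S x)"
  using rep by (simp_all add: lie_representation_def)

lemma act_vec_add: "x \<in> G \<Longrightarrow> act S x (u + v) = act S x u + act S x v"
  and act_vec_scale: "x \<in> G \<Longrightarrow> act S x (c \<odot> v) = c \<odot> act S x v"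
proof -
  assume "x \<in> G"
  then interpret Vector_Spaces.linear "mscl S" "mscl S" "act S x" by (rule act_linear)
  show "act S x (u + v) = act S x u + act S x v" "act S x (c \<odot> v) = c \<odot> act S x v"
    by (simp_all add: add scale)
qed

lemma eigenspace_0: "0 \<in> eigenspace H k"
  by (simp add: eigenspace_def isom_0)

lemma eigenspace_add: "x \<in> eigenspace H k \<Longrightarrow> y \<in> eigenspace H k \<Longrightarrow> x + y \<in> eigenspace H k"
  by (simp add: eigenspace_def isom_add V.scale_right_distrib)

lemma carrier_add: "x \<in> G \<Longrightarrow> y \<in> G \<Longrightarrow> x + y \<in> G"
  by (simp add: hhat_carrier_def lookup_add eigenspace_add)

lemma carrier_central: "(0, z) \<in> G"
  by (simp add: hhat_carrier_def eigenspace_0)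

lemma carrier_single: "u \<in> eigenspace H k \<Longrightarrow> (Poly_Mapping.single k u, 0) \<in> G"
  by (simp add: hhat_carrier_def lookup_single when_def eigenspace_0)

lemma act_0: "act S 0 v = 0"
  using act_scale[OF carrier_central[of 0], of 0 v] by (simp add: hhat_scale_def zero_prod_def map_zero)

lemma act_sum: "(\<And>i. i \<in> I \<Longrightarrow> f i \<in> G) \<Longrightarrow> act S (\<Sum>i\<in>I. f i) v = (\<Sum>i\<in>I. act S (f i) v) \<and> (\<Sum>i\<in>I. f i) \<in> G"
  using carrier_central[of 0]
  by (induction I rule: infinite_finite_induct) (simp_all add: act_0[unfolded zero_prod_def] act_add carrier_add zero_prod_def)

lemma act_induct:
  assumes "P (vac S)" "\<And>u v. P u \<Longrightarrow> P v \<Longrightarrow> P (u + v)" "\<And>c v. P v \<Longrightarrow> P (c \<odot> v)"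
    "\<And>x v. x \<in> G \<Longrightarrow> P v \<Longrightarrow> P (act S x v)"
  shows "P v"
proof -
  obtain w where w: "Poly_Mapping.keys w \<subseteq> lists G" "word_eval (mscl S) (act S) (vac S) w = v"
    using S unfolding is_S_nu_def is_induced_module_def by blast
  have f: "P (foldr (act S) u (vac S))" if "u \<in> lists G" for u
    using that by induction (auto intro: assms)
  have "P 0" using assms(3)[OF assms(1), of 0] by simp
  then have "P (\<Sum>u\<in>I. Poly_Mapping.lookup w u \<odot> foldr (act S) u (vac S))" if "I \<subseteq> lists G" for I
    using that by (induction I rule: infinite_finite_induct) (auto intro: assms f)
  then show ?thesis using w unfolding word_eval_def by blast
qed

text \<open>The element \<open>word [b] - snd b\<close> is a defining relation, hence evaluates to
  \<open>0\<close> at the vacuum.\<close>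

lemma act_vac:
  assumes "b \<in> hhat_nonneg H"
  shows "act S b (vac S) = snd b \<odot> vac S"
proof -
  interpret W: module "scale_words :: complex \<Rightarrow> ('h hhat list \<Rightarrow>\<^sub>0 complex) \<Rightarrow> _"
    by (rule module_scale_words)
  let ?w = "word [b] - scale_words (snd b) (word [])"
  have b: "b \<in> G" using assms by (simp add: hhat_nonneg_def)
  have keys: "Poly_Mapping.keys ?w \<subseteq> {[b], []}"
  proof
    fix u assume "u \<in> Poly_Mapping.keys ?w"
    then have "Poly_Mapping.lookup ?w u \<noteq> 0" by (simp add: in_keys_iff)
    then show "u \<in> {[b], []}"
      by (auto simp: lookup_minus lookup_map_0 lookup_single when_def split: if_splits)
  qed
  have "word ([] @ [b]) - scale_words (snd b) (word []) \<in> induced_relations G (hhat_scale H) (hhat_bracket H) (hhat_nonneg H) snd"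
    unfolding induced_relations_def using assms by (intro W.span_base UnI2) blast
  moreover have "Poly_Mapping.keys ?w \<subseteq> lists G" using keys b by auto
  ultimately have "word_eval (mscl S) (act S) (vac S) ?w = 0"
    using S by (auto simp: is_S_nu_def is_induced_module_def)
  moreover have "word_eval (mscl S) (act S) (vac S) ?w = (\<Sum>u\<in>{[b], []}. Poly_Mapping.lookup ?w u \<odot> foldr (act S) u (vac S))"
    unfolding word_eval_def using keys
    by (intro sum.mono_neutral_left) (auto simp: in_keys_iff)
  ultimately show ?thesis
    by (simp add: lookup_minus lookup_map_0 lookup_single when_def)
qed

text \<open>\<open>C\<close> acts as \<open>1\<close> on the vacuum and commutes with the whole
  algebra, so induction along the generated module applies.\<close>

lemma act_central: "act S (0, z) v = z \<odot> v"
proof -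
  have "act S (0, 1) v = v"
  proof (induction v rule: act_induct)
    case 1
    have "(0, 1) \<in> hhat_nonneg H" using carrier_central by (simp add: hhat_nonneg_def)
    then show ?case using act_vac by fastforce
  next
    case (4 x v)
    have "hhat_bracket H (0, 1) x = 0" by (simp add: hhat_bracket_def zero_prod_def)
    then show ?case using act_bracket[OF carrier_central 4(1), of 1 v] 4(2) by (simp add: act_0)
  qed (simp_all add: act_vec_add act_vec_scale carrier_central)
  then show ?thesis
    using act_scale[OF carrier_central, of z 1 v] by (simp add: hhat_scale_def map_zero)
qed

definition mode :: "nat \<Rightarrow> int \<Rightarrow> 'v \<Rightarrow> 'v" where
  "mode q k = hmode H S (\<alpha> q) k"

lemma mode_eq: "mode q k = act S (Poly_Mapping.single k (proj k (\<alpha> q)), 0)"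
  by (simp add: mode_def hmode_def eproj_eq_proj fun_eq_iff)

lemma act_single_sum:
  "act S (Poly_Mapping.single k (\<Sum>q\<in>I. c q \<cdot> proj k (\<alpha> q)), 0) v = (\<Sum>q\<in>I. c q \<odot> mode q k v)"
proof -
  have x: "(Poly_Mapping.single k (\<Sum>q\<in>I. c q \<cdot> proj k (\<alpha> q)), 0) =
     (\<Sum>q\<in>I. hhat_scale H (c q) (Poly_Mapping.single k (proj k (\<alpha> q)), 0))"
    by (rule prod_eqI, rule poly_mapping_eqI)
       (auto simp: fst_sum snd_sum hhat_scale_def lookup_sum lookup_map_0 lookup_single when_def)
  have "hhat_scale H (c q) (Poly_Mapping.single k (proj k (\<alpha> q)), 0) \<in> G" for q
  proof -
    have "hhat_scale H (c q) (Poly_Mapping.single k (proj k (\<alpha> q)), 0) = (Poly_Mapping.single k (proj k (c q \<cdot> \<alpha> q)), 0)"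
      by (rule prod_eqI, rule poly_mapping_eqI)
         (auto simp: hhat_scale_def lookup_map_0 lookup_single when_def proj_scale)
    then show ?thesis by (simp add: carrier_single proj_in_eigenspace)
  qed
  then show ?thesis
    unfolding x using act_sum[of I "\<lambda>q. hhat_scale H (c q) (Poly_Mapping.single k (proj k (\<alpha> q)), 0)" v]
    by (simp add: act_scale carrier_single proj_in_eigenspace mode_eq)
qed

lemma act_single:
  assumes "u \<in> eigenspace H k"
  shows "act S (Poly_Mapping.single k u, 0) v = (\<Sum>q=1..d. B u (\<alpha> q) \<odot> mode q k v)"
proof -
  have "u = proj k u" using proj_eigenspace[OF assms, of k] by simp
  also have "\<dots> = (\<Sum>q=1..d. B u (\<alpha> q) \<cdot> proj k (\<alpha> q))"
    by (subst orthonormal_expansion[of u, symmetric]) (simp add: proj_sum proj_scale)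
  finally show ?thesis using act_single_sum by metis
qed

lemma act_expand:
  assumes "x \<in> G"
  shows "act S x v = (\<Sum>k\<in>Poly_Mapping.keys (fst x). \<Sum>q=1..d. B (Poly_Mapping.lookup (fst x) k) (\<alpha> q) \<odot> mode q k v)
     + snd x \<odot> v"
proof -
  have e: "Poly_Mapping.lookup (fst x) k \<in> eigenspace H k" for k using assms by (simp add: hhat_carrier_def)
  let ?f = "\<lambda>k. (Poly_Mapping.single k (Poly_Mapping.lookup (fst x) k), 0 :: complex)"
  have x: "x = (\<Sum>k\<in>Poly_Mapping.keys (fst x). ?f k) + (0, snd x)"
    by (rule prod_eqI) (simp_all add: fst_sum snd_sum sum_single_lookup)
  have s: "act S (\<Sum>k\<in>Poly_Mapping.keys (fst x). ?f k) v = (\<Sum>k\<in>Poly_Mapping.keys (fst x). act S (?f k) v)"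
    "(\<Sum>k\<in>Poly_Mapping.keys (fst x). ?f k) \<in> G"
    using act_sum[of "Poly_Mapping.keys (fst x)" ?f v] e carrier_single by blast+
  have "act S x v = act S (\<Sum>k\<in>Poly_Mapping.keys (fst x). ?f k) v + act S (0, snd x) v"
    by (subst x) (rule act_add[OF s(2) carrier_central])
  then show ?thesis unfolding s(1) act_central act_single[OF e] .
qed

sublocale fock "mscl S" mode "vac S" d p "\<lambda>k q q'. B (proj k (\<alpha> q)) (\<alpha> q')" "edim H"
proof
  show "0 < p" by (rule p_pos)
  have G: "(Poly_Mapping.single k (proj k (\<alpha> q)), 0) \<in> G" for k q
    by (rule carrier_single[OF proj_in_eigenspace])
  show "mode q k (u + v) = mode q k u + mode q k v" "mode q k (c \<odot> v) = c \<odot> mode q k v" for q k u v c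
    by (simp_all add: mode_eq act_vec_add act_vec_scale G)
  show "mode q k (mode q' l v) = mode q' l (mode q k v) +
      (if k + l = 0 then (of_int k / of_nat p * B (proj k (\<alpha> q)) (\<alpha> q')) \<odot> v else 0)" for q q' k l v
  proof -
    have "B (proj k (\<alpha> q)) (proj l (\<alpha> q')) = B (proj k (\<alpha> q)) (\<alpha> q')" if "k + l = 0"
    proof -
      have "l = - k" using that by simp
      then show ?thesis using proj_adjoint[of k "proj k (\<alpha> q)" "\<alpha> q'"] by (simp add: proj_proj)
    qed
    then have "hhat_bracket H (Poly_Mapping.single k (proj k (\<alpha> q)), 0) (Poly_Mapping.single l (proj l (\<alpha> q')), 0) =
       (0, if k + l = 0 then of_int k / of_nat p * B (proj k (\<alpha> q)) (\<alpha> q') else 0)"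
      by (auto simp: hhat_bracket_def frac_exp_def form_0 form_sym[of _ 0])
    then show ?thesis
      using act_bracket[OF G G, of k q l q' v] by (auto simp: mode_eq[symmetric] act_central algebra_simps)
  qed
  show "(\<Sum>q'=1..d. B (proj k (\<alpha> q)) (\<alpha> q') \<odot> mode q' (k + int p * n) v) = mode q (k + int p * n) v" for q k n v
  proof -
    have "proj k (\<alpha> q) \<in> eigenspace H (k + int p * n)"
      using proj_in_eigenspace[of "k + int p * n"] by (simp add: proj_periodic)
    from act_single[OF this, of v] show ?thesis by (simp add: mode_eq proj_periodic)
  qed
  show "B (proj (- k) (\<alpha> q)) (\<alpha> q') = B (proj k (\<alpha> q')) (\<alpha> q)" for k q q'
    using proj_adjoint[of k "\<alpha> q'" "\<alpha> q"] by (simp add: form_sym)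
  show "(\<Sum>q=1..d. B (proj k (\<alpha> q)) (\<alpha> q)) = of_nat (edim H k)" for k by (rule trace_proj)
  show "edim H (k + int p) = edim H k" for k by (rule edim_periodic)
  show "(\<Sum>k<p. edim H (int k)) = d" by (rule edim_sum)
  show "mode q k (vac S) = 0" if "k \<ge> 0" for q k
  proof -
    have "(Poly_Mapping.single k (proj k (\<alpha> q)), 0) \<in> hhat_nonneg H"
      using G that by (simp add: hhat_nonneg_def)
    from act_vac[OF this] show ?thesis by (simp add: mode_eq)
  qed
  show "P v" if P: "P (vac S)" "\<And>u v. P u \<Longrightarrow> P v \<Longrightarrow> P (u + v)" "\<And>c v. P v \<Longrightarrow> P (c \<odot> v)"
    "\<And>q k v. q \<in> {1..d} \<Longrightarrow> P v \<Longrightarrow> P (mode q k v)" for P v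
  proof (induction v rule: act_induct)
    case (4 x v)
    have P0: "P 0" using P(3)[OF P(1), of 0] by simp
    have Ps: "P (\<Sum>i\<in>I. f i)" if "\<And>i. i \<in> I \<Longrightarrow> P (f i)" for I and f :: "'i \<Rightarrow> 'v"
      using that by (induction I rule: infinite_finite_induct) (auto intro: P0 P(2))
    have "P (\<Sum>q=1..d. c q \<odot> mode q k v)" for c k
      by (rule Ps) (blast intro: P(3,4) 4(2))
    then have "P (\<Sum>k\<in>I. \<Sum>q=1..d. c k q \<odot> mode q k v)" for c and I :: "int set"
      by (induction I rule: infinite_finite_induct) (auto intro: P0 P(2))
    then show ?case unfolding act_expand[OF 4(1)] by (intro P(2) P(3) 4(2))
  qed (use P in auto)
qed

end

section \<open>Structure of the algebra D-hat-plus\<close>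

lemma lookup_dop_scale: "Poly_Mapping.lookup (dop_scale c A) n = smult c (Poly_Mapping.lookup A n)"
  unfolding dop_scale_def by (rule lookup_map_0) simp

lemma dop_mult_single:
  "dop_mult (Poly_Mapping.single m f) (Poly_Mapping.single n g) =
     Poly_Mapping.single (m + n) (pcompose f [:of_int n, 1:] * g)"
  by (auto simp: dop_mult_def)

lemma dop_bracket_eq:
  "dop_bracket A B = (\<Sum>m\<in>Poly_Mapping.keys A. \<Sum>n\<in>Poly_Mapping.keys B.
     Poly_Mapping.single (m + n) (bracket_poly m (Poly_Mapping.lookup A m) n (Poly_Mapping.lookup B n)))"
proof -
  have "dop_mult B A = (\<Sum>m\<in>Poly_Mapping.keys A. \<Sum>n\<in>Poly_Mapping.keys B.
     Poly_Mapping.single (m + n)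
       (pcompose (Poly_Mapping.lookup B n) [:of_int m, 1:] * Poly_Mapping.lookup A m))"
    unfolding dop_mult_def by (subst sum.swap) (simp add: add.commute)
  then show ?thesis
    unfolding dop_bracket_def dop_mult_def[of A B]
    by (simp add: bracket_poly_def single_diff sum_subtractf)
qed

lemma dop_bracket_single:
  "dop_bracket (Poly_Mapping.single m f) (Poly_Mapping.single n g) =
     Poly_Mapping.single (m + n) (bracket_poly m f n g)"
  by (simp add: dop_bracket_def dop_mult_single bracket_poly_def single_diff add.commute)

lemma Psi_single: "Psi (Poly_Mapping.single m f) (Poly_Mapping.single n g) = psi_hom m f n g"
  by (auto simp: Psi_def psi_hom_def)

text \<open>The \<open>f\<close> with \<open>L_n^(r) = t^n f(D)\<close>: moving \<open>D^r\<close>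
  past \<open>t^n\<close> turns it into \<open>(D + n)^r\<close>.\<close>

definition gen_poly :: "int \<Rightarrow> nat \<Rightarrow> complex poly" where
  "gen_poly n r = smult ((- 1) ^ Suc r) ([:0, 1:] ^ Suc r * [:of_int n, 1:] ^ r)"

lemma Lgen_eq: "Lgen n r = Poly_Mapping.single n (gen_poly n r)"
proof -
  let ?f = "smult ((-1) ^ Suc r) (pcompose (pcompose (monom 1 r) [:of_int n, 1:] * monom 1 1) [:0, 1:] * monom 1 r)"
  have "Lgen n r = dop_scale ((-1) ^ Suc r) (Poly_Mapping.single n
     (pcompose (pcompose (monom 1 r) [:of_int n, 1:] * monom 1 1) [:0, 1:] * monom 1 r))"
    by (simp add: Lgen_def tD_def dop_mult_single)
  also have "\<dots> = Poly_Mapping.single n ?f"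
    by (rule poly_mapping_eqI) (simp add: lookup_dop_scale lookup_single when_def)
  also have "?f = gen_poly n r"
    by (rule poly_ext) (simp add: gen_poly_def poly_pcompose poly_monom mult_ac)
  finally show ?thesis .
qed

lemma poly_gen_poly: "poly (gen_poly n r) x = (-1) ^ Suc r * x ^ Suc r * (x + of_int n) ^ r"
  by (simp add: gen_poly_def add.commute)

lemma reflective_gen_poly: "reflective n (gen_poly n r)"
  unfolding reflective_def
proof
  fix x :: complex
  have "- of_int n - x = - (x + of_int n)" by simp
  then have "(- of_int n - x) ^ r = (-1) ^ r * (x + of_int n) ^ r" "(- x) ^ r = (-1) ^ r * x ^ r"
    by (metis power_minus, metis power_minus)
  then show "x * poly (gen_poly n r) (- of_int n - x) + (of_int n + x) * poly (gen_poly n r) x = 0"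
    by (simp add: poly_gen_poly algebra_simps)
qed

lemma gen_poly_nonzero: "gen_poly n r \<noteq> 0"
  by (simp add: gen_poly_def del: mult_pCons_left power_Suc)

lemma degree_gen_poly: "degree (gen_poly n r) = 2 * r + 1"
  unfolding gen_poly_def degree_smult_eq
  by (subst degree_mult_eq) (simp_all add: degree_power_eq del: mult_pCons_left power_Suc)

lemma lead_coeff_gen_poly: "lead_coeff (gen_poly n r) = (-1) ^ Suc r"
  by (simp add: gen_poly_def lead_coeff_mult lead_coeff_power del: mult_pCons_left power_Suc)

lemma gen_poly_0: "gen_poly 0 r = monom ((-1) ^ Suc r) (2 * r + 1)"
proof -
  have "[:0, 1 :: complex:] ^ Suc r * [:0, 1:] ^ r = [:0, 1:] ^ (2 * r + 1)"
    by (simp add: power_add[symmetric] mult_2 del: power_Suc) 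
  then show ?thesis unfolding gen_poly_def monom_altdef by simp
qed

lemma Dplus_reflective: "A \<in> Dplus \<Longrightarrow> reflective n (Poly_Mapping.lookup A n)"
proof (induction arbitrary: n rule: Dplus.induct)
  case (Dplus_gen n r)
  then show ?case by (simp add: Lgen_eq lookup_single when_def reflective_gen_poly reflective_0)
next
  case (Dplus_bracket A B)
  show ?case unfolding dop_bracket_eq lookup_sum
  proof -
    have s: "reflective n (\<Sum>i\<in>I. f i)" if "\<And>i. i \<in> I \<Longrightarrow> reflective n (f i)" for I :: "int set" and f
      using that by (induction I rule: infinite_finite_induct) (simp_all add: reflective_0 reflective_add)
    show "reflective n (\<Sum>x\<in>Poly_Mapping.keys A. \<Sum>xa\<in>Poly_Mapping.keys B. Poly_Mapping.lookup
       (Poly_Mapping.single (x + xa) (bracket_poly x (Poly_Mapping.lookup A x) xa (Poly_Mapping.lookup B xa))) n)"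
      by (intro s) (auto simp: lookup_single when_def intro: reflective_0 reflective_bracket_poly Dplus_bracket.IH)
  qed
qed (simp_all add: reflective_0 lookup_add reflective_add lookup_dop_scale reflective_smult)

section \<open>Expansion of brackets in the generators\<close>

lemma even_poly_expansion:
  fixes q :: "complex poly" and N :: complex
  assumes "\<And>x. poly q (- N - x) = poly q x" and "degree q \<le> 2 * t + 1"
  shows "\<exists>b. q = (\<Sum>i\<le>t. smult (b i) (([:0, 1:] * [:N, 1:]) ^ i))"
  using assms
proof (induction t arbitrary: q)
  case 0
  obtain c0 q' where q': "q = pCons c0 q'" by (cases q)
  then have "degree q' = 0" using "0.prems"(2) by (auto simp: degree_pCons_eq_if split: if_splits)
  then obtain c1 where "q' = [:c1:]" by (rule degree_eq_zeroE)
  with q' have q: "q = [:c0, c1:]" by simp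
  \<comment> \<open>The points \<open>1 - N/2\<close> and \<open>-1 - N/2\<close> are exchanged by
    the reflection, so the linear coefficient satisfies \<open>2 c1 = 0\<close>.\<close>
  have "c1 = 0" using "0.prems"(1)[of "1 - N / 2"] unfolding q by (simp add: field_simps)
  then have "q = smult c0 1" using q by (simp add: one_pCons)
  then show ?case by auto
next
  case (Suc t)
  define X where "X = [:0, 1 :: complex:]"
  define Y where "Y = [:N, 1 :: complex:]"
  have XY: "poly X x = x" "poly Y x = N + x" "X \<noteq> 0" "Y \<noteq> 0" "degree X = 1" "degree Y = 1" for x
    by (simp_all add: X_def Y_def)
  have "poly (q - [:poly q 0:]) 0 = 0" by simp
  then obtain q1 where q1: "q - [:poly q 0:] = X * q1"
    unfolding poly_eq_0_iff_dvd dvd_def X_def by auto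
  have q1': "x * poly q1 x = poly q x - poly q 0" for x
    using arg_cong[OF q1, of "\<lambda>P. poly P x"] by (simp add: XY)
  \<comment> \<open>Removing both \<open>x\<close> and \<open>x + N\<close> lowers the degree by two
    and keeps the symmetry. For \<open>N = 0\<close> the two roots coincide, and the second one
    comes from \<open>q1\<close> being odd.\<close>
  have "poly q1 (- N) = 0"
  proof (cases "N = 0")
    case True
    have "X * (q1 + pcompose q1 [:0, -1:]) = 0"
    proof (rule poly_ext)
      fix x
      have "x * poly q1 x = - x * poly q1 (- x)"
        using Suc.prems(1)[of x] unfolding q1' using True by simp
      then show "poly (X * (q1 + pcompose q1 [:0, -1:])) x = poly 0 x"
        by (simp add: XY poly_pcompose distrib_left)
    qed
    then have "q1 + pcompose q1 [:0, -1:] = 0" using XY by simp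
    then have "poly (q1 + pcompose q1 [:0, -1:]) 0 = 0" by simp
    then show ?thesis using True by (simp add: poly_pcompose)
  next
    case False
    then show ?thesis using q1'[of "- N"] Suc.prems(1)[of 0] by simp
  qed
  then obtain q2 where q2: "q1 = Y * q2"
    unfolding poly_eq_0_iff_dvd dvd_def Y_def by auto
  have q: "q = [:poly q 0:] + X * Y * q2"
    using q1 q2 by (simp add: diff_eq_eq algebra_simps)
  have sym: "poly q2 (- N - x) = poly q2 x" for x
  proof -
    have "X * Y * (pcompose q2 [:- N, -1:] - q2) = 0"
    proof (rule poly_ext)
      fix y
      have "poly q (- N - y) = poly q 0 + (- N - y) * (- y) * poly q2 (- N - y)"
        by (subst q) (simp add: XY)
      moreover have "poly q y = poly q 0 + y * (N + y) * poly q2 y"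
        by (subst q) (simp add: XY)
      ultimately show "poly (X * Y * (pcompose q2 [:- N, -1:] - q2)) y = poly 0 y"
        using Suc.prems(1)[of y] by (simp add: XY poly_pcompose algebra_simps)
    qed
    then have "pcompose q2 [:- N, -1:] = q2" using XY by simp
    then have "poly (pcompose q2 [:- N, -1:]) x = poly q2 x" by simp
    then show ?thesis by (simp add: poly_pcompose)
  qed
  have "degree q2 \<le> 2 * t + 1"
  proof (cases "q2 = 0")
    case False
    have "degree (X * Y * q2) = 2 + degree q2"
      using False XY by (simp add: degree_mult_eq)
    moreover have "X * Y * q2 = q - [:poly q 0:]" using q by (metis add_diff_cancel_left')
    moreover have "degree (q - [:poly q 0:]) \<le> 2 * Suc t + 1"
      using Suc.prems(2) by (intro degree_diff_le) auto
    ultimately show ?thesis by simp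
  qed simp
  then obtain b where b: "q2 = (\<Sum>i\<le>t. smult (b i) ((X * Y) ^ i))"
    using Suc.IH[OF sym] unfolding X_def Y_def by blast
  have "q = (\<Sum>i\<le>Suc t. smult ((\<lambda>i. case i of 0 \<Rightarrow> poly q 0 | Suc j \<Rightarrow> b j) i) ((X * Y) ^ i))"
    by (subst q, subst b) (simp add: sum.atMost_Suc_shift sum_distrib_left one_pCons del: sum.atMost_Suc)
  then show ?case unfolding X_def Y_def by blast
qed

text \<open>Both products have degree \<open>2 (r + s) + 2\<close> with the same leading
  coefficient, so the top terms cancel.\<close>

lemma degree_bracket_gen_poly: "degree (bracket_poly m (gen_poly m r) n (gen_poly n s)) \<le> 2 * (r + s) + 1"
proof -
  let ?f = "gen_poly m r" and ?g = "gen_poly n s" and ?D = "2 * (r + s) + 2"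
  have d: "degree (pcompose (gen_poly a b) [:c, 1:]) = 2 * b + 1" for a b c
    by (simp add: degree_pcompose degree_gen_poly)
  have l: "coeff (pcompose (gen_poly a b) [:c, 1:]) (2 * b + 1) = (-1) ^ Suc b" for a b c
    using lead_coeff_comp[of "[:c, 1:]" "gen_poly a b"] lead_coeff_gen_poly[of a b] by (simp add: d)
  have l': "coeff (gen_poly a b) (2 * b + 1) = (-1) ^ Suc b" for a b
    using lead_coeff_gen_poly[of a b] by (simp add: degree_gen_poly)
  have 1: "degree (pcompose (gen_poly a b) [:c, 1:] * gen_poly a' b') \<le> 2 * (b + b') + 2"
    "coeff (pcompose (gen_poly a b) [:c, 1:] * gen_poly a' b') (2 * (b + b') + 2) = (-1) ^ Suc b * (-1) ^ Suc b'"
    for a b c a' b'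
  proof -
    show "degree (pcompose (gen_poly a b) [:c, 1:] * gen_poly a' b') \<le> 2 * (b + b') + 2"
      using degree_mult_le[of "pcompose (gen_poly a b) [:c, 1:]" "gen_poly a' b'"] by (simp add: d degree_gen_poly)
    have "2 * (b + b') + 2 = (2 * b + 1) + (2 * b' + 1)" by simp
    then show "coeff (pcompose (gen_poly a b) [:c, 1:] * gen_poly a' b') (2 * (b + b') + 2) = (-1) ^ Suc b * (-1) ^ Suc b'"
      using coeff_mult_degree_sum[of "pcompose (gen_poly a b) [:c, 1:]" "gen_poly a' b'"]
      unfolding d degree_gen_poly l l' by simp
  qed
  have "degree (bracket_poly m ?f n ?g) \<le> ?D"
    unfolding bracket_poly_def using 1(1)[of m r "of_int n" n s] 1(1)[of n s "of_int m" m r]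
    by (intro degree_diff_le) (simp_all add: add.commute)
  moreover have "coeff (bracket_poly m ?f n ?g) ?D = 0"
    unfolding bracket_poly_def coeff_diff using 1(2)[of m r "of_int n" n s] 1(2)[of n s "of_int m" m r]
    by (simp add: add.commute)
  ultimately have "degree (bracket_poly m ?f n ?g) < ?D"
    by (metis le_neq_implies_less leading_coeff_0_iff degree_0 zero_less_Suc add_2_eq_Suc')
  then show ?thesis by simp
qed

text \<open>The lower limit \<open>min r s\<close> comes from a common factor of the two products,
  the upper limit from the degree bound. The quotient is symmetric about \<open>- (m + n)/2\<close>,
  hence a polynomial in \<open>x (x + m + n)\<close>.\<close>

lemma bracket_gen_poly_expansion:
  "\<exists>c. bracket_poly m (gen_poly m r) n (gen_poly n s) = (\<Sum>i=min r s..r+s. smult (c i) (gen_poly (m + n) i))"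
proof -
  let ?\<mu> = "min r s" and ?N = "of_int (m + n) :: complex"
  let ?Br = "bracket_poly m (gen_poly m r) n (gen_poly n s)"
  define X where "X = [:0, 1 :: complex:]"
  define Y where "Y k = [:of_int k, 1 :: complex:]" for k
  have XY: "poly X x = x" "poly (Y k) x = x + of_int k" "X \<noteq> 0" "Y k \<noteq> 0" "degree X = 1" "degree (Y k) = 1" for x k
    by (simp_all add: X_def Y_def)
  define q where "q = smult ((-1) ^ (r + s)) (X ^ (s - ?\<mu>) * Y (m + n) ^ (r - ?\<mu>) * Y n ^ (Suc r + s)
     - X ^ (r - ?\<mu>) * Y (m + n) ^ (s - ?\<mu>) * Y m ^ (Suc s + r))"
  have q: "?Br = X ^ Suc ?\<mu> * Y (m + n) ^ ?\<mu> * q"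
  proof (rule poly_ext)
    fix x :: complex
    have gen: "y ^ Suc (\<mu> + u) * z ^ (\<mu> + u) * x ^ Suc (\<mu> + w) * y ^ (\<mu> + w)
        - y' ^ Suc (\<mu> + w) * z ^ (\<mu> + w) * x ^ Suc (\<mu> + u) * y' ^ (\<mu> + u) =
      x ^ Suc \<mu> * z ^ \<mu> * (x ^ w * z ^ u * y ^ (Suc (\<mu> + u) + (\<mu> + w)) - x ^ u * z ^ w * y' ^ (Suc (\<mu> + w) + (\<mu> + u)))"
      for y y' z and \<mu> u w :: nat
      by (simp add: power_add right_diff_distrib mult_ac)
    have rs: "?\<mu> + (r - ?\<mu>) = r" "?\<mu> + (s - ?\<mu>) = s" by simp_all
    have a: "x + of_int n + of_int m = x + ?N" "x + of_int m + of_int n = x + ?N" by simp_all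
    have "poly ?Br x = (-1) ^ (r + s) * ((x + of_int n) ^ Suc r * (x + ?N) ^ r * x ^ Suc s * (x + of_int n) ^ s
       - (x + of_int m) ^ Suc s * (x + ?N) ^ s * x ^ Suc r * (x + of_int m) ^ r)"
      unfolding poly_bracket_poly poly_gen_poly a by (simp add: power_add right_diff_distrib mult_ac)
    also have "\<dots> = poly (X ^ Suc ?\<mu> * Y (m + n) ^ ?\<mu> * q) x"
      unfolding q_def poly_mult poly_power poly_smult poly_diff XY
        gen[of "x + of_int n" ?\<mu> "r - ?\<mu>" "x + ?N" "s - ?\<mu>" "x + of_int m", unfolded rs]
      by (simp only: mult_ac)
    finally show "poly ?Br x = poly (X ^ Suc ?\<mu> * Y (m + n) ^ ?\<mu> * q) x" .
  qed
  have sym: "poly q (- ?N - x) = poly q x" for x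
  proof -
    have "(X * Y (m + n)) ^ Suc ?\<mu> * (q - pcompose q [:- ?N, -1:]) = 0"
    proof (rule poly_ext)
      fix y
      have "reflective (m + n) ?Br" by (intro reflective_bracket_poly reflective_gen_poly)
      then have R: "y * poly ?Br (- ?N - y) + (?N + y) * poly ?Br y = 0" by (simp add: reflective_def)
      have neg: "(- ?N - y) ^ Suc ?\<mu> = (-1) ^ Suc ?\<mu> * (y + ?N) ^ Suc ?\<mu>" "(- y) ^ ?\<mu> = (-1) ^ ?\<mu> * y ^ ?\<mu>"
        unfolding power_mult_distrib[symmetric] by simp_all
      have "poly ?Br (- ?N - y) = (-1) ^ Suc ?\<mu> * (-1) ^ ?\<mu> * ((y + ?N) ^ Suc ?\<mu> * y ^ ?\<mu> * poly q (- ?N - y))"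
      proof -
        have "poly ?Br (- ?N - y) = (- ?N - y) ^ Suc ?\<mu> * (- y) ^ ?\<mu> * poly q (- ?N - y)"
          unfolding q poly_mult poly_power XY by (simp del: power_Suc)
        then show ?thesis unfolding neg by (simp only: mult_ac)
      qed
      also have "(-1 :: complex) ^ Suc ?\<mu> * (-1) ^ ?\<mu> = -1" by (simp add: power_mult_distrib[symmetric])
      finally have 1: "y * poly ?Br (- ?N - y) = - ((y * (y + ?N)) ^ Suc ?\<mu> * poly q (- ?N - y))"
        by (simp add: power_mult_distrib mult_ac)
      have 2: "(?N + y) * poly ?Br y = (y * (y + ?N)) ^ Suc ?\<mu> * poly q y"
        unfolding q poly_mult poly_power XY by (simp add: power_mult_distrib mult_ac add.commute)
      show "poly ((X * Y (m + n)) ^ Suc ?\<mu> * (q - pcompose q [:- ?N, -1:])) y = poly 0 y"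
        using R unfolding 1 2 poly_mult poly_power XY poly_diff poly_pcompose
        by (simp add: right_diff_distrib)
    qed
    then have "pcompose q [:- ?N, -1:] = q" using XY by simp
    then have "poly (pcompose q [:- ?N, -1:]) x = poly q x" by simp
    then show ?thesis by (simp add: poly_pcompose)
  qed
  have deg: "degree q \<le> 2 * (r + s - ?\<mu>) + 1"
  proof (cases "q = 0")
    case False
    have "degree ?Br = 2 * ?\<mu> + 1 + degree q"
      unfolding q using False XY by (simp add: degree_mult_eq degree_power_eq del: power_Suc)
    then show ?thesis using degree_bracket_gen_poly[of m r n s] by simp
  qed simp
  obtain b where b: "q = (\<Sum>i\<le>r+s-?\<mu>. smult (b i) (([:0, 1:] * [:?N, 1:]) ^ i))"
    using even_poly_expansion[OF sym deg] by blast
  have g: "X ^ Suc ?\<mu> * Y (m + n) ^ ?\<mu> * smult (b i) (([:0, 1:] * [:?N, 1:]) ^ i)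
      = smult ((-1) ^ Suc (i + ?\<mu>) * b i) (gen_poly (m + n) (i + ?\<mu>))" for i
  proof -
    have "(-1 :: complex) ^ Suc (i + ?\<mu>) * b i * (-1) ^ Suc (i + ?\<mu>) = b i"
    proof -
      have "(-1 :: complex) ^ k * c * (-1) ^ k = ((-1) ^ k * (-1) ^ k) * c" for k c by (simp only: mult_ac)
      moreover have "(-1 :: complex) ^ k * (-1) ^ k = 1" for k by (simp add: power_mult_distrib[symmetric])
      ultimately show ?thesis by simp
    qed
    then show ?thesis
      unfolding gen_poly_def X_def[symmetric] Y_def[symmetric] smult_smult
      by (simp only: power_mult_distrib power_add power_Suc mult_smult_right mult_ac)
  qed
  have "?Br = (\<Sum>i\<le>r+s-?\<mu>. smult ((-1) ^ Suc (i + ?\<mu>) * b i) (gen_poly (m + n) (i + ?\<mu>)))"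
    unfolding q b sum_distrib_left g ..
  also have "\<dots> = (\<Sum>i=?\<mu>..r+s. smult ((-1) ^ Suc i * b (i - ?\<mu>)) (gen_poly (m + n) i))"
    by (rule sum.reindex_bij_witness[of _ "\<lambda>i. i - ?\<mu>" "\<lambda>i. i + ?\<mu>"]) auto
  finally show ?thesis
    by (rule exI[of _ "\<lambda>i. (-1) ^ Suc i * b (i - ?\<mu>)"])
qed

text \<open>All signs cancel and a Beta integrand remains; this is the origin of the factorials in
  the central term.\<close>

lemma vac_poly_gen_poly:
  "vac_poly (int m) (gen_poly (int m) r) (gen_poly (- int m) s) =
     [:0, 1:] ^ (r + s + 1) * [:of_nat m, -1:] ^ (r + s + 1)"
proof (rule poly_ext)
  fix x :: complex
  have p: "(- x) ^ k = (-1) ^ k * x ^ k" for k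
    by (simp add: power_mult_distrib[symmetric])
  have s: "(-1 :: complex) ^ k * (-1) ^ k = 1" for k
    by (simp add: power_mult_distrib[symmetric])
  have "poly (gen_poly (int m) r) (- x) = ((-1) ^ Suc r * (-1) ^ Suc r) * x ^ Suc r * (of_nat m - x) ^ r"
    unfolding poly_gen_poly p by (simp only: mult_ac) (simp add: algebra_simps)
  moreover have "poly (gen_poly (- int m) s) (of_nat m - x) = - ((-1) ^ s * (-1) ^ s) * x ^ s * (of_nat m - x) ^ Suc s"
    unfolding poly_gen_poly by (simp add: p mult_ac)
  moreover have "- (A * B) = x ^ (r + s + 1) * w ^ (r + s + 1)"
    if "A = 1 * x ^ Suc r * w ^ r" "B = - 1 * x ^ s * w ^ Suc s" for A B w
    unfolding that by (simp add: power_add mult_ac)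
  ultimately show "poly (vac_poly (int m) (gen_poly (int m) r) (gen_poly (- int m) s)) x =
      poly ([:0, 1:] ^ (r + s + 1) * [:of_nat m, -1:] ^ (r + s + 1)) x"
    unfolding s by (simp add: poly_vac_poly del: power_Suc)
qed

text \<open>The cocycle contributes half of a sum and the zeta pairing half of integral minus sum,
  so the Beta integral survives. For \<open>m < 0\<close> antisymmetry of the left side matches the
  odd exponent of \<open>m\<close>.\<close>

lemma central_term:
  assumes "m + n = 0"
  shows "- (1/2) * psi_hom m (gen_poly m r) n (gen_poly n s)
     + 1/2 * pairing zeta_fps (bracket_poly m (gen_poly m r) n (gen_poly n s)) =
    (fact (r + s + 1))\<^sup>2 / (2 * fact (2 * (r + s) + 3)) * of_int m ^ (2 * (r + s) + 3)"
proof -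
  have pos: "- (1/2) * psi_hom (int m) (gen_poly (int m) r) (- int m) (gen_poly (- int m) s)
     + 1/2 * pairing zeta_fps (bracket_poly (int m) (gen_poly (int m) r) (- int m) (gen_poly (- int m) s)) =
    (fact (r + s + 1))\<^sup>2 / (2 * fact (2 * (r + s) + 3)) * of_nat m ^ (2 * (r + s) + 3)" if "m > 0" for m r s
  proof -
    let ?P = "vac_poly (int m) (gen_poly (int m) r) (gen_poly (- int m) s)"
    note rg = reflective_gen_poly[of "int m" r] reflective_gen_poly[of "- int m" s]
    obtain R where R: "pderiv R = ?P" using pderiv_surj by blast
    have e: "r + s + 1 + (r + s + 1) + 1 = 2 * (r + s) + 3" by simp
    have "poly R (of_nat m) - poly R 0 =
       fact (r + s + 1) * fact (r + s + 1) / fact (2 * (r + s) + 3) * of_nat m ^ (2 * (r + s) + 3)"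
      using beta_integral[of R "r + s + 1" "of_nat m" "r + s + 1"] unfolding R vac_poly_gen_poly e by blast
    moreover have "pairing zeta_fps (?P - pcompose ?P [:of_nat m, 1:]) =
       (\<Sum>j<m. poly ?P (of_nat j)) - (poly R (of_nat m) - poly R 0)"
      using pairing_zeta_fps[of R m] unfolding R .
    moreover have "- (1/2) * - u + 1/2 * - (u - j) = k / (2 * l) * w" if "j = k / l * w" for u j k l w :: complex
      using that by (simp add: diff_divide_distrib)
    ultimately show ?thesis
      unfolding psi_hom_eq_vac_poly[OF that rg] bracket_poly_eq_vac_poly[OF rg] pairing_minus power2_eq_square
      by presburger
  qed
  consider "m = 0" | "m > 0" | "m < 0" by linarith
  then show ?thesis
  proof cases
    case 1
    then show ?thesis using assms by (simp add: psi_hom_def bracket_poly_def mult.commute)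
  next
    case 2
    then show ?thesis using pos[of "nat m" r s] assms by (simp add: add_eq_0_iff)
  next
    case 3
    have n: "int (nat n) = n" "- n = m" "of_nat (nat n) = (- of_int m :: complex)"
      using 3 assms by (simp_all add: add_eq_0_iff)
    have "odd (2 * (r + s) + 3)" by simp
    then have "(- of_int m :: complex) ^ (2 * (r + s) + 3) = - (of_int m ^ (2 * (r + s) + 3))"
      by (rule power_minus_odd)
    note P = pos[of "nat n" s r, unfolded n psi_hom_swap[of n _ m] bracket_poly_swap[of n _ m]
        pairing_minus add.commute[of s r] this]
    have "- (1/2) * u + 1/2 * v = k * w" if "- (1/2) * - u + 1/2 * - v = k * - w" for u v k w :: complex
      using that by (simp add: algebra_simps)
    from this[OF P] show ?thesis using 3 assms by simp
  qed
qed

interpretation dhat: vector_space dhat_scale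
proof unfold_locales
  fix a b :: complex and x y :: dhat
  have s: "dop_scale a (A + B) = dop_scale a A + dop_scale a B"
    "dop_scale (a + b) A = dop_scale a A + dop_scale b A"
    "dop_scale a (dop_scale b A) = dop_scale (a * b) A" "dop_scale 1 A = A" for A B
    by (rule poly_mapping_eqI; simp add: lookup_dop_scale lookup_add smult_add_right smult_add_left)+
  show "dhat_scale a (x + y) = dhat_scale a x + dhat_scale a y"
    "dhat_scale (a + b) x = dhat_scale a x + dhat_scale b x"
    "dhat_scale a (dhat_scale b x) = dhat_scale (a * b) x" "dhat_scale 1 x = x"
    by (rule prod_eqI; simp add: dhat_scale_def s ring_distribs)+
qed

lemma fst_Lbar: "fst (dhat_Lbar n r) = Poly_Mapping.single n (gen_poly n r)"
proof -
  have "dop_scale c 0 = 0" for c by (simp add: dop_scale_def map_zero)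
  then show ?thesis by (simp add: dhat_Lbar_def dhat_L_def dhat_c_def dhat_scale_def Lgen_eq)
qed

lemma snd_Lbar: "snd (dhat_Lbar n r) = (if n = 0 then (- 1) ^ r / 2 * riemann_zeta (- of_nat (2 * r + 1)) else 0)"
  by (simp add: dhat_Lbar_def dhat_L_def dhat_c_def dhat_scale_def)

lemma inj_Lbar:
  assumes "dhat_Lbar n r = dhat_Lbar n' r'"
  shows "n = n' \<and> r = r'"
proof -
  have e: "Poly_Mapping.single n (gen_poly n r) = Poly_Mapping.single n' (gen_poly n' r')"
    using assms fst_Lbar by metis
  then have n: "n = n'"
    by (metis gen_poly_nonzero lookup_single_eq lookup_single_not_eq)
  have "gen_poly n r = gen_poly n r'"
    using e unfolding n by (metis lookup_single_eq)
  then show ?thesis using n degree_gen_poly[of n r] degree_gen_poly[of n r'] by simp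
qed

lemma Lbar_neq_c: "dhat_Lbar n r \<noteq> dhat_c"
proof
  assume "dhat_Lbar n r = dhat_c"
  then have "Poly_Mapping.single n (gen_poly n r) = 0" using fst_Lbar[of n r] by (simp add: dhat_c_def)
  then show False using gen_poly_nonzero by (metis lookup_single_eq lookup_zero)
qed

abbreviation "Lbar_basis \<equiv> insert dhat_c {dhat_Lbar k j | k j. True}"

lemma independent_Lbar: "dhat.independent Lbar_basis"
  unfolding dhat.independent_explicit_finite_subsets
proof (intro allI impI ballI)
  fix T u assume T: "T \<subseteq> Lbar_basis" "finite T" "(\<Sum>v\<in>T. dhat_scale (u v) v) = 0"
  define T' where "T' = {v \<in> T - {dhat_c}. u v \<noteq> 0}"
  define lev where "lev v = (THE j. \<exists>k. v = dhat_Lbar k j)" for v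
  have lev: "lev (dhat_Lbar k j) = j" for k j
    unfolding lev_def by (rule the_equality) (use inj_Lbar in blast)+
  have "T' = {}"
  proof (rule ccontr)
    assume ne: "T' \<noteq> {}"
    have fin: "finite T'" using T(2) by (simp add: T'_def)
    have "Max (lev ` T') \<in> lev ` T'" using fin ne by (intro Max_in) auto
    then obtain b0 where b0': "b0 \<in> T'" "Max (lev ` T') = lev b0" by blast
    then have b0: "b0 \<in> T'" "\<And>b. b \<in> T' \<Longrightarrow> lev b \<le> lev b0"
      using Max_ge[of "lev ` T'"] fin by auto
    then obtain k0 j0 where kj: "b0 = dhat_Lbar k0 j0" using T(1) by (auto simp: T'_def)
    \<comment> \<open>As \<open>gen_poly k j\<close> has degree \<open>2 j + 1\<close> and
      \<open>j0\<close> is maximal, this functional vanishes on every other vector that occurs with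
      nonzero coefficient, and on \<open>c\<close>.\<close>
    let ?\<phi> = "\<lambda>v. coeff (Poly_Mapping.lookup (fst v) k0) (2 * j0 + 1)"
    have "?\<phi> (\<Sum>v\<in>T. dhat_scale (u v) v) = (\<Sum>v\<in>T. u v * ?\<phi> v)"
      by (simp add: fst_sum lookup_sum coeff_sum dhat_scale_def lookup_dop_scale)
    also have "\<dots> = (\<Sum>v\<in>T. if v = b0 then u b0 * ?\<phi> b0 else 0)"
    proof (rule sum.cong[OF refl])
      fix v assume v: "v \<in> T"
      show "u v * ?\<phi> v = (if v = b0 then u b0 * ?\<phi> b0 else 0)"
      proof (cases "v = b0 \<or> v = dhat_c \<or> u v = 0")
        case True
        then show ?thesis by (auto simp: dhat_c_def)
      next
        case False
        then have "v \<in> T'" using v by (simp add: T'_def)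
        moreover obtain k j where v: "v = dhat_Lbar k j" using False v T(1) by auto
        ultimately have "j \<le> j0" using b0(2)[of v] by (simp add: kj lev)
        moreover have "k \<noteq> k0 \<or> j \<noteq> j0" using False v kj by auto
        ultimately have "?\<phi> v = 0"
          unfolding v fst_Lbar by (auto simp: lookup_single when_def degree_gen_poly intro!: coeff_eq_0)
        then show ?thesis using False by simp
      qed
    qed
    also have "\<dots> = u b0 * ?\<phi> b0"
      using b0(1) T(2) by (simp add: T'_def)
    finally have "u b0 * ?\<phi> b0 = 0" using T(3) by simp
    moreover have "?\<phi> b0 = (-1) ^ Suc j0"
      using lead_coeff_gen_poly[of k0 j0] unfolding kj fst_Lbar degree_gen_poly by simp
    ultimately show False using b0(1) by (simp add: T'_def)
  qed
  then have z: "u v = 0" if "v \<in> T" "v \<noteq> dhat_c" for v using that unfolding T'_def by blast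
  fix v assume v: "v \<in> T"
  show "u v = 0"
  proof (cases "v = dhat_c")
    case True
    have "(\<Sum>v\<in>T. dhat_scale (u v) v) = (\<Sum>v\<in>T. if v = dhat_c then dhat_scale (u dhat_c) dhat_c else 0)"
      using z by (intro sum.cong) auto
    then have "dhat_scale (u dhat_c) dhat_c = 0" using T v True by simp
    moreover have "snd (dhat_scale a dhat_c) = a" for a
      by (simp add: dhat_scale_def dhat_c_def)
    ultimately show ?thesis using True by (metis snd_zero)
  next
    case False
    then show ?thesis by (rule z[OF v])
  qed
qed

text \<open>The coefficients of the polynomial expansion also match the central components, by
  \<open>central_term\<close>; linear independence then identifies them with
  \<open>struct_const\<close>.\<close>

lemma Lbar_bracket:
  "dhat_bracket (dhat_Lbar m r) (dhat_Lbar n s) =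
    (\<Sum>i=min r s..r+s. dhat_scale (struct_const r s m n i) (dhat_Lbar (m + n) i)) +
    dhat_scale ((fact (r + s + 1))\<^sup>2 / (2 * fact (2 * (r + s) + 3)) * of_int m ^ (2 * (r + s) + 3)
      * (if m + n = 0 then 1 else 0)) dhat_c"
proof -
  let ?Br = "bracket_poly m (gen_poly m r) n (gen_poly n s)" and ?I = "{min r s..r+s}"
  let ?z = "(fact (r + s + 1))\<^sup>2 / (2 * fact (2 * (r + s) + 3)) * of_int m ^ (2 * (r + s) + 3)
      * (if m + n = 0 then 1 else 0) :: complex"
  obtain c where c: "?Br = (\<Sum>i\<in>?I. smult (c i) (gen_poly (m + n) i))"
    using bracket_gen_poly_expansion by blast
  have br: "dhat_bracket (dhat_Lbar m r) (dhat_Lbar n s) =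
     (Poly_Mapping.single (m + n) ?Br, - (1/2) * psi_hom m (gen_poly m r) n (gen_poly n s))"
    by (simp add: dhat_bracket_def fst_Lbar dop_bracket_single Psi_single)
  have eq: "dhat_bracket (dhat_Lbar m r) (dhat_Lbar n s) =
     (\<Sum>i\<in>?I. dhat_scale (c i) (dhat_Lbar (m + n) i)) + dhat_scale ?z dhat_c"
  proof (rule prod_eqI)
    have "dop_scale a 0 = 0" for a by (simp add: dop_scale_def map_zero)
    moreover have "dop_scale a (Poly_Mapping.single k f) = Poly_Mapping.single k (smult a f)" for a k f
      by (rule poly_mapping_eqI) (simp add: lookup_dop_scale lookup_single when_def)
    moreover have "Poly_Mapping.single (m + n) (\<Sum>i\<in>I. f i) = (\<Sum>i\<in>I. Poly_Mapping.single (m + n) (f i))"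
      for I :: "nat set" and f :: "nat \<Rightarrow> complex poly"
      by (induction I rule: infinite_finite_induct) (simp_all add: single_add)
    ultimately show "fst (dhat_bracket (dhat_Lbar m r) (dhat_Lbar n s)) =
       fst ((\<Sum>i\<in>?I. dhat_scale (c i) (dhat_Lbar (m + n) i)) + dhat_scale ?z dhat_c)"
      unfolding br c by (simp add: fst_sum dhat_scale_def fst_Lbar dhat_c_def)
    show "snd (dhat_bracket (dhat_Lbar m r) (dhat_Lbar n s)) =
       snd ((\<Sum>i\<in>?I. dhat_scale (c i) (dhat_Lbar (m + n) i)) + dhat_scale ?z dhat_c)"
    proof (cases "m + n = 0")
      case True
      \<comment> \<open>The polynomial \<open>gen_poly 0 i\<close> is a monomial of degree
        \<open>2 i + 1\<close>, so its pairing is a zeta value, and the central shift in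
        \<open>dhat_Lbar\<close> is \<open>-1/2\<close> times it.\<close>
      have "pairing zeta_fps (smult (c i) (gen_poly 0 i)) = - 2 * (c i * snd (dhat_Lbar 0 i))" for i
        unfolding pairing_smult gen_poly_0 snd_Lbar
        by (subst pairing_zeta_fps_monom) simp_all
      moreover have "pairing zeta_fps (\<Sum>i\<in>I. f i) = (\<Sum>i\<in>I. pairing zeta_fps (f i))"
        for I :: "nat set" and f :: "nat \<Rightarrow> complex poly"
        by (induction I rule: infinite_finite_induct) (simp_all add: pairing_add)
      ultimately have "1/2 * pairing zeta_fps ?Br = - (\<Sum>i\<in>?I. c i * snd (dhat_Lbar 0 i))"
        unfolding c True by (simp add: sum_negf sum_distrib_left)
      moreover have "u = w + z" if "u + v = z" "v = - w" for u v w z :: complex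
        using that by (simp add: algebra_simps)
      ultimately have "- (1/2) * psi_hom m (gen_poly m r) n (gen_poly n s) =
          (\<Sum>i\<in>?I. c i * snd (dhat_Lbar 0 i)) + ?z"
        using central_term[OF True, of r s] True by (simp only: if_True mult_1_right simp_thms)
      then show ?thesis
        unfolding br using True by (simp add: snd_sum dhat_scale_def dhat_c_def)
    next
      case False
      then show ?thesis unfolding br
        by (simp add: snd_sum dhat_scale_def dhat_c_def snd_Lbar psi_hom_def)
    qed
  qed
  have L: "dhat_Lbar k j \<in> Lbar_basis" for k j by blast
  have sp: "dhat_Lbar k j \<in> dhat.span Lbar_basis" "dhat_c \<in> dhat.span Lbar_basis" for k j
    by (rule dhat.span_base, blast)+
  have "struct_const r s m n i = c i" if "i \<in> ?I" for i
  proof -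
    have "struct_const r s m n i = (\<Sum>j\<in>?I. c j * (if dhat_Lbar (m + n) i = dhat_Lbar (m + n) j then 1 else 0))"
    proof -
      have c: "dhat_c \<in> Lbar_basis" by blast
      have s1: "(\<Sum>i\<in>?I. dhat_scale (c i) (dhat_Lbar (m + n) i)) \<in> dhat.span Lbar_basis"
        "dhat_scale ?z dhat_c \<in> dhat.span Lbar_basis"
        "dhat_scale (c i) (dhat_Lbar (m + n) i) \<in> dhat.span Lbar_basis" for i
        by (intro dhat.span_sum dhat.span_scale sp)+
      show ?thesis
        unfolding struct_const_def eq dhat.representation_add[OF independent_Lbar s1(2,1)]
          dhat.representation_sum[OF independent_Lbar s1(3)] dhat.representation_scale[OF independent_Lbar sp(1)]
          dhat.representation_scale[OF independent_Lbar sp(2)] dhat.representation_basis[OF independent_Lbar L]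
          dhat.representation_basis[OF independent_Lbar c]
        using Lbar_neq_c[of "m + n" i] by simp
    qed
    also have "\<dots> = (\<Sum>j\<in>?I. if j = i then c i else 0)"
      using inj_Lbar by (intro sum.cong) auto
    finally show ?thesis using that by simp
  qed
  then show ?thesis unfolding eq by simp
qed

section \<open>The representations\<close>

context twisted_fock
begin

definition dop_rep :: "dop \<Rightarrow> 'v \<Rightarrow> 'v" where
  "dop_rep A v = (\<Sum>n\<in>Poly_Mapping.keys A. R n (Poly_Mapping.lookup A n) v)"

lemma dop_rep_eq: "finite F \<Longrightarrow> Poly_Mapping.keys A \<subseteq> F \<Longrightarrow> dop_rep A v = (\<Sum>n\<in>F. R n (Poly_Mapping.lookup A n) v)"
  unfolding dop_rep_def by (intro sum.mono_neutral_left) (auto simp: in_keys_iff R_poly_0)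

lemma dop_rep_add: "dop_rep (A + A') v = dop_rep A v + dop_rep A' v"
proof -
  let ?F = "Poly_Mapping.keys A \<union> Poly_Mapping.keys A'"
  have "Poly_Mapping.keys (A + A') \<subseteq> ?F" by (rule keys_add)
  then show ?thesis
    using dop_rep_eq[of ?F "A + A'" v] dop_rep_eq[of ?F A v] dop_rep_eq[of ?F A' v]
    by (simp add: lookup_add R_poly_add sum.distrib)
qed

lemma dop_rep_scale: "dop_rep (dop_scale c A) v = c \<odot> dop_rep A v"
proof -
  have "Poly_Mapping.keys (dop_scale c A) \<subseteq> Poly_Mapping.keys A"
    by (auto simp: in_keys_iff lookup_dop_scale)
  then show ?thesis
    using dop_rep_eq[of "Poly_Mapping.keys A" "dop_scale c A" v]
    by (simp add: lookup_dop_scale R_poly_smult dop_rep_def M.scale_sum_right)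
qed

lemma dop_rep_0: "dop_rep 0 v = 0"
  by (simp add: dop_rep_def)

lemma dop_rep_sum: "dop_rep (\<Sum>i\<in>I. f i) v = (\<Sum>i\<in>I. dop_rep (f i) v)"
  by (induction I rule: infinite_finite_induct) (simp_all add: dop_rep_add dop_rep_0)

lemma dop_rep_single: "dop_rep (Poly_Mapping.single n f) v = R n f v"
  by (simp add: dop_rep_def R_poly_0)

lemma linop_dop_rep: "linop (dop_rep A)"
  unfolding dop_rep_def[abs_def] by (intro linop_sum_fun linop_R)

lemma dop_rep_bracket:
  assumes "A \<in> Dplus" "A' \<in> Dplus"
  shows "dop_rep A (dop_rep A' v) - dop_rep A' (dop_rep A v) = dop_rep (dop_bracket A A') v + (- (of_nat d / 2) * Psi A A') \<odot> v"
proof -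
  let ?K = "Poly_Mapping.keys A" and ?K' = "Poly_Mapping.keys A'"
  let ?f = "Poly_Mapping.lookup A" and ?g = "Poly_Mapping.lookup A'"
  have "dop_rep A (dop_rep A' v) = (\<Sum>m\<in>?K. \<Sum>n\<in>?K'. R m (?f m) (R n (?g n) v))"
    unfolding dop_rep_def by (simp add: linop_sum[OF linop_R])
  moreover have "dop_rep A' (dop_rep A v) = (\<Sum>m\<in>?K. \<Sum>n\<in>?K'. R n (?g n) (R m (?f m) v))"
    unfolding dop_rep_def by (subst sum.swap) (simp add: linop_sum[OF linop_R])
  ultimately have "dop_rep A (dop_rep A' v) - dop_rep A' (dop_rep A v) =
      (\<Sum>m\<in>?K. \<Sum>n\<in>?K'. R m (?f m) (R n (?g n) v) - R n (?g n) (R m (?f m) v))"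
    by (simp add: sum_subtractf)
  also have "\<dots> = (\<Sum>m\<in>?K. \<Sum>n\<in>?K'. R (m + n) (bracket_poly m (?f m) n (?g n)) v
      + (- (of_nat d / 2) * psi_hom m (?f m) n (?g n)) \<odot> v)"
    using assms by (intro sum.cong refl R_commutator Dplus_reflective)
  also have "\<dots> = dop_rep (dop_bracket A A') v + (- (of_nat d / 2) * Psi A A') \<odot> v"
    unfolding dop_bracket_eq Psi_def dop_rep_sum dop_rep_single sum.distrib sum_distrib_left M.scale_sum_left ..
  finally show ?thesis .
qed

definition dhat_rep :: "dhat \<Rightarrow> 'v \<Rightarrow> 'v" where
  "dhat_rep x v = dop_rep (fst x) v + (snd x * of_nat d) \<odot> v"

lemma dhat_rep_add: "dhat_rep (x + y) v = dhat_rep x v + dhat_rep y v"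
  by (simp add: dhat_rep_def dop_rep_add M.scale_left_distrib ring_distribs)

lemma dhat_rep_scale: "dhat_rep (dhat_scale c x) v = c \<odot> dhat_rep x v"
  by (simp add: dhat_rep_def dhat_scale_def dop_rep_scale M.scale_right_distrib mult.assoc)

lemma dhat_rep_0: "dhat_rep 0 v = 0"
  by (simp add: dhat_rep_def dop_rep_0)

lemma dhat_rep_sum: "dhat_rep (\<Sum>i\<in>I. f i) v = (\<Sum>i\<in>I. dhat_rep (f i) v)"
  by (induction I rule: infinite_finite_induct) (simp_all add: dhat_rep_add dhat_rep_0)

lemma dhat_rep_bracket:
  assumes "x \<in> Dhat" "y \<in> Dhat"
  shows "dhat_rep (dhat_bracket x y) v = dhat_rep x (dhat_rep y v) - dhat_rep y (dhat_rep x v)"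
  using dop_rep_bracket[of "fst x" "fst y" v] assms
  by (auto simp: dhat_rep_def dhat_bracket_def Dhat_def linop_add[OF linop_dop_rep] linop_scale[OF linop_dop_rep]
      M.scale_right_distrib algebra_simps)

lemma lie_representation_dhat_rep: "lie_representation Dhat dhat_scale dhat_bracket (mscl S) dhat_rep"
proof -
  have "Vector_Spaces.linear (mscl S) (mscl S) (dhat_rep x)" for x
    by unfold_locales (simp_all add: dhat_rep_def linop_add[OF linop_dop_rep] linop_scale[OF linop_dop_rep]
        M.scale_right_distrib mult.commute)
  then show ?thesis
    unfolding lie_representation_def
    using M.vector_space_axioms dhat_rep_bracket dhat_rep_add dhat_rep_scale by blast
qed

lemma dhat_rep_c: "dhat_rep dhat_c = mscl S (of_nat d)"
  by (simp add: fun_eq_iff dhat_rep_def dhat_c_def dop_rep_0)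

section \<open>Comparison with the vertex operator coefficients\<close>

lemma quad_coeff_eq: "quad_coeff H S d \<alpha> r r n v = Q n (weight (gen_poly n r)) v"
proof -
  have "(let l = int p * n - k in (exp_factor H k r * exp_factor H l r) \<odot>
       normal_ordered H S (\<alpha> q) k (\<alpha> q) l v) =
     weight (gen_poly n r) k \<odot> nprod q k (int p * n - k) v" if q: "q \<in> {1..d}" for q k
  proof (cases "k = 0")
    case True
    then show ?thesis by (simp add: Let_def normal_ordered_def nprod_def mode_def[symmetric] a_0[OF q])
  next
    case False
    define x where "x = (of_int k / of_nat p :: complex)"
    have x: "x \<noteq> 0" using False p_pos by (simp add: x_def)
    have l: "frac_exp H (int p * n - k) = of_int n - x"
      using p_pos by (simp add: frac_exp_def x_def divide_simps)
    have pw: "(- y) ^ r = (-1) ^ r * y ^ r" for y :: complex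
      by (simp add: power_mult_distrib[symmetric])
    have s: "(-1 :: complex) ^ r * (-1) ^ r = 1"
      by (simp add: power_mult_distrib[symmetric])
    have "exp_factor H k r * exp_factor H (int p * n - k) r = (- x) ^ r * (- (of_int n - x)) ^ r"
      unfolding exp_factor_def l by (simp add: frac_exp_def x_def)
    also have "\<dots> = x ^ r * (of_int n - x) ^ r"
    proof -
      have "(- x) ^ r * (- (of_int n - x)) ^ r = ((-1) ^ r * (-1) ^ r) * (x ^ r * (of_int n - x) ^ r)"
        unfolding pw[of x] pw[of "of_int n - x"] by (simp only: mult_ac)
      then show ?thesis unfolding s by simp
    qed
    also have "\<dots> = weight (gen_poly n r) k"
    proof -
      have "poly (gen_poly n r) (- x) = ((-1) ^ r * (-1) ^ r) * x * (x ^ r * (of_int n - x) ^ r)"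
        unfolding poly_gen_poly by (simp add: pw[of x] mult_ac)
      then show ?thesis unfolding weight_def x_def[symmetric] s using x by simp
    qed
    finally show ?thesis by (simp add: Let_def normal_ordered_def nprod_def mode_def)
  qed
  then show ?thesis unfolding quad_coeff_def Q_def by (simp cong: sum.cong_simp)
qed

lemma one_minus_exp_nonzero: "1 - fps_to_fls (fps_exp (1 :: complex)) \<noteq> 0"
proof
  assume "1 - fps_to_fls (fps_exp (1 :: complex)) = 0"
  then have "fls_nth (1 - fps_to_fls (fps_exp (1 :: complex))) 1 = 0" by simp
  then show False by simp
qed

lemma exp_quotient_fls:
  "(fps_to_fls (fps_exp x) - 1) * c / (1 - fps_to_fls (fps_exp 1)) = c * fps_to_fls (twist_fps x)"
proof -
  have "fps_to_fls (twist_fps x) * (1 - fps_to_fls (fps_exp 1)) = fps_to_fls (fps_exp x) - 1"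
    using arg_cong[OF twist_fps_mult[of x], of fps_to_fls]
    by (simp add: fls_times_fps_to_fls)
  then show ?thesis using one_minus_exp_nonzero by (simp add: divide_eq_eq mult_ac)
qed

lemma inverse_exp_fls:
  "1 / (1 - fps_to_fls (fps_exp 1)) = fps_to_fls zeta_fps - fls_X_inv"
proof -
  have z: "fps_to_fls zeta_fps * (1 - fps_to_fls (fps_exp 1)) = 1 - fps_to_fls exp_quotient"
    using arg_cong[OF zeta_fps_mult, of fps_to_fls] by (simp add: fls_times_fps_to_fls)
  have "fls_X * fps_to_fls exp_quotient = fps_to_fls (fps_exp 1) - 1"
    using arg_cong[OF fps_X_mult_exp_quotient, of fps_to_fls] by (simp add: fls_times_fps_to_fls)
  then have "fls_X_inv * (fps_to_fls (fps_exp 1) - 1) = fps_to_fls exp_quotient"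
    by (metis fls_inverse_X fls_X_nonzero left_inverse mult.assoc mult_1)
  then have "(fps_to_fls zeta_fps - fls_X_inv) * (1 - fps_to_fls (fps_exp 1)) = 1"
    using z by (simp add: algebra_simps)
  then show ?thesis using one_minus_exp_nonzero by (simp add: divide_eq_eq)
qed

lemma scalar_series_eq:
  "scalar_series H = fls_const (1/2) * fls_deriv (\<Sum>k<p. of_nat (edim H (int k)) * fps_to_fls (twist_fps (of_nat k / of_nat p)))"
  unfolding scalar_series_def exp_quotient_fls by (simp add: frac_exp_def)

text \<open>Dropping the \<open>-1\<close> in each numerator adds the multiplicity times
  \<open>1/(1 - e^u)\<close>, and the multiplicities add up to \<open>d\<close>. The pole
  \<open>-1/u\<close> differentiates to the subtracted polar term.\<close>

lemma scalar_series_bar_eq: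
  "scalar_series_bar H d = scalar_series H + fls_const (1/2) * fls_deriv (of_nat d * (fps_to_fls zeta_fps - fls_X_inv))
     - fls_const (of_nat d / 2) * fls_X_intpow (- 2)"
proof -
  have "fps_to_fls (fps_exp x) * c / (1 - fps_to_fls (fps_exp 1)) =
     (fps_to_fls (fps_exp x) - 1) * c / (1 - fps_to_fls (fps_exp 1)) + c * (fps_to_fls zeta_fps - fls_X_inv)"
    for x :: complex and c
    unfolding inverse_exp_fls[symmetric] by (simp add: diff_divide_distrib left_diff_distrib)
  moreover have "(\<Sum>k<p. of_nat (edim H (int k)) * z) = of_nat d * (z :: complex fls)" for z
    unfolding sum_distrib_right[symmetric] of_nat_sum[symmetric] edim_sum ..
  ultimately show ?thesis
    unfolding scalar_series_bar_def scalar_series_def by (simp add: sum.distrib distrib_left)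
qed

lemma diff_coeff_diag: "diff_coeff F r r = (-1) ^ r * fact (2 * r) * fls_nth F (int (2 * r))"
proof -
  have "fact r * fact r * of_nat ((r + r) choose r) = (fact (2 * r) :: complex)"
    using binomial_fact_lemma[of r "r + r"] by (metis add_diff_cancel_left' le_add1 mult_2 of_nat_fact of_nat_mult)
  then show ?thesis unfolding diff_coeff_def by (simp add: mult_2[symmetric] mult_ac)
qed

lemma diff_coeff_deriv:
  "diff_coeff (fls_const (1/2) * fls_deriv F) r r = (-1) ^ r / 2 * fact (2 * r + 1) * fls_nth F (int (2 * r + 1))"
  unfolding diff_coeff_diag by (simp add: algebra_simps)

lemma diff_coeff_add: "diff_coeff (F + F') r r = diff_coeff F r r + diff_coeff F' r r"
  and diff_coeff_diff: "diff_coeff (F - F') r r = diff_coeff F r r - diff_coeff F' r r"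
  unfolding diff_coeff_diag by (simp_all add: ring_distribs)

lemma diff_coeff_scalar_series: "diff_coeff (scalar_series H) r r = vac_scalar p (edim H) (gen_poly 0 r)"
proof -
  have nth: "fls_nth (\<Sum>i\<in>I. of_nat (f i) * fps_to_fls (g i)) (int j) = (\<Sum>i\<in>I. of_nat (f i) * (g i $ j))"
    for I :: "nat set" and f and g :: "nat \<Rightarrow> complex fps" and j
    by (induction I rule: infinite_finite_induct) (simp_all add: fls_of_nat)
  show ?thesis
    unfolding scalar_series_eq diff_coeff_deriv nth vac_scalar_def gen_poly_0 pairing_monom
    by (simp add: sum_distrib_left mult_ac del: fact_Suc)
qed

lemma diff_coeff_scalar_series_bar:
  "diff_coeff (scalar_series_bar H d) r r =
     diff_coeff (scalar_series H) r r + of_nat d * ((-1) ^ r / 2 * riemann_zeta (- of_nat (2 * r + 1)))"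
proof -
  have nat: "nat (1 + int r * 2) = Suc (r * 2)" by simp
  have "riemann_zeta (- of_nat (2 * r + 1)) = fact (2 * r + 1) * zeta_fps $ (2 * r + 1)"
    using pairing_zeta_fps_monom[of "2 * r + 1" 1] by (simp add: pairing_monom del: fact_Suc of_nat_add)
  moreover have "diff_coeff (fls_const (of_nat d / 2) * fls_X_intpow (- 2)) r r = 0"
    unfolding diff_coeff_diag by simp
  ultimately show ?thesis
    unfolding scalar_series_bar_eq diff_coeff_add diff_coeff_diff diff_coeff_deriv
    using nat by (simp add: fls_of_nat mult_ac del: fact_Suc of_nat_add)
qed

lemma dhat_rep_L: "dhat_rep (dhat_L n r) = Ldiag H S d \<alpha> r n"
proof
  fix v
  have "dhat_rep (dhat_L n r) v = R n (gen_poly n r) v"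
    by (simp add: dhat_rep_def dhat_L_def Lgen_eq dop_rep_single)
  then show "dhat_rep (dhat_L n r) v = Ldiag H S d \<alpha> r n v"
    by (simp add: R_def Ldiag_def Lop_def quad_coeff_eq diff_coeff_scalar_series)
qed

lemma dhat_rep_Lbar: "dhat_rep (dhat_Lbar n r) = Ldiag_bar H S d \<alpha> r n"
proof
  fix v
  have "dhat_rep (dhat_Lbar n r) v = dhat_rep (dhat_L n r) v +
      (of_nat d * (if n = 0 then (-1) ^ r / 2 * riemann_zeta (- of_nat (2 * r + 1)) else 0)) \<odot> v"
    unfolding dhat_Lbar_def dhat_rep_add dhat_rep_scale dhat_rep_c by (simp add: mult_ac)
  then show "dhat_rep (dhat_Lbar n r) v = Ldiag_bar H S d \<alpha> r n v"
    unfolding dhat_rep_L Ldiag_def Lop_def Ldiag_bar_def Lop_bar_def diff_coeff_scalar_series_bar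
    by (simp add: M.scale_left_distrib add.assoc)
qed

lemma Lbar_in_Dhat: "dhat_Lbar n r \<in> Dhat"
  using Dplus_gen[of n r] by (simp add: Dhat_def mem_Times_iff fst_Lbar Lgen_eq)

lemma Ldiag_bar_commutator:
  "Ldiag_bar H S d \<alpha> r m (Ldiag_bar H S d \<alpha> s n v) - Ldiag_bar H S d \<alpha> s n (Ldiag_bar H S d \<alpha> r m v) =
    (\<Sum>i = min r s..r + s. struct_const r s m n i \<odot> Ldiag_bar H S d \<alpha> i (m + n) v) +
    ((fact (r + s + 1))\<^sup>2 / (2 * fact (2 * (r + s) + 3)) * of_int m ^ (2 * (r + s) + 3)
       * (if m + n = 0 then 1 else 0) * of_nat d) \<odot> v"
  unfolding dhat_rep_Lbar[symmetric] dhat_rep_bracket[OF Lbar_in_Dhat Lbar_in_Dhat, symmetric]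
    Lbar_bracket dhat_rep_add dhat_rep_sum dhat_rep_scale dhat_rep_c M.scale_scale ..

end

theorem theorem6p5:
  fixes H :: "'h::ab_group_add twisted_data"
    and S :: "('h hhat, 'v::ab_group_add) lie_module"
    and d :: nat and \<alpha> :: "nat \<Rightarrow> 'h"
  assumes "twisted_space H"
    and "d = vector_space.dim (scl H) UNIV"
    and "orthonormal_basis H d \<alpha>"
    and "\<exists>\<Lambda>. rational_lattice H \<Lambda> \<and> isom H ` \<Lambda> = \<Lambda>"
    and "is_S_nu H S"
  shows "(\<exists>\<rho>. lie_representation Dhat dhat_scale dhat_bracket (mscl S) \<rho> \<and>
            (\<forall>n r. \<rho> (dhat_L n r) = Ldiag H S d \<alpha> r n) \<and>
            \<rho> dhat_c = mscl S (of_nat d)) \<and>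
         (\<exists>\<rho>. lie_representation Dhat dhat_scale dhat_bracket (mscl S) \<rho> \<and>
            (\<forall>n r. \<rho> (dhat_Lbar n r) = Ldiag_bar H S d \<alpha> r n) \<and>
            \<rho> dhat_c = mscl S (of_nat d)) \<and>
         (\<forall>r s m n v.
            Ldiag_bar H S d \<alpha> r m (Ldiag_bar H S d \<alpha> s n v)
              - Ldiag_bar H S d \<alpha> s n (Ldiag_bar H S d \<alpha> r m v) =
            (\<Sum>i = min r s..r + s.
               mscl S (struct_const r s m n i) (Ldiag_bar H S d \<alpha> i (m + n) v)) +
            mscl S ((fact (r + s + 1))\<^sup>2 / (2 * fact (2 * (r + s) + 3))
                      * of_int m ^ (2 * (r + s) + 3)
                      * (if m + n = 0 then 1 else 0) * of_nat d) v)"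
proof -
  interpret twisted_fock H d \<alpha> S
    by unfold_locales (use assms in auto)
  show ?thesis
    using lie_representation_dhat_rep dhat_rep_L dhat_rep_Lbar dhat_rep_c Ldiag_bar_commutator by blast
qed

end
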